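(* Let $N\ge 3$, $1<p<N$, $p^\ast=\frac{Np}{N-p}$, let $\alpha,\beta>1$ with $\alpha+\beta=p^\ast$, let $\mu_1,\mu_2>0$, and let $\gamma<0$. Let $I$, $\mathcal{N}$, $A=\inf_{(u,v)\in\mathcal{N}}I(u,v)$ and $S$ be as defined in the context. Then $$A=\frac{1}{N}\Big(\mu_1^{-\frac{N-p}{p}}+\mu_2^{-\frac{N-p}{p}}\Big)S^{\frac{N}{p}},$$ and $A$ is not attained, i.e. there is no $(u,v)\in\mathcal{N}$ with $I(u,v)=A$.
   Context: $D^{1,p}(\mathbb{R}^N)=\{u\in L^{p^\ast}(\mathbb{R}^N):|\nabla u|\in L^p(\mathbb{R}^N)\}$ with norm $\|u\|_{D^{1,p}}=\big(\int_{\mathbb{R}^N}|\nabla u|^p\,dx\big)^{1/p}$, and $D=D^{1,p}(\mathbb{R}^N)\times D^{1,p}(\mathbb{R}^N)$. The sharp Sobolev constant is $$S=\inf_{u\in D^{1,p}(\mathbb{R}^N)\setminus\{0\}}\frac{\int_{\mathbb{R}^N}|\nabla u|^p\,dx}{\big(\int_{\mathbb{R}^N}|u|^{p^\ast}\,dx\big)^{p/p^\ast}}.$$ For $(u,v)\in D$, $$I(u,v)=\frac1p\int_{\mathbb{R}^N}\big(|\nabla u|^p+|\nabla v|^p\big)\,dx-\frac{1}{p^\ast}\int_{\mathbb{R}^N}\big(\mu_1|u|^{p^\ast}+\mu_2|v|^{p^\ast}+\gamma|u|^\alpha|v|^\beta\big)\,dx.$$ $\mathcal{N}$ is the set of $(u,v)\in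 D$ with $u\neq0$, $v\neq 0$ (as elements of $D^{1,p}(\mathbb{R}^N)$) such that $$\int_{\mathbb{R}^N}|\nabla u|^p=\int_{\mathbb{R}^N}\Big(\mu_1|u|^{p^\ast}+\frac{\alpha\gamma}{p^\ast}|u|^\alpha|v|^\beta\Big),\qquad \int_{\mathbb{R}^N}|\nabla v|^p=\int_{\mathbb{R}^N}\Big(\mu_2|v|^{p^\ast}+\frac{\beta\gamma}{p^\ast}|u|^\alpha|v|^\beta\Big).$$ *)

theory Defs
  imports "HOL-Analysis.Analysis"
begin

definition partial_deriv :: "'n::finite \<Rightarrow> (real ^ 'n \<Rightarrow> real) \<Rightarrow> real ^ 'n \<Rightarrow> real" where
  "partial_deriv i f x = frechet_derivative f (at x) (axis i 1)"

primrec C_k :: "nat \<Rightarrow> (real ^ 'n::finite \<Rightarrow> real) \<Rightarrow> bool" where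
  "C_k 0 f \<longleftrightarrow> continuous_on UNIV f"
| "C_k (Suc k) f \<longleftrightarrow> (\<forall>x. f differentiable (at x)) \<and> (\<forall>i. C_k k (partial_deriv i f))"

definition test_function :: "(real ^ 'n::finite \<Rightarrow> real) \<Rightarrow> bool" where
  "test_function \<phi> \<longleftrightarrow> (\<forall>k. C_k k \<phi>) \<and> compact (closure {x. \<phi> x \<noteq> 0})"

definition locally_integrable :: "(real ^ 'n::finite \<Rightarrow> 'b::euclidean_space) \<Rightarrow> bool" where
  "locally_integrable f \<longleftrightarrow> (\<forall>K. compact K \<longrightarrow> set_integrable lebesgue K f)"

definition has_weak_gradient ::
    "(real ^ 'n::finite \<Rightarrow> real) \<Rightarrow> (real ^ 'n \<Rightarrow> real ^ 'n) \<Rightarrow> bool" where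
  "has_weak_gradient u G \<longleftrightarrow>
     locally_integrable u \<and> locally_integrable G \<and>
     (\<forall>\<phi> i. test_function \<phi> \<longrightarrow>
        (LINT x|lebesgue. u x * partial_deriv i \<phi> x) = - (LINT x|lebesgue. G x $ i * \<phi> x))"

text \<open>Weak gradients are unique only up to null sets; everything below depends on the chosen
  representative only through integrals.\<close>

definition weak_grad :: "(real ^ 'n::finite \<Rightarrow> real) \<Rightarrow> real ^ 'n \<Rightarrow> real ^ 'n" where
  "weak_grad u = (SOME G. has_weak_gradient u G)"

definition in_Lp :: "real \<Rightarrow> (real ^ 'n::finite \<Rightarrow> 'b::euclidean_space) \<Rightarrow> bool" where
  "in_Lp q f \<longleftrightarrow>
     f \<in> borel_measurable lebesgue \<and> integrable lebesgue (\<lambda>x. norm (f x) powr q)"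

definition crit_exp :: "nat \<Rightarrow> real \<Rightarrow> real" where
  "crit_exp N p = real N * p / (real N - p)"

text \<open>Elements of the Lebesgue and Sobolev spaces are represented by functions instead of classes
  modulo almost-everywhere equality, so \<open>u \<noteq> 0\<close> as an element of the space is rendered as
  \<open>\<not> (AE x in lebesgue. u x = 0)\<close>.\<close>

definition D1p :: "real \<Rightarrow> (real ^ 'n::finite \<Rightarrow> real) set" where
  "D1p p = {u. in_Lp (crit_exp CARD('n) p) u \<and> (\<exists>G. has_weak_gradient u G \<and> in_Lp p G)}"

definition nonzero :: "(real ^ 'n::finite \<Rightarrow> real) \<Rightarrow> bool" where
  "nonzero u \<longleftrightarrow> \<not> (AE x in lebesgue. u x = 0)"

text \<open>Infima are conditionally complete ones on \<open>real\<close>. In the intended parameter range they are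
  genuine: both sets are nonempty and bounded below by 0 (on \<open>nehari\<close> the energy equals
  \<open>1/N\<close> times the total gradient integral).\<close>

definition sobolev_const :: "'n::finite itself \<Rightarrow> real \<Rightarrow> real" where
  "sobolev_const _ p =
     (INF u \<in> {u \<in> (D1p p :: (real ^ 'n \<Rightarrow> real) set). nonzero u}.
        (LINT x|lebesgue. norm (weak_grad u x) powr p) /
        (LINT x|lebesgue. \<bar>u x\<bar> powr crit_exp CARD('n) p) powr (p / crit_exp CARD('n) p))"

definition energy ::
    "real \<Rightarrow> real \<Rightarrow> real \<Rightarrow> real \<Rightarrow> real \<Rightarrow> real \<Rightarrow>
     (real ^ 'n::finite \<Rightarrow> real) \<Rightarrow> (real ^ 'n \<Rightarrow> real) \<Rightarrow> real" where
  "energy p \<alpha> \<beta> \<mu>\<^sub>1 \<mu>\<^sub>2 \<gamma> u v =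
     1 / p * (LINT x|lebesgue. norm (weak_grad u x) powr p + norm (weak_grad v x) powr p)
     - 1 / crit_exp CARD('n) p *
       (LINT x|lebesgue. \<mu>\<^sub>1 * \<bar>u x\<bar> powr crit_exp CARD('n) p
          + \<mu>\<^sub>2 * \<bar>v x\<bar> powr crit_exp CARD('n) p
          + \<gamma> * \<bar>u x\<bar> powr \<alpha> * \<bar>v x\<bar> powr \<beta>)"

definition nehari ::
    "real \<Rightarrow> real \<Rightarrow> real \<Rightarrow> real \<Rightarrow> real \<Rightarrow> real \<Rightarrow>
     ((real ^ 'n::finite \<Rightarrow> real) \<times> (real ^ 'n \<Rightarrow> real)) set" where
  "nehari p \<alpha> \<beta> \<mu>\<^sub>1 \<mu>\<^sub>2 \<gamma> =
     {(u, v). u \<in> D1p p \<and> v \<in> D1p p \<and> nonzero u \<and> nonzero v \<and>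
        (LINT x|lebesgue. norm (weak_grad u x) powr p) =
        (LINT x|lebesgue. \<mu>\<^sub>1 * \<bar>u x\<bar> powr crit_exp CARD('n) p
           + \<alpha> * \<gamma> / crit_exp CARD('n) p * \<bar>u x\<bar> powr \<alpha> * \<bar>v x\<bar> powr \<beta>) \<and>
        (LINT x|lebesgue. norm (weak_grad v x) powr p) =
        (LINT x|lebesgue. \<mu>\<^sub>2 * \<bar>v x\<bar> powr crit_exp CARD('n) p
           + \<beta> * \<gamma> / crit_exp CARD('n) p * \<bar>u x\<bar> powr \<alpha> * \<bar>v x\<bar> powr \<beta>)}"

definition least_energy ::
    "'n::finite itself \<Rightarrow> real \<Rightarrow> real \<Rightarrow> real \<Rightarrow> real \<Rightarrow> real \<Rightarrow> real \<Rightarrow> real" where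
  "least_energy _ p \<alpha> \<beta> \<mu>\<^sub>1 \<mu>\<^sub>2 \<gamma> =
     (INF (u, v) \<in> (nehari p \<alpha> \<beta> \<mu>\<^sub>1 \<mu>\<^sub>2 \<gamma> :: ((real ^ 'n \<Rightarrow> real) \<times> (real ^ 'n \<Rightarrow> real)) set).
        energy p \<alpha> \<beta> \<mu>\<^sub>1 \<mu>\<^sub>2 \<gamma> u v)"

end

theory Submission
  imports Defs
begin

text \<open>On the Nehari set the energy is \<open>1/N\<close> times the total gradient integral, and since
  \<open>\<gamma> < 0\<close> the Sobolev inequality bounds each of the two gradient integrals from below by
  \<open>\<mu>\<^sub>i powr (-(N-p)/p) * S powr (N/p)\<close>. Rescaled near-minimisers with disjoint supports show that the
  sum of these bounds is the infimum. If it were attained at \<open>(u, v)\<close>, then \<open>u v = 0\<close> almost everywhere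
  and \<open>u\<close> would be extremal for the Sobolev inequality.

  But an extremal \<open>u\<close> is nonzero almost everywhere. Comparing \<open>u\<close> with the competitor
  \<open>(|u|\<^sup>p + (\<epsilon> \<phi>)\<^sup>p) powr (1/p)\<close>, which has at least the mass of \<open>u\<close>, for a cutoff \<open>\<phi>\<close> that is 1 on
  a ball \<open>B\<close>, bounds the integral of \<open>|\<nabla>u|\<^sup>p / (|u|\<^sup>p + \<epsilon>\<^sup>p)\<close> over \<open>B\<close> independently of \<open>\<epsilon>\<close>. Hence
  \<open>ln (1 + u\<^sup>2 / \<epsilon>\<^sup>2)\<close> has gradients bounded in \<open>L\<^sup>1(B)\<close>, although it vanishes on the zero set of \<open>u\<close> and
  blows up elsewhere as \<open>\<epsilon>\<close> tends to 0; so one of the two sets is null.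

  Weak gradients are handled without mollifiers: testing against smooth functions identifies them with
  the limits in \<open>L\<^sup>1\<close> of difference quotients on balls, and this form passes through \<open>C\<^sup>1\<close> compositions.\<close>

section \<open>Smooth functions and cutoffs\<close>

text \<open>The delicate point is non-attainment: disjointness of \<open>u\<close> and
  \<open>v\<close> contradicts nothing unless an extremal cannot vanish on a set of positive
  measure. The comparison used for this needs no Euler-Lagrange equation. Combining \<open>u\<close>
  and \<psi> through the \<open>p\<close>-th powers of their values makes the two gradients enter
  with weights \<open>l powr (1 - 1 / p)\<close> and \<open>m powr (1 - 1 / p)\<close>, where
  \<open>l + m \<le> 1\<close>. Hoelder then gives |grad W|^p \<le> |grad u|^p + |grad \<psi>|^p
  with constant exactly 1. For \<psi> = \<epsilon> \<phi> the cost is thus at most \<epsilon>^p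
  times a fixed number, while on the plateau of \<phi>, where the second gradient is 0, the weight
  \<open>l\<close> < 1 saves a term that also carries the factor \<epsilon>^p. The factor cancels,
  which is why the resulting bound does not depend on \<epsilon>.

  The value S = 0 is treated as a case of its own: the lower bounds are then 0, and attaining them
  would contradict the positivity of the gradient integral of a nonzero function, which is proved
  through translation invariance.\<close>

lemma frechet_derivative_worksI:
  "f differentiable F \<Longrightarrow> (f has_derivative frechet_derivative f F) F"
  by (simp add: frechet_derivative_works)

lemma partial_deriv_eq:
  "(f has_derivative f') (at x) \<Longrightarrow> partial_deriv i f x = f' (axis i 1)"
  unfolding partial_deriv_def using frechet_derivative_at by metis

lemma C_k_differentiable: "C_k (Suc k) f \<Longrightarrow> f differentiable (at x)"
  by simp

lemma C_k_SucD: "C_k (Suc k) f \<Longrightarrow> C_k k f"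
proof (induction k arbitrary: f)
  case 0
  then show ?case
    by (auto simp: continuous_on_eq_continuous_within intro!: differentiable_imp_continuous_within)
next
  case (Suc k)
  then show ?case by (metis C_k.simps(2))
qed

lemma C_k_const: "C_k k (\<lambda>x :: real ^ 'n::finite. c)"
proof (induction k arbitrary: c)
  case (Suc k)
  have "partial_deriv i (\<lambda>x :: real ^ 'n. c) = (\<lambda>x. 0)" for i
    by (rule ext, subst partial_deriv_eq[OF has_derivative_const]) simp
  then show ?case using Suc[of 0] by simp
qed auto

lemma C_k_linear:
  assumes "bounded_linear f" shows "C_k k f"
proof (cases k)
  case 0
  then show ?thesis using assms by (simp add: linear_continuous_on)
next
  case (Suc m)
  have d: "(f has_derivative f) (at x)" for x
    using assms by (rule bounded_linear_imp_has_derivative)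
  have "partial_deriv i f = (\<lambda>x. f (axis i 1))" for i
    by (rule ext, subst partial_deriv_eq[OF d]) simp
  then show ?thesis using Suc d C_k_const by (auto simp: differentiable_def)
qed

lemma C_k_add:
  "C_k k f \<Longrightarrow> C_k k g \<Longrightarrow> C_k k (\<lambda>x. f x + g x)"
proof (induction k arbitrary: f g)
  case 0
  then show ?case by (auto intro: continuous_on_add)
next
  case (Suc k)
  have d: "f differentiable (at x)" "g differentiable (at x)" for x
    using Suc.prems by auto
  have "partial_deriv i (\<lambda>x. f x + g x) = (\<lambda>x. partial_deriv i f x + partial_deriv i g x)" for i
  proof
    fix x
    show "partial_deriv i (\<lambda>x. f x + g x) x = partial_deriv i f x + partial_deriv i g x"
      using partial_deriv_eq[OF has_derivative_add[OF d[THEN frechet_derivative_worksI]]]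
      by (simp add: partial_deriv_def)
  qed
  then show ?case using Suc d by auto
qed

lemma C_k_mult:
  "C_k k f \<Longrightarrow> C_k k g \<Longrightarrow> C_k k (\<lambda>x. f x * g x)"
proof (induction k arbitrary: f g)
  case 0
  then show ?case by (auto intro: continuous_on_mult)
next
  case (Suc k)
  have d: "f differentiable (at x)" "g differentiable (at x)" for x
    using Suc.prems by auto
  have "partial_deriv i (\<lambda>x. f x * g x)
      = (\<lambda>x. f x * partial_deriv i g x + partial_deriv i f x * g x)" for i
  proof
    fix x
    show "partial_deriv i (\<lambda>x. f x * g x) x = f x * partial_deriv i g x + partial_deriv i f x * g x"
      using partial_deriv_eq[OF has_derivative_mult[OF d[THEN frechet_derivative_worksI]]]
      by (simp add: partial_deriv_def)
  qed
  moreover have "C_k k f" "C_k k g"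
    using Suc.prems C_k_SucD by blast+
  ultimately show ?case using Suc d by (auto intro!: C_k_add)
qed

lemma partial_deriv_shift:
  "partial_deriv i (\<lambda>x. f (x + a)) x = partial_deriv i f (x + a)" if "f differentiable (at (x + a))"
proof -
  have "((\<lambda>x. f (x + a)) has_derivative frechet_derivative f (at (x + a))) (at x)"
    using has_derivative_compose[OF has_derivative_add[OF has_derivative_ident has_derivative_const]
        frechet_derivative_worksI[OF that]] by simp
  from partial_deriv_eq[OF this] show ?thesis
    by (simp add: partial_deriv_def)
qed

lemma differentiable_shift:
  fixes f :: "'a::real_normed_vector \<Rightarrow> 'b::real_normed_vector"
  shows "f differentiable (at (x + a)) \<Longrightarrow> (\<lambda>x. f (x + a)) differentiable (at x)"
  using differentiable_chain_at[of "\<lambda>x. x + a" x f] by (simp add: o_def)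

lemma C_k_shift: "C_k k f \<Longrightarrow> C_k k (\<lambda>x. f (x + a))"
proof (induction k arbitrary: f)
  case 0
  then show ?case by (auto intro!: continuous_on_compose2[of UNIV f] continuous_intros)
next
  case (Suc k)
  then have "partial_deriv i (\<lambda>x. f (x + a)) = (\<lambda>x. partial_deriv i f (x + a))" for i
    by (auto simp: partial_deriv_shift)
  then show ?case using Suc by (auto simp: differentiable_shift)
qed

text \<open>The witness \<open>D\<close> lists all derivatives of \<open>f\<close>, so that an
  induction can pass from \<open>D j\<close> to \<open>D (Suc j)\<close> without naming
  them.\<close>

definition smooth_real :: "(real \<Rightarrow> real) \<Rightarrow> bool" where
  "smooth_real f \<longleftrightarrow> (\<exists>D. D 0 = f \<and> (\<forall>k t. (D k has_real_derivative D (Suc k) t) (at t)))"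

text \<open>Generalised over \<open>j\<close>, because the partial derivatives of \<open>D j\<close>
  after \<open>g\<close> contain \<open>D (Suc j)\<close> after \<open>g\<close>.\<close>

lemma C_k_compose:
  assumes D: "\<And>k t. (D k has_real_derivative D (Suc k) t) (at t)"
  shows "C_k k g \<Longrightarrow> C_k k (\<lambda>x. D j (g x))"
proof (induction k arbitrary: g j)
  case 0
  have "continuous_on UNIV (D j)"
    using D by (meson DERIV_continuous continuous_at_imp_continuous_on)
  with 0 show ?case by (auto intro: continuous_on_compose2)
next
  case (Suc k)
  have dg: "g differentiable (at x)" for x using Suc.prems by auto
  have d: "((\<lambda>x. D j (g x)) has_derivative (\<lambda>h. D (Suc j) (g x) * frechet_derivative g (at x) h)) (at x)" for x
    using has_derivative_compose[OF frechet_derivative_worksI[OF dg[of x]]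
        D[of j "g x", unfolded has_field_derivative_def]] by simp
  have "partial_deriv i (\<lambda>x. D j (g x)) = (\<lambda>x. D (Suc j) (g x) * partial_deriv i g x)" for i
    by (rule ext, subst partial_deriv_eq[OF d]) (simp add: partial_deriv_def)
  moreover have "C_k k g" using Suc.prems C_k_SucD by blast
  moreover have "(\<lambda>x. D j (g x)) differentiable (at x)" for x
    using d by (auto simp: differentiable_def)
  ultimately show ?case using Suc by (auto intro!: C_k_mult)
qed

lemma C_k_smooth_compose: "smooth_real f \<Longrightarrow> \<forall>k. C_k k g \<Longrightarrow> \<forall>k. C_k k (\<lambda>x. f (g x))"
  unfolding smooth_real_def using C_k_compose by metis

lemma C_k_polynomial:
  "real_polynomial_function f \<Longrightarrow> C_k k (f :: real ^ 'n \<Rightarrow> real)"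
  by (induction rule: real_polynomial_function.induct)
     (auto intro: C_k_linear C_k_const C_k_add C_k_mult)

section \<open>Flat exponentials and the smooth cutoff\<close>

text \<open>For \<open>P = 1\<close> this is the classical flat function exp (-1/t). The polynomial
  factor makes the family closed under differentiation, so smoothness needs only a first
  derivative.\<close>

definition exp_poly :: "real poly \<Rightarrow> real \<Rightarrow> real" where
  "exp_poly P t = (if t > 0 then poly P (1 / t) * exp (- (1 / t)) else 0)"

lemma poly_times_exp_tendsto_0: "((\<lambda>s. poly P s * exp (- s)) \<longlongrightarrow> 0) (at_top :: real filter)"
proof -
  have "((\<lambda>s. coeff P i * (s ^ i / exp s)) \<longlongrightarrow> 0) at_top" for i
    by (rule tendsto_mult_right_zero[OF tendsto_power_div_exp_0])
  then have "((\<lambda>s. \<Sum>i\<le>degree P. coeff P i * (s ^ i / exp s)) \<longlongrightarrow> (\<Sum>i\<le>degree P. 0)) at_top"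
    by (intro tendsto_sum) auto
  also have "(\<lambda>s. \<Sum>i\<le>degree P. coeff P i * (s ^ i / exp s)) = (\<lambda>s. poly P s * exp (- s))"
    by (simp add: poly_altdef sum_distrib_right exp_minus divide_inverse mult.assoc)
  finally show ?thesis by simp
qed

lemma exp_poly_tendsto_0: "(exp_poly P \<longlongrightarrow> 0) (at 0)"
proof -
  have "(exp_poly P \<longlongrightarrow> 0) (at_right 0)"
  proof -
    have "((\<lambda>t. poly P (inverse t) * exp (- inverse t)) \<longlongrightarrow> 0) (at_right 0)"
      using filterlim_compose[OF poly_times_exp_tendsto_0 filterlim_inverse_at_top_right] .
    moreover have "\<forall>\<^sub>F t in at_right 0. poly P (inverse t) * exp (- inverse t) = exp_poly P t"
      by (auto simp: eventually_at_filter exp_poly_def field_simps)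
    ultimately show ?thesis using Lim_transform_eventually by blast
  qed
  moreover have "(exp_poly P \<longlongrightarrow> 0) (at_left 0)"
  proof -
    have "\<forall>\<^sub>F t in at_left 0. (0::real) = exp_poly P t"
      by (auto simp: eventually_at_filter exp_poly_def)
    then show ?thesis using Lim_transform_eventually tendsto_const by blast
  qed
  ultimately show ?thesis by (simp add: filterlim_split_at)
qed

text \<open>With s = 1/t, differentiating P(s) exp(-s) in t multiplies the s-derivative by -s^2,
  which gives s^2 (P - P')(s) exp(-s).\<close>

lemma exp_poly_deriv:
  "(exp_poly P has_real_derivative exp_poly ([:0, 0, 1:] * (P - pderiv P)) t) (at t)"
proof -
  consider "t > 0" | "t < 0" | "t = 0" by linarith
  then show ?thesis
  proof cases
    case 1
    have "((\<lambda>t. poly P (1 / t) * exp (- (1 / t))) has_real_derivative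
        exp_poly ([:0, 0, 1:] * (P - pderiv P)) t) (at t)"
      using 1 by (auto intro!: derivative_eq_intros DERIV_chain'[OF _ poly_DERIV]
          simp: exp_poly_def field_simps power2_eq_square)
    moreover have "\<forall>\<^sub>F x in nhds t. poly P (1 / x) * exp (- (1 / x)) = exp_poly P x"
      using eventually_nhds_in_open[of "{0<..}" t] 1
      by (auto simp: exp_poly_def elim: eventually_mono)
    ultimately show ?thesis
      by (subst (asm) DERIV_cong_ev[OF refl _ refl])
next
    case 2
    have "((\<lambda>t. 0) has_real_derivative exp_poly ([:0, 0, 1:] * (P - pderiv P)) t) (at t)"
      using 2 by (simp add: exp_poly_def)
    moreover have "\<forall>\<^sub>F x in nhds t. 0 = exp_poly P x"
      using eventually_nhds_in_open[of "{..<0}" t] 2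
      by (auto simp: exp_poly_def elim: eventually_mono)
    ultimately show ?thesis
      by (subst (asm) DERIV_cong_ev[OF refl _ refl])
  next
    case 3
    \<comment> \<open>At 0, dividing by \<open>h\<close> multiplies the polynomial by its variable,
      so the difference quotient is again a member of the family and tends to 0.\<close>
    have eq: "(\<lambda>h. (exp_poly P (0 + h) - exp_poly P 0) / h) = exp_poly ([:0, 1:] * P)"
      by (auto simp: exp_poly_def fun_eq_iff)
    show ?thesis
      unfolding 3 DERIV_def eq using exp_poly_tendsto_0 by (simp add: exp_poly_def)
  qed
qed

lemma smooth_exp_poly: "smooth_real (exp_poly P)"
  unfolding smooth_real_def
  by (rule exI[of _ "\<lambda>k. exp_poly (((\<lambda>P. [:0, 0, 1:] * (P - pderiv P)) ^^ k) P)"])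
     (auto simp del: mult_pCons_left intro: exp_poly_deriv)

text \<open>The plateau ends at norm \<open>r\<close>, where the inner \<open>exp (-1/t)\<close> becomes positive; since
  \<open>exp (-1) > 1/4\<close>, the outer argument is negative from norm \<open>2 * r\<close> on.\<close>

definition cutoff :: "real \<Rightarrow> real ^ 'n::finite \<Rightarrow> real" where
  "cutoff r x = exp_poly 1 (1 / 4 - exp_poly 1 ((norm x / r)\<^sup>2 - 1)) / exp_poly 1 (1 / 4)"

text \<open>Only the squared norm enters, a polynomial in the coordinates, so the origin is no
  exception; the rest is composition with \<open>exp_poly 1\<close>.\<close>

lemma cutoff_smooth: "r > 0 \<Longrightarrow> \<forall>k. C_k k (cutoff r :: real ^ 'n::finite \<Rightarrow> real)"
proof -
  assume r: "r > 0"
  have "real_polynomial_function (\<lambda>x::real^'n. (\<Sum>i\<in>UNIV. (x $ i) * (x $ i)) * (1 / r\<^sup>2) + (- 1))"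
    by (intro real_polynomial_function.intros real_polynomial_function_sum bounded_linear_vec_nth) auto
  moreover have "(\<Sum>i\<in>UNIV. (x $ i) * (x $ i)) * (1 / r\<^sup>2) + (- 1) = (norm x / r)\<^sup>2 - 1" for x :: "real ^ 'n"
    by (simp add: power_divide power2_norm_eq_inner inner_vec_def)
  ultimately have "\<forall>k. C_k k (\<lambda>x::real^'n. (norm x / r)\<^sup>2 - 1)"
    using C_k_polynomial by fastforce
  then have "\<forall>k. C_k k (\<lambda>x::real^'n. exp_poly 1 ((norm x / r)\<^sup>2 - 1))"
    by (rule C_k_smooth_compose[OF smooth_exp_poly])
  then have "\<forall>k. C_k k (\<lambda>x::real^'n. 1 / 4 + (- 1) * exp_poly 1 ((norm x / r)\<^sup>2 - 1))"
    by (intro allI C_k_add C_k_mult C_k_const) auto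
  then have "\<forall>k. C_k k (\<lambda>x::real^'n. exp_poly 1 (1 / 4 + (- 1) * exp_poly 1 ((norm x / r)\<^sup>2 - 1)))"
    by (rule C_k_smooth_compose[OF smooth_exp_poly])
  then have "\<forall>k. C_k k (\<lambda>x::real^'n. exp_poly 1 (1 / 4 + (- 1) * exp_poly 1 ((norm x / r)\<^sup>2 - 1)) * (1 / exp_poly 1 (1 / 4)))"
    by (intro allI C_k_mult C_k_const) auto
  moreover have "(\<lambda>x::real^'n. exp_poly 1 (1 / 4 + (- 1) * exp_poly 1 ((norm x / r)\<^sup>2 - 1)) * (1 / exp_poly 1 (1 / 4))) = cutoff r"
    by (simp add: cutoff_def fun_eq_iff)
  ultimately show ?thesis by simp
qed

lemma exp_poly_1_mono: "s \<le> t \<Longrightarrow> exp_poly 1 s \<le> exp_poly 1 t"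
  by (auto simp: exp_poly_def frac_le)

lemma exp_poly_1_nonneg: "0 \<le> exp_poly 1 t"
  by (auto simp: exp_poly_def)

lemma exp_poly_quarter_pos: "0 < exp_poly 1 (1 / 4)"
  by (auto simp: exp_poly_def)

lemma cutoff_bounds: "0 \<le> cutoff r x" "cutoff r x \<le> 1" "\<bar>cutoff r x\<bar> \<le> 1"
proof -
  have "exp_poly 1 (1 / 4 - exp_poly 1 ((norm x / r)\<^sup>2 - 1)) \<le> exp_poly 1 (1 / 4)"
    by (rule exp_poly_1_mono) (simp add: exp_poly_1_nonneg)
  then show "cutoff r x \<le> 1"
    using exp_poly_quarter_pos by (simp add: cutoff_def)
  show "0 \<le> cutoff r x"
    using exp_poly_quarter_pos by (simp add: cutoff_def exp_poly_1_nonneg)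
  then show "\<bar>cutoff r x\<bar> \<le> 1" using \<open>cutoff r x \<le> 1\<close> by simp
qed

lemma cutoff_eq_1: "r > 0 \<Longrightarrow> norm x \<le> r \<Longrightarrow> cutoff r x = 1"
proof -
  assume "r > 0" "norm x \<le> r"
  then have "(norm x / r)\<^sup>2 \<le> 1" by (simp add: power_le_one)
  then show ?thesis using exp_poly_quarter_pos by (simp add: cutoff_def exp_poly_def)
qed

lemma cutoff_eq_0: "r > 0 \<Longrightarrow> norm x \<ge> 2 * r \<Longrightarrow> cutoff r x = 0"
proof -
  assume r: "r > 0" "norm x \<ge> 2 * r"
  then have "2 \<le> norm x / r" by (simp add: field_simps)
  then have "2\<^sup>2 \<le> (norm x / r)\<^sup>2" by (intro power_mono) auto
  then have "exp_poly 1 1 \<le> exp_poly 1 ((norm x / r)\<^sup>2 - 1)"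
    by (intro exp_poly_1_mono) simp
  moreover have "exp_poly 1 1 \<ge> 1 / 4"
    using exp_le by (simp add: exp_poly_def exp_minus field_simps)
  ultimately show ?thesis by (simp add: cutoff_def exp_poly_def)
qed

lemma cutoff_scale: "r > 0 \<Longrightarrow> cutoff r x = cutoff 1 (x /\<^sub>R r)"
  by (simp add: cutoff_def field_simps)

section \<open>Test functions and approximation in \<open>L\<^sup>1\<close>\<close>

lemma eventually_le_real: "\<forall>\<^sub>F n in sequentially. c \<le> real n"
  using filterlim_real_sequentially by (simp add: filterlim_at_top)

section \<open>Classical gradients of test functions\<close>

definition tgrad :: "(real ^ 'n::finite \<Rightarrow> real) \<Rightarrow> real ^ 'n \<Rightarrow> real ^ 'n" where
  "tgrad f x = (\<chi> i. partial_deriv i f x)"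

lemma tgrad_has_derivative:
  assumes "f differentiable (at x)"
  shows "(f has_derivative (\<lambda>h. tgrad f x \<bullet> h)) (at x)"
proof -
  let ?D = "frechet_derivative f (at x)"
  have D: "(f has_derivative ?D) (at x)"
    using assms by (rule frechet_derivative_worksI)
  then interpret linear ?D by (rule has_derivative_linear)
  have "?D h = tgrad f x \<bullet> h" for h
  proof -
    have "?D h = ?D (\<Sum>i\<in>UNIV. h $ i *\<^sub>R axis i 1)"
      by (simp add: basis_expansion flip: scalar_mult_eq_scaleR)
    also have "\<dots> = (\<Sum>i\<in>UNIV. h $ i * ?D (axis i 1))"
      by (simp add: sum scaleR)
    finally show ?thesis
      by (simp add: tgrad_def inner_vec_def partial_deriv_def mult.commute)
  qed
  then have "?D = (\<lambda>h. tgrad f x \<bullet> h)" by (rule ext)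
  then show ?thesis using D by simp
qed

lemma tgrad_eqI:
  assumes "(f has_derivative (\<lambda>h. g \<bullet> h)) (at x)"
  shows "tgrad f x = g"
  by (simp add: tgrad_def partial_deriv_eq[OF assms] inner_axis vec_eq_iff)

lemma test_functionI:
  assumes "\<And>k. C_k k \<phi>" "\<And>x. norm x \<ge> r \<Longrightarrow> \<phi> x = 0"
  shows "test_function \<phi>"
proof -
  have "{x. \<phi> x \<noteq> 0} \<subseteq> cball 0 r"
    using assms(2) by (force simp: not_le intro: less_imp_le)
  then have "closure {x. \<phi> x \<noteq> 0} \<subseteq> cball 0 r"
    by (simp add: closure_minimal)
  then show ?thesis
    using assms(1) unfolding test_function_def
    by (meson bounded_cball bounded_subset closed_closure compact_eq_bounded_closed)
qed

lemma test_function_support: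
  assumes "test_function \<phi>"
  shows "\<exists>r>0. \<forall>x. norm x \<ge> r \<longrightarrow> \<phi> x = 0"
proof -
  have "bounded (closure {x. \<phi> x \<noteq> 0})"
    using assms by (simp add: test_function_def compact_imp_bounded)
  then obtain B where "B > 0" "\<And>x. x \<in> closure {x. \<phi> x \<noteq> 0} \<Longrightarrow> norm x \<le> B"
    by (auto simp: bounded_pos)
  then show ?thesis
    using closure_subset[of "{x. \<phi> x \<noteq> 0}"] by (intro exI[of _ "B + 1"]) force
qed

context
  fixes \<phi> :: "real ^ 'n::finite \<Rightarrow> real"
  assumes test: "test_function \<phi>"
begin

lemma test_differentiable: "\<phi> differentiable (at x)"
  using test C_k_differentiable[of 0 \<phi>] unfolding test_function_def by blast

lemma test_has_derivative: "(\<phi> has_derivative (\<lambda>h. tgrad \<phi> x \<bullet> h)) (at x)"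
  by (rule tgrad_has_derivative[OF test_differentiable])

text \<open>Along a sequence instead of the filter at 0, as dominated convergence requires.\<close>

lemma test_directional_limit:
  assumes X: "X \<longlonglongrightarrow> 0" "\<And>n. X n \<noteq> 0"
  shows "(\<lambda>n. (\<phi> (x + X n *\<^sub>R h) - \<phi> x) / X n) \<longlonglongrightarrow> tgrad \<phi> x \<bullet> h"
proof -
  have "((\<lambda>t. x + t *\<^sub>R h) has_derivative (\<lambda>t. t *\<^sub>R h)) (at 0)"
    by (auto intro!: derivative_eq_intros)
  moreover have "(\<phi> has_derivative (\<lambda>h. tgrad \<phi> x \<bullet> h)) (at (x + 0 *\<^sub>R h))"
    using test_has_derivative by simp
  ultimately have "((\<lambda>t. \<phi> (x + t *\<^sub>R h)) has_derivative (\<lambda>t. tgrad \<phi> x \<bullet> (t *\<^sub>R h))) (at 0)"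
    by (rule has_derivative_compose)
  then have "((\<lambda>t. \<phi> (x + t *\<^sub>R h)) has_real_derivative tgrad \<phi> x \<bullet> h) (at 0)"
    by (simp add: has_field_derivative_def mult_commute_abs)
  then have "((\<lambda>t. (\<phi> (x + t *\<^sub>R h) - \<phi> x) / t) \<longlongrightarrow> tgrad \<phi> x \<bullet> h) (at 0)"
    by (simp add: DERIV_def)
  moreover have "filterlim X (at 0) sequentially"
    using X by (simp add: filterlim_at)
  ultimately show ?thesis by (rule filterlim_compose)
qed

lemma test_continuous: "continuous_on UNIV \<phi>"
  using test C_k.simps(1)[of \<phi>] unfolding test_function_def by blast

lemma test_partial_deriv_continuous: "continuous_on UNIV (partial_deriv i \<phi>)"
  using test C_k.simps(2)[of 0 \<phi>] C_k.simps(1) unfolding test_function_def by blast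

lemma tgrad_continuous: "continuous_on UNIV (tgrad \<phi>)"
  unfolding tgrad_def using test_partial_deriv_continuous by (intro continuous_intros)

lemma tgrad_support:
  assumes "\<And>x. norm x \<ge> r \<Longrightarrow> \<phi> x = 0" "norm x > r"
  shows "tgrad \<phi> x = 0"
proof (rule tgrad_eqI)
  have "open {x::real^'n. norm x > r}"
    by (intro open_Collect_less continuous_intros)
  moreover have "((\<lambda>x. 0) has_derivative (\<lambda>h. 0 \<bullet> h)) (at x)"
    by simp
  ultimately show "(\<phi> has_derivative (\<lambda>h. 0 \<bullet> h)) (at x)"
    using assms
    by (elim has_derivative_transform_within_open) (auto intro: less_imp_le)
qed

lemma tgrad_bounded:
  "\<exists>L>0. \<forall>x. norm (tgrad \<phi> x) \<le> L"
proof -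
  obtain r where r: "r > 0" "\<And>x. norm x \<ge> r \<Longrightarrow> \<phi> x = 0"
    using test_function_support[OF test] by blast
  have "compact (tgrad \<phi> ` cball 0 r)"
    by (intro compact_continuous_image continuous_on_subset[OF tgrad_continuous]) auto
  then have "bounded (tgrad \<phi> ` cball 0 r)" by (rule compact_imp_bounded)
  then obtain L where L: "L > 0" "\<forall>y\<in>tgrad \<phi> ` cball 0 r. norm y \<le> L"
    unfolding bounded_pos by blast
  have "norm (tgrad \<phi> x) \<le> L" for x
    using L tgrad_support[OF r(2)] by (cases "norm x \<le> r") auto
  then show ?thesis using L by blast
qed

lemma test_lipschitz:
  assumes "\<And>x. norm (tgrad \<phi> x) \<le> L"
  shows "\<bar>\<phi> x - \<phi> y\<bar> \<le> L * norm (x - y)"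
proof -
  have "norm (\<phi> x - \<phi> y) \<le> L * norm (x - y)"
  proof (rule differentiable_bound[of UNIV])
    fix z
    have "onorm (\<lambda>h. tgrad \<phi> z \<bullet> h) \<le> norm (tgrad \<phi> z)"
      by (rule onorm_le) (simp add: Cauchy_Schwarz_ineq2)
    with assms[of z] show "onorm (\<lambda>h. tgrad \<phi> z \<bullet> h) \<le> L" by linarith
  qed (use test_has_derivative in auto)
  then show ?thesis by simp
qed

lemma test_bounded:
  "\<exists>L>0. \<forall>x. \<bar>\<phi> x\<bar> \<le> L"
proof -
  obtain r where r: "r > 0" "\<And>x. norm x \<ge> r \<Longrightarrow> \<phi> x = 0"
    using test_function_support[OF test] by blast
  have "compact (\<phi> ` cball 0 r)"
    by (intro compact_continuous_image continuous_on_subset[OF test_continuous]) auto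
  then have "bounded (\<phi> ` cball 0 r)" by (rule compact_imp_bounded)
  then obtain L where L: "L > 0" "\<forall>y\<in>\<phi> ` cball 0 r. norm y \<le> L"
    unfolding bounded_pos by blast
  have "\<bar>\<phi> x\<bar> \<le> L" for x
    using L r by (cases "norm x \<le> r") auto
  then show ?thesis using L by blast
qed

lemma test_shift: "test_function (\<lambda>x. \<phi> (x + a))"
proof -
  obtain r where r: "r > 0" "\<And>x. norm x \<ge> r \<Longrightarrow> \<phi> x = 0"
    using test_function_support[OF test] by blast
  show ?thesis
  proof (rule test_functionI[of _ "r + norm a"])
    show "C_k k (\<lambda>x. \<phi> (x + a))" for k
      using test by (intro C_k_shift) (simp_all add: test_function_def)
    show "\<phi> (x + a) = 0" if "r + norm a \<le> norm x" for x
      using that norm_diff_ineq[of x a] by (intro r) linarith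
  qed
qed

lemma tgrad_shift: "tgrad (\<lambda>x. \<phi> (x + a)) x = tgrad \<phi> (x + a)"
  using test_differentiable by (simp add: tgrad_def partial_deriv_shift)

lemma test_mult: "(\<And>k. C_k k f) \<Longrightarrow> test_function (\<lambda>x. f x * \<phi> x)"
proof -
  assume f: "\<And>k. C_k k f"
  obtain r where r: "r > 0" "\<And>x. norm x \<ge> r \<Longrightarrow> \<phi> x = 0"
    using test_function_support[OF test] by blast
  show ?thesis
    using f r test by (intro test_functionI[of _ r] C_k_mult) (simp_all add: test_function_def)
qed

lemma test_cmult: "test_function (\<lambda>x. c * \<phi> x)"
  by (rule test_mult[OF C_k_const])

lemma tgrad_cmult: "tgrad (\<lambda>x. c * \<phi> x) x = c *\<^sub>R tgrad \<phi> x"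
  by (rule tgrad_eqI) (auto intro!: derivative_eq_intros test_has_derivative)

end

lemma test_smooth: "test_function \<phi> \<Longrightarrow> C_k k \<phi>"
  by (simp add: test_function_def)

lemma test_cutoff: "r > 0 \<Longrightarrow> test_function (cutoff r)"
  by (rule test_functionI[of _ "2 * r"]) (auto simp: cutoff_smooth cutoff_eq_0)

lemma test_zero: "test_function (\<lambda>x. 0)"
  by (rule test_functionI[of _ 0]) (auto intro: C_k_const)

lemma tgrad_cutoff_plateau:
  assumes r: "r > 0" "norm x < r"
  shows "tgrad (cutoff r) x = 0"
proof (rule tgrad_eqI)
  have "((\<lambda>x. 1) has_derivative (\<lambda>h. 0 \<bullet> h)) (at x)" by simp
  then show "(cutoff r has_derivative (\<lambda>h. 0 \<bullet> h)) (at x)"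
    by (rule has_derivative_transform_within_open[of _ _ _ _ "ball 0 r"])
      (use r in \<open>auto simp: cutoff_eq_1 dist_norm\<close>)
qed

lemma tgrad_mult:
  "test_function f \<Longrightarrow> test_function g \<Longrightarrow> tgrad (\<lambda>x. f x * g x) x = f x *\<^sub>R tgrad g x + g x *\<^sub>R tgrad f x"
  by (rule tgrad_eqI) (auto intro!: derivative_eq_intros test_has_derivative simp: inner_add_left)

section \<open>Translation invariance and local integrability\<close>

lemma lebesgue_distr_translation: "distr lebesgue lebesgue (\<lambda>x. x + a) = (lebesgue :: 'a::euclidean_space measure)"
  using lebesgue_affine_euclidean[of "\<lambda>_. 1" a]
  by (simp add: euclidean_representation density_1 add.commute)

lemma measurable_lebesgue_translation: "(\<lambda>x. x + a) \<in> lebesgue \<rightarrow>\<^sub>M (lebesgue :: 'a::euclidean_space measure)"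
  using lebesgue_affine_measurable[of "\<lambda>_. 1" a] by (simp add: euclidean_representation add.commute)

lemma AE_lebesgue_translation:
  "AE x in lebesgue. P x \<Longrightarrow> AE x::'a::euclidean_space in lebesgue. P (x + a)"
  using AE_distrD[OF measurable_lebesgue_translation, of P a] unfolding lebesgue_distr_translation .

lemma borel_measurable_lebesgue_translation:
  "f \<in> borel_measurable lebesgue \<Longrightarrow> (\<lambda>x::'a::euclidean_space. f (x + a)) \<in> borel_measurable lebesgue"
  using measurable_compose[OF measurable_lebesgue_translation] .

lemma integral_lebesgue_translation:
  fixes f :: "'a::euclidean_space \<Rightarrow> 'b::{banach, second_countable_topology}"
  assumes "f \<in> borel_measurable lebesgue"
  shows "(LINT x|lebesgue. f (x + a)) = (LINT x|lebesgue. f x)"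
  using integral_distr[OF measurable_lebesgue_translation assms, of a]
  by (simp add: lebesgue_distr_translation)

lemma integrable_lebesgue_translation:
  fixes f :: "'a::euclidean_space \<Rightarrow> 'b::{banach, second_countable_topology}"
  assumes "integrable lebesgue f"
  shows "integrable lebesgue (\<lambda>x. f (x + a))"
  using integrable_distr_eq[OF measurable_lebesgue_translation, of f a] assms
  by (auto simp: lebesgue_distr_translation)

lemma borel_measurable_lebesgue_continuous:
  "continuous_on UNIV f \<Longrightarrow> f \<in> borel_measurable lebesgue"
  by (simp add: borel_measurable_continuous_onI measurable_completion)

lemma integrable_indicator_cball:
  "integrable lebesgue (\<lambda>x::'a::euclidean_space. indicator (cball c r) x :: real)"
  using emeasure_lborel_cball_finite[of c r] by (intro integrable_real_indicator) auto

lemma integral_indicator_cball: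
  "(LINT x::'a::euclidean_space|lebesgue. indicator (cball c r) x) = measure lebesgue (cball c r)"
  by simp

text \<open>Every compact set lies in a centred ball, so integrability on balls suffices; this is
  the working form of local integrability.\<close>

lemma locally_integrable_iff:
  "locally_integrable f \<longleftrightarrow> (\<forall>r. integrable lebesgue (\<lambda>x. indicator (cball 0 r) x *\<^sub>R f x))"
proof
  assume r: "\<forall>r. integrable lebesgue (\<lambda>x. indicator (cball 0 r) x *\<^sub>R f x)"
  show "locally_integrable f" unfolding locally_integrable_def
  proof (intro allI impI)
    fix K :: "(real ^ 'a) set" assume K: "compact K"
    then obtain B where "\<And>x. x \<in> K \<Longrightarrow> norm x \<le> B"
      by (meson bounded_iff compact_imp_bounded)
    then have "K \<subseteq> cball 0 B" by auto
    moreover have "set_integrable lebesgue (cball 0 B) f"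
      using r by (simp add: set_integrable_def)
    moreover have "K \<in> sets lebesgue" using K by (simp add: borel_compact)
    ultimately show "set_integrable lebesgue K f"
      using set_integrable_subset by blast
  qed
qed (auto simp: locally_integrable_def set_integrable_def)

lemma locally_integrable_measurable:
  fixes f :: "real ^ 'a::finite \<Rightarrow> 'b::euclidean_space"
  assumes "locally_integrable f" shows "f \<in> borel_measurable lebesgue"
proof (rule borel_measurable_LIMSEQ_metric)
  show "(\<lambda>x. indicator (cball 0 (real n)) x *\<^sub>R f x) \<in> borel_measurable lebesgue" for n
    using assms[unfolded locally_integrable_iff] by (intro borel_measurable_integrable) blast
  fix x :: "real ^ 'a"
  have "\<forall>\<^sub>F n in sequentially. norm x \<le> real n"
    by (rule eventually_le_real)
  then have "\<forall>\<^sub>F n in sequentially. indicator (cball 0 (real n)) x *\<^sub>R f x = f x"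
    by eventually_elim simp
  then show "(\<lambda>n. indicator (cball 0 (real n)) x *\<^sub>R f x) \<longlonglongrightarrow> f x"
    by (rule tendsto_eventually)
qed

lemma locally_integrable_abs_cball:
  fixes f :: "real ^ 'n::finite \<Rightarrow> real"
  assumes "locally_integrable f"
  shows "integrable lebesgue (\<lambda>x. indicator (cball 0 r) x * \<bar>f x\<bar>)"
proof -
  have "integrable lebesgue (\<lambda>x. indicator (cball 0 r) x *\<^sub>R f x)"
    using assms by (simp add: locally_integrable_iff)
  from integrable_norm[OF this] show ?thesis
    by (simp add: abs_mult)
qed

lemma integrable_mult_bounded_support:
  fixes f :: "real ^ 'n::finite \<Rightarrow> 'b::euclidean_space"
  assumes "locally_integrable f" "g \<in> borel_measurable lebesgue"
    and "\<And>x. \<bar>g x\<bar> \<le> B" "\<And>x. norm x > r \<Longrightarrow> g x = 0"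
  shows "integrable lebesgue (\<lambda>x. g x *\<^sub>R f x)"
proof (rule Bochner_Integration.integrable_bound)
  show "integrable lebesgue (\<lambda>x. B *\<^sub>R (indicator (cball 0 r) x *\<^sub>R f x))"
    using assms(1)[unfolded locally_integrable_iff] by (intro integrable_scaleR_right) blast
  show "(\<lambda>x. g x *\<^sub>R f x) \<in> borel_measurable lebesgue"
    using assms locally_integrable_measurable by (intro borel_measurable_scaleR)
  have "norm (g x *\<^sub>R f x) \<le> norm (B *\<^sub>R (indicator (cball 0 r) x *\<^sub>R f x))" for x
  proof (cases "norm x \<le> r")
    case True
    have "\<bar>g x\<bar> \<le> \<bar>B\<bar>" using assms(3)[of x] by linarith
    with True show ?thesis by (simp add: mult_right_mono)
  next
    case False
    then show ?thesis using assms(4)[of x] by simp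
  qed
  then show "AE x in lebesgue. norm (g x *\<^sub>R f x) \<le> norm (B *\<^sub>R (indicator (cball 0 r) x *\<^sub>R f x))"
    by simp
qed

lemma integrable_mult_test:
  fixes f :: "real ^ 'n::finite \<Rightarrow> real"
  assumes f: "locally_integrable f" and \<phi>: "test_function \<phi>"
  shows "integrable lebesgue (\<lambda>x. f x * \<phi> x)"
proof -
  obtain r where r: "r > 0" "\<And>x. norm x \<ge> r \<Longrightarrow> \<phi> x = 0"
    using test_function_support[OF \<phi>] by blast
  obtain L where "\<And>x. \<bar>\<phi> x\<bar> \<le> L"
    using test_bounded[OF \<phi>] by blast
  from integrable_mult_bounded_support[OF f borel_measurable_lebesgue_continuous[OF test_continuous[OF \<phi>]] this, of r]
  show ?thesis
    using r borel_measurable_lebesgue_continuous[OF test_continuous[OF \<phi>]] by (auto simp: mult.commute)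
qed

lemma integrable_mult_tgrad:
  fixes f :: "real ^ 'n::finite \<Rightarrow> real"
  assumes f: "locally_integrable f" and \<phi>: "test_function \<phi>"
  shows "integrable lebesgue (\<lambda>x. f x * (tgrad \<phi> x \<bullet> h))"
proof -
  obtain r where r: "r > 0" "\<And>x. norm x \<ge> r \<Longrightarrow> \<phi> x = 0"
    using test_function_support[OF \<phi>] by blast
  obtain L where L: "L > 0" "\<And>x. norm (tgrad \<phi> x) \<le> L"
    using tgrad_bounded[OF \<phi>] by blast
  have "\<bar>tgrad \<phi> x \<bullet> h\<bar> \<le> L * norm h" for x
    using Cauchy_Schwarz_ineq2[of "tgrad \<phi> x" h] L(2)[of x]
    by (meson mult_right_mono norm_ge_zero order_trans)
  moreover have "continuous_on UNIV (\<lambda>x. tgrad \<phi> x \<bullet> h)"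
    using tgrad_continuous[OF \<phi>] by (intro continuous_intros)
  ultimately show ?thesis
    using integrable_mult_bounded_support[OF f borel_measurable_lebesgue_continuous, of "\<lambda>x. tgrad \<phi> x \<bullet> h" "L * norm h" r]
      tgrad_support[OF \<phi> r(2)] by (simp add: mult.commute)
qed

section \<open>Approximation by test functions and duality\<close>

text \<open>A measurable function is an a.e. limit of continuous ones. These are clamped to [-M, M],
  approximated by polynomials on the ball of radius \<open>2 * r\<close> by Stone-Weierstrass, and
  multiplied by a cutoff. The bound \<open>M\<close> is kept exactly, since duality arguments need
  test functions bounded by 1.\<close>

lemma AE_test_approx:
  fixes s :: "real ^ 'n::finite \<Rightarrow> real"
  assumes s: "s \<in> borel_measurable lebesgue" and M: "M > 0" "\<And>x. \<bar>s x\<bar> \<le> M"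
    and r: "r > 0" "\<And>x. norm x > r \<Longrightarrow> s x = 0"
  obtains \<phi> where "\<And>n. test_function (\<phi> n)" "\<And>n x. \<bar>\<phi> n x\<bar> \<le> M"
    "\<And>n x. norm x \<ge> 2 * r \<Longrightarrow> \<phi> n x = 0" "AE x in lebesgue. (\<lambda>n. \<phi> n x) \<longlonglongrightarrow> s x"
proof -
  obtain N g where N: "negligible N" and g: "\<And>n::nat. continuous_on UNIV (g n)"
    and lim: "\<And>x. x \<notin> N \<Longrightarrow> (\<lambda>n. g n x) \<longlonglongrightarrow> s x"
    using lebesgue_measurable_imp_measurable_on[OF s, of UNIV]
    by (auto simp: measurable_on_def)
  define h where "h n x = max (- M) (min M (g n x))" for n x
  have h_cont: "continuous_on (cball 0 (2 * r)) (h n)" for n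
    unfolding h_def by (intro continuous_intros continuous_on_subset[OF g]) auto
  have h_le: "\<bar>h n x\<bar> \<le> M" for n x using M(1) by (auto simp: h_def)
  have "\<exists>q. real_polynomial_function q \<and> (\<forall>x\<in>cball 0 (2 * r). \<bar>h n x - q x\<bar> < 1 / Suc n)" for n
    using Stone_Weierstrass_real_polynomial_function[OF compact_cball h_cont[of n], of "1 / Suc n"]
    by (metis of_nat_0_less_iff zero_less_Suc zero_less_divide_1_iff)
  then obtain q where q: "\<And>n. real_polynomial_function (q n)"
    "\<And>n x. x \<in> cball 0 (2 * r) \<Longrightarrow> \<bar>h n x - q n x\<bar> < 1 / Suc n"
    by metis
  \<comment> \<open>The polynomial may exceed \<open>M\<close> by up to \<open>1 / Suc n\<close>;
    this factor, tending to 1, brings it back to at most \<open>M\<close>.\<close>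
  define c where "c n = M / (M + 1 / Suc n)" for n
  have c0: "c n > 0" for n unfolding c_def using M(1) by (intro divide_pos_pos add_pos_pos) auto
  define \<phi> where "\<phi> n x = (c n * q n x) * cutoff r x" for n x
  have c_lim: "c \<longlonglongrightarrow> 1"
  proof -
    have "(\<lambda>n. M / (M + 1 / Suc n)) \<longlonglongrightarrow> M / (M + 0)"
      using M(1) by (intro tendsto_intros LIMSEQ_Suc[OF lim_1_over_n]) auto
    then show ?thesis unfolding c_def using M(1) by simp
  qed
  show thesis
  proof
    show "test_function (\<phi> n)" for n
      unfolding \<phi>_def using q(1) r
      by (intro test_mult[OF test_cutoff] C_k_mult C_k_const C_k_polynomial)
    show zero: "\<phi> n x = 0" if "norm x \<ge> 2 * r" for n x
      using that r by (simp add: \<phi>_def cutoff_eq_0)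
    show "\<bar>\<phi> n x\<bar> \<le> M" for n x
    proof (cases "norm x \<le> 2 * r")
      case True
      then have "\<bar>q n x\<bar> \<le> M + 1 / Suc n"
        using q(2)[of x n] h_le[of n x] by auto
      then have "c n * \<bar>q n x\<bar> \<le> c n * (M + 1 / Suc n)"
        using c0[of n] by simp
      also have "\<dots> = M" unfolding c_def using M(1) add_pos_pos[of M "1 / Suc n"] by auto
      finally have "\<bar>\<phi> n x\<bar> \<le> M * \<bar>cutoff r x\<bar>"
        unfolding \<phi>_def using c0[of n] by (simp add: abs_mult mult_right_mono)
      also have "\<dots> \<le> M * 1" using M(1) by (intro mult_left_mono cutoff_bounds) auto
      finally show ?thesis by simp
    next
      case False
      then have "\<phi> n x = 0" by (intro zero) simp
      then show ?thesis using M(1) by simp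
    qed
    have "(\<lambda>n. \<phi> n x) \<longlonglongrightarrow> s x" if "x \<notin> N" for x
    proof (cases "norm x \<le> 2 * r")
      case True
      have "(\<lambda>n. h n x) \<longlonglongrightarrow> max (- M) (min M (s x))"
        unfolding h_def using lim[OF that] by (intro tendsto_intros)
      then have "(\<lambda>n. h n x) \<longlonglongrightarrow> s x"
        using M(2)[of x] by (simp add: max_def min_def abs_le_iff split: if_splits)
      moreover have "(\<lambda>n. h n x - q n x) \<longlonglongrightarrow> 0"
      proof (rule Lim_null_comparison)
        show "\<forall>\<^sub>F n in sequentially. norm (h n x - q n x) \<le> 1 / Suc n"
          using q(2)[of x] True by (intro always_eventually) (auto intro: less_imp_le)
        show "(\<lambda>n. 1 / Suc n) \<longlonglongrightarrow> 0" by (rule LIMSEQ_Suc[OF lim_1_over_n])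
      qed
      ultimately have "(\<lambda>n. h n x - (h n x - q n x)) \<longlonglongrightarrow> s x - 0"
        by (intro tendsto_diff)
      then have "(\<lambda>n. \<phi> n x) \<longlonglongrightarrow> (1 * s x) * cutoff r x"
        unfolding \<phi>_def using c_lim by (intro tendsto_intros) auto
      moreover have "s x * cutoff r x = s x"
        using r cutoff_eq_1[of r x] by (cases "norm x \<le> r") auto
      ultimately show ?thesis by simp
    next
      case False
      then show ?thesis using zero[of x] r by simp
    qed
    moreover have "AE x in lebesgue. x \<notin> N"
      using N by (simp add: negligible_iff_null_sets AE_not_in)
    ultimately show "AE x in lebesgue. (\<lambda>n. \<phi> n x) \<longlonglongrightarrow> s x"
      by auto
  qed
qed

text \<open>The best multiplier is the sign of \<open>f\<close> on the ball. Its approximations by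
  test functions are bounded by 1 and supported in the doubled ball, which is where the radius
  \<open>2 * r\<close> in the hypothesis comes from.\<close>

lemma L1_norm_le_by_duality:
  fixes f :: "real ^ 'n::finite \<Rightarrow> real"
  assumes f: "locally_integrable f" and r: "r > 0"
    and M: "\<And>\<phi>. test_function \<phi> \<Longrightarrow> (\<And>x. \<bar>\<phi> x\<bar> \<le> 1) \<Longrightarrow> (\<And>x. norm x \<ge> 2 * r \<Longrightarrow> \<phi> x = 0) \<Longrightarrow>
          \<bar>LINT x|lebesgue. f x * \<phi> x\<bar> \<le> M"
  shows "(LINT x|lebesgue. indicator (cball 0 r) x * \<bar>f x\<bar>) \<le> M"
proof -
  have [measurable]: "f \<in> borel_measurable lebesgue"
    by (rule locally_integrable_measurable[OF f])
  have [measurable]: "cball 0 c \<in> sets lebesgue" for c :: real and x :: "real ^ 'n"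
    by simp
  define s where "s x = indicator (cball 0 r) x * sgn (f x)" for x
  have "s \<in> borel_measurable lebesgue" unfolding s_def by measurable
  then obtain \<phi> where \<phi>: "\<And>n. test_function (\<phi> n)" "\<And>n x. \<bar>\<phi> n x\<bar> \<le> 1"
    "\<And>n x. norm x \<ge> 2 * r \<Longrightarrow> \<phi> n x = 0" "AE x in lebesgue. (\<lambda>n. \<phi> n x) \<longlonglongrightarrow> s x"
    by (rule AE_test_approx[of s 1 r]) (auto simp: s_def r sgn_if indicator_def)
  have lim: "(\<lambda>n. LINT x|lebesgue. f x * \<phi> n x) \<longlonglongrightarrow> (LINT x|lebesgue. f x * s x)"
  proof (rule integral_dominated_convergence[where w = "\<lambda>x. indicator (cball 0 (2 * r)) x * \<bar>f x\<bar>"])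
    show "integrable lebesgue (\<lambda>x. indicator (cball 0 (2 * r)) x * \<bar>f x\<bar>)"
      by (rule locally_integrable_abs_cball[OF f])
    show "(\<lambda>x. f x * s x) \<in> borel_measurable lebesgue" unfolding s_def by measurable
    show "(\<lambda>x. f x * \<phi> n x) \<in> borel_measurable lebesgue" for n
      using integrable_mult_test[OF f \<phi>(1)] by auto
    show "AE x in lebesgue. (\<lambda>n. f x * \<phi> n x) \<longlonglongrightarrow> f x * s x"
      using \<phi>(4) by eventually_elim (intro tendsto_intros)
    have "norm (f x * \<phi> n x) \<le> indicator (cball 0 (2 * r)) x * \<bar>f x\<bar>" for n x
      using \<phi>(2)[of n x] \<phi>(3)[of x n] by (cases "norm x \<le> 2 * r") (auto simp: abs_mult mult_left_le)
    then show "AE x in lebesgue. norm (f x * \<phi> n x) \<le> indicator (cball 0 (2 * r)) x * \<bar>f x\<bar>" for n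
      by simp
  qed
  have eq: "(LINT x|lebesgue. f x * s x) = (LINT x|lebesgue. indicator (cball 0 r) x * \<bar>f x\<bar>)"
    by (rule Bochner_Integration.integral_cong) (auto simp: s_def abs_sgn mult_ac)
  have "(LINT x|lebesgue. f x * \<phi> n x) \<le> M" for n
    using M[OF \<phi>(1,2,3), of n] by auto
  then show ?thesis
    by (intro LIMSEQ_le_const2[OF lim[unfolded eq]]) auto
qed

text \<open>Density in two stages: \<open>f\<close> is truncated in height to become bounded, then
  the truncation is approximated a.e. by uniformly bounded test functions with common support. Each
  stage costs less than \<open>e / 2\<close>.\<close>

lemma L1_approx_test:
  fixes f :: "real ^ 'n::finite \<Rightarrow> real"
  assumes f: "integrable lebesgue f" and r: "r > 0" "\<And>x. norm x > r \<Longrightarrow> f x = 0" and e: "e > 0"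
  obtains \<phi> where "test_function \<phi>" "integrable lebesgue \<phi>" "(LINT x|lebesgue. \<bar>f x - \<phi> x\<bar>) < e"
proof -
  have [measurable]: "f \<in> borel_measurable lebesgue" using f by auto
  define g where "g n x = max (- real (Suc n)) (min (real (Suc n)) (f x))" for n x
  have [measurable]: "g n \<in> borel_measurable lebesgue" for n unfolding g_def by measurable
  have g_int: "integrable lebesgue (g n)" for n
    by (rule Bochner_Integration.integrable_bound[OF f]) (auto simp: g_def)
  have "(\<lambda>n. LINT x|lebesgue. \<bar>f x - g n x\<bar>) \<longlonglongrightarrow> (LINT x|(lebesgue :: (real ^ 'n) measure). 0)"
  proof (rule integral_dominated_convergence[where w = "\<lambda>x. \<bar>f x\<bar>"])
    show "AE x in lebesgue. (\<lambda>n. \<bar>f x - g n x\<bar>) \<longlonglongrightarrow> 0"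
    proof (intro AE_I2 tendsto_eventually)
      fix x
      have "\<forall>\<^sub>F n in sequentially. \<bar>f x\<bar> \<le> real (Suc n)"
        using eventually_le_real[of "\<bar>f x\<bar>"] by eventually_elim simp
      then show "\<forall>\<^sub>F n in sequentially. \<bar>f x - g n x\<bar> = 0"
        by eventually_elim (auto simp: g_def)
    qed
    show "AE x in lebesgue. norm \<bar>f x - g n x\<bar> \<le> \<bar>f x\<bar>" for n
      by (auto simp: g_def)
  qed (use f in auto)
  then have "\<forall>\<^sub>F n in sequentially. (LINT x|lebesgue. \<bar>f x - g n x\<bar>) < e / 2"
    using e by (intro order_tendstoD(2)) auto
  then obtain n where n: "(LINT x|lebesgue. \<bar>f x - g n x\<bar>) < e / 2"
    by (auto dest: eventually_happens)
  obtain \<phi> where \<phi>: "\<And>k. test_function (\<phi> k)" "\<And>k x. \<bar>\<phi> k x\<bar> \<le> Suc n"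
    "\<And>k x. norm x \<ge> 2 * r \<Longrightarrow> \<phi> k x = 0" "AE x in lebesgue. (\<lambda>k. \<phi> k x) \<longlonglongrightarrow> g n x"
    by (rule AE_test_approx[of "g n" "Suc n" r]) (auto simp: g_def r)
  have B: "integrable lebesgue (\<lambda>x. indicator (cball 0 (2 * r)) x * (2 * real (Suc n)))" (is "integrable _ ?w")
    by (intro integrable_mult_left integrable_indicator_cball)
  have [measurable]: "\<phi> k \<in> borel_measurable lebesgue" for k
    by (rule borel_measurable_lebesgue_continuous[OF test_continuous[OF \<phi>(1)]])
  have \<phi>_int: "integrable lebesgue (\<phi> k)" for k
  proof (rule Bochner_Integration.integrable_bound[OF B])
    have "norm (\<phi> k x) \<le> norm (?w x)" for x
      using \<phi>(2)[of k x] \<phi>(3)[of x k] by (cases "norm x \<le> 2 * r") auto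
    then show "AE x in lebesgue. norm (\<phi> k x) \<le> norm (?w x)" by simp
  qed auto
  have "(\<lambda>k. LINT x|lebesgue. \<bar>g n x - \<phi> k x\<bar>) \<longlonglongrightarrow> (LINT x|(lebesgue :: (real ^ 'n) measure). 0)"
  proof (rule integral_dominated_convergence[OF _ _ B])
    show "AE x in lebesgue. (\<lambda>k. \<bar>g n x - \<phi> k x\<bar>) \<longlonglongrightarrow> 0"
      using \<phi>(4)
    proof eventually_elim
      case (elim x)
      have "(\<lambda>k. \<bar>g n x - \<phi> k x\<bar>) \<longlonglongrightarrow> \<bar>g n x - g n x\<bar>"
        using elim by (intro tendsto_intros)
      then show ?case by simp
    qed
    have "norm \<bar>g n x - \<phi> k x\<bar> \<le> ?w x" for x k
    proof (cases "norm x \<le> 2 * r")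
      case True
      have "\<bar>g n x\<bar> \<le> Suc n" by (auto simp: g_def)
      then show ?thesis using True \<phi>(2)[of k x] by auto
    next
      case False
      then show ?thesis using \<phi>(3)[of x k] r by (auto simp: g_def)
    qed
    then show "AE x in lebesgue. norm \<bar>g n x - \<phi> k x\<bar> \<le> ?w x" for k
      by simp
  qed auto
  then have "\<forall>\<^sub>F k in sequentially. (LINT x|lebesgue. \<bar>g n x - \<phi> k x\<bar>) < e / 2"
    using e by (intro order_tendstoD(2)) auto
  then obtain k where k: "(LINT x|lebesgue. \<bar>g n x - \<phi> k x\<bar>) < e / 2"
    by (auto dest: eventually_happens)
  have "(LINT x|lebesgue. \<bar>f x - \<phi> k x\<bar>) \<le> (LINT x|lebesgue. \<bar>f x - g n x\<bar> + \<bar>g n x - \<phi> k x\<bar>)"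
    using f g_int \<phi>_int by (intro integral_mono) auto
  also have "\<dots> < e" using n k f g_int \<phi>_int by (subst Bochner_Integration.integral_add) auto
  finally show ?thesis using that \<phi>(1) \<phi>_int by blast
qed

lemma locally_integrable_shift:
  assumes f: "locally_integrable f"
  shows "locally_integrable (\<lambda>x. f (x + a))"
  unfolding locally_integrable_iff
proof
  fix r
  have [measurable]: "f \<in> borel_measurable lebesgue"
    by (rule locally_integrable_measurable[OF f])
  have "integrable lebesgue (\<lambda>x. indicator (cball 0 (r + norm a)) (x + a) *\<^sub>R f (x + a))"
    using integrable_lebesgue_translation[of "\<lambda>x. indicator (cball 0 (r + norm a)) x *\<^sub>R f x" a] f
    by (auto simp: locally_integrable_iff)
  then show "integrable lebesgue (\<lambda>x. indicator (cball 0 r) x *\<^sub>R f (x + a))"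
  proof (rule Bochner_Integration.integrable_bound)
    have "norm (indicator (cball 0 r) x *\<^sub>R f (x + a))
       \<le> norm (indicator (cball 0 (r + norm a)) (x + a) *\<^sub>R f (x + a))" for x
      using norm_triangle_ineq[of x a] by (auto simp: indicator_def)
    then show "AE x in lebesgue. norm (indicator (cball 0 r) x *\<^sub>R f (x + a))
       \<le> norm (indicator (cball 0 (r + norm a)) (x + a) *\<^sub>R f (x + a))" by simp
    show "(\<lambda>x. indicator (cball 0 r) x *\<^sub>R f (x + a)) \<in> borel_measurable lebesgue"
      using borel_measurable_lebesgue_translation[of f a] by (intro borel_measurable_scaleR borel_measurable_indicator) auto
  qed
qed

lemma locally_integrable_cong_bound:
  fixes f :: "real ^ 'n::finite \<Rightarrow> 'b::euclidean_space" and g :: "real ^ 'n \<Rightarrow> 'c::euclidean_space"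
  assumes "locally_integrable g" "f \<in> borel_measurable lebesgue" "\<And>x. norm (f x) \<le> norm (g x)"
  shows "locally_integrable f"
  unfolding locally_integrable_iff
proof
  fix r
  have "integrable lebesgue (\<lambda>x. indicator (cball 0 r) x *\<^sub>R g x)"
    using assms by (simp add: locally_integrable_iff)
  then show "integrable lebesgue (\<lambda>x. indicator (cball 0 r) x *\<^sub>R f x)"
  proof (rule Bochner_Integration.integrable_bound)
    show "(\<lambda>x. indicator (cball 0 r) x *\<^sub>R f x) \<in> borel_measurable lebesgue"
      using assms(2) by (intro borel_measurable_scaleR borel_measurable_indicator) auto
    show "AE x in lebesgue. norm (indicator (cball 0 r) x *\<^sub>R f x) \<le> norm (indicator (cball 0 r) x *\<^sub>R g x)"
      using assms(3) by (auto simp: indicator_def)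
  qed
qed

lemma locally_integrable_add:
  "locally_integrable f \<Longrightarrow> locally_integrable g \<Longrightarrow> locally_integrable (\<lambda>x. f x + g x)"
  by (auto simp: locally_integrable_iff scaleR_add_right)

lemma locally_integrable_diff:
  "locally_integrable f \<Longrightarrow> locally_integrable g \<Longrightarrow> locally_integrable (\<lambda>x. f x - g x)"
  by (auto simp: locally_integrable_iff scaleR_diff_right)

lemma locally_integrable_scaleR:
  assumes "locally_integrable f"
  shows "locally_integrable (\<lambda>x. (c::real) *\<^sub>R f x)"
proof -
  have "integrable lebesgue (\<lambda>x. c *\<^sub>R (indicator (cball 0 r) x *\<^sub>R f x))" for r
    using assms[unfolded locally_integrable_iff] by (intro integrable_scaleR_right) blast
  then show ?thesis by (simp add: locally_integrable_iff mult.commute)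
qed

lemma locally_integrable_difference_quotient:
  fixes f :: "real ^ 'n::finite \<Rightarrow> real"
  assumes "locally_integrable f"
  shows "locally_integrable (\<lambda>x. (f (x + h) - f x) / t)"
  using locally_integrable_scaleR[OF locally_integrable_diff[OF locally_integrable_shift[OF assms] assms], of "1 / t"]
  by simp

lemma locally_integrable_const: "locally_integrable (\<lambda>x. c)"
  unfolding locally_integrable_iff
  by (intro allI integrable_scaleR_left integrable_indicator_cball)

lemma locally_integrable_inner:
  fixes G :: "real ^ 'n::finite \<Rightarrow> real ^ 'n"
  assumes "locally_integrable G"
  shows "locally_integrable (\<lambda>x. G x \<bullet> h)"
proof -
  have "integrable lebesgue (\<lambda>x. (indicator (cball 0 r) x *\<^sub>R G x) \<bullet> h)" for r
    using assms by (intro integrable_inner_left) (auto simp: locally_integrable_iff)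
  then show ?thesis by (simp add: locally_integrable_iff)
qed

text \<open>The three-part estimate: a test function close to \<open>f\<close> in the mean is
  Lipschitz, and the approximation error is itself invariant under translation.\<close>

lemma L1_translation_continuous:
  fixes f :: "real ^ 'n::finite \<Rightarrow> real"
  assumes f: "locally_integrable f" and r: "r > 0" and e: "e > 0"
  shows "\<exists>d>0. \<forall>h. norm h < d \<longrightarrow>
    (LINT x|lebesgue. indicator (cball 0 r) x * \<bar>f (x + h) - f x\<bar>) < e"
proof -
  have [measurable]: "f \<in> borel_measurable lebesgue"
    by (rule locally_integrable_measurable[OF f])
  define F where "F x = indicator (cball 0 (r + 1)) x *\<^sub>R f x" for x
  have F: "integrable lebesgue F"
    using f unfolding F_def by (simp add: locally_integrable_iff)
  obtain \<phi> where \<phi>: "test_function \<phi>" "integrable lebesgue \<phi>" "(LINT x|lebesgue. \<bar>F x - \<phi> x\<bar>) < e / 3"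
    using L1_approx_test[OF F, of "r + 1" "e / 3"] r e by (auto simp: F_def)
  obtain L where L: "L > 0" "\<And>x. norm (tgrad \<phi> x) \<le> L"
    using tgrad_bounded[OF \<phi>(1)] by blast
  define V where "V = measure lebesgue (cball (0::real^'n) r)"
  have V: "V \<ge> 0" by (simp add: V_def)
  \<comment> \<open>The 1 keeps \<open>x + h\<close> inside the ball of radius \<open>r + 1\<close>,
    where \<open>F\<close> agrees with \<open>f\<close>. The other entry makes the Lipschitz
    contribution \<open>V * (L * norm h)\<close> at most \<open>e / 3\<close>; the summand 1 in it
    keeps the denominator positive.\<close>
  define d where "d = min 1 (e / (3 * (L * V + 1)))"
  have LV: "L * V + 1 > 0" using L V by (simp add: add_nonneg_pos)
  show ?thesis
  proof (intro exI[of _ d] conjI allI impI)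
    show "d > 0" using e LV by (simp add: d_def)
    fix h :: "real ^ 'n" assume h: "norm h < d"
    have i1: "integrable lebesgue (\<lambda>x. \<bar>F (x + h) - \<phi> (x + h)\<bar>)"
      using F \<phi>(2) integrable_lebesgue_translation[of "\<lambda>x. \<bar>F x - \<phi> x\<bar>" h] by auto
    have i2: "integrable lebesgue (\<lambda>x. \<bar>F x - \<phi> x\<bar>)"
      using F \<phi>(2) by auto
    have i3: "integrable lebesgue (\<lambda>x. indicator (cball 0 r) x * (L * norm h))"
      by (intro integrable_mult_left integrable_indicator_cball)
    have "(LINT x|lebesgue. indicator (cball 0 r) x * \<bar>f (x + h) - f x\<bar>)
        \<le> (LINT x|lebesgue. \<bar>F (x + h) - \<phi> (x + h)\<bar> + \<bar>F x - \<phi> x\<bar> + indicator (cball 0 r) x * (L * norm h))"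
    proof (rule integral_mono)
      show "integrable lebesgue (\<lambda>x. indicator (cball 0 r) x * \<bar>f (x + h) - f x\<bar>)"
        by (intro locally_integrable_abs_cball locally_integrable_diff locally_integrable_shift f)
      show "integrable lebesgue (\<lambda>x. \<bar>F (x + h) - \<phi> (x + h)\<bar> + \<bar>F x - \<phi> x\<bar> + indicator (cball 0 r) x * (L * norm h))"
        using i1 i2 i3 by auto
      fix x
      show "indicator (cball 0 r) x * \<bar>f (x + h) - f x\<bar>
        \<le> \<bar>F (x + h) - \<phi> (x + h)\<bar> + \<bar>F x - \<phi> x\<bar> + indicator (cball 0 r) x * (L * norm h)"
      proof (cases "norm x \<le> r")
        case True
        have "norm (x + h) \<le> r + 1" using True h norm_triangle_ineq[of x h] by (simp add: d_def)
        then have "F (x + h) = f (x + h)" "F x = f x"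
          using True by (auto simp: F_def)
        moreover have "\<bar>\<phi> (x + h) - \<phi> x\<bar> \<le> L * norm h"
          using test_lipschitz[OF \<phi>(1) L(2), of "x + h" x] by simp
        ultimately show ?thesis using True by auto
      qed auto
    qed
    also have "\<dots> = (LINT x|lebesgue. \<bar>F (x + h) - \<phi> (x + h)\<bar>) + (LINT x|lebesgue. \<bar>F x - \<phi> x\<bar>)
        + (LINT x|lebesgue. indicator (cball (0 :: real ^ 'n) r) x * (L * norm h))"
      using Bochner_Integration.integral_add[OF i1 i2]
        Bochner_Integration.integral_add[OF Bochner_Integration.integrable_add[OF i1 i2] i3] by linarith
    also have "(LINT x|lebesgue. indicator (cball (0 :: real ^ 'n) r) x * (L * norm h)) = V * (L * norm h)"
      by (simp add: V_def)
    also have "(LINT x|lebesgue. \<bar>F (x + h) - \<phi> (x + h)\<bar>) = (LINT x|lebesgue. \<bar>F x - \<phi> x\<bar>)"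
      using integral_lebesgue_translation[of "\<lambda>x. \<bar>F x - \<phi> x\<bar>" h] i2 by auto
    also have "V * (L * norm h) \<le> e / 3"
    proof -
      have "norm h \<le> e / (3 * (L * V + 1))" using h by (simp add: d_def)
      then have "(L * V + 1) * norm h \<le> e / 3" using LV by (simp add: field_simps)
      moreover have "V * (L * norm h) \<le> (L * V + 1) * norm h" by (simp add: algebra_simps)
      ultimately show ?thesis by linarith
    qed
    finally show "(LINT x|lebesgue. indicator (cball 0 r) x * \<bar>f (x + h) - f x\<bar>) < e"
      using \<phi>(3) by simp
  qed
qed

section \<open>Weak gradients and difference quotients\<close>

text \<open>The fundamental lemma of the calculus of variations: the duality bound with constant 0,
  on every ball.\<close>

lemma AE_zero_by_duality:
  fixes f :: "real ^ 'n::finite \<Rightarrow> real"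
  assumes f: "locally_integrable f"
    and z: "\<And>\<phi>. test_function \<phi> \<Longrightarrow> (LINT x|lebesgue. f x * \<phi> x) = 0"
  shows "AE x in lebesgue. f x = 0"
proof -
  have "AE x in lebesgue. indicator (cball 0 (real (Suc n))) x * \<bar>f x\<bar> = 0" for n
  proof -
    have "(LINT x|lebesgue. indicator (cball 0 (real (Suc n))) x * \<bar>f x\<bar>) \<le> 0"
      by (rule L1_norm_le_by_duality[OF f]) (use z in auto)
    moreover have "(LINT x|lebesgue. indicator (cball 0 (real (Suc n))) x * \<bar>f x\<bar>) \<ge> 0"
      by (intro integral_nonneg_AE) auto
    ultimately have "(LINT x|lebesgue. indicator (cball 0 (real (Suc n))) x * \<bar>f x\<bar>) = 0"
      by (rule antisym)
    then show ?thesis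
      by (subst (asm) integral_nonneg_eq_0_iff_AE[OF locally_integrable_abs_cball[OF f]]) auto
  qed
  then have "AE x in lebesgue. \<forall>n. indicator (cball 0 (real (Suc n))) x * \<bar>f x\<bar> = 0"
    by (simp only: AE_all_countable) blast
  then show ?thesis
  proof eventually_elim
    case (elim x)
    obtain n where "norm x \<le> real n" using real_arch_simple by blast
    then have "x \<in> cball 0 (real (Suc n))" by simp
    with elim[rule_format, of n] show ?case by simp
  qed
qed

lemma has_weak_gradient_locally_integrable:
  assumes "has_weak_gradient u G"
  shows "locally_integrable u" "locally_integrable G"
  using assms by (auto simp: has_weak_gradient_def)

lemma tgrad_component: "tgrad f x $ i = partial_deriv i f x"
  by (simp add: tgrad_def)

lemma has_weak_gradient_inner:
  assumes w: "has_weak_gradient u G" and \<phi>: "test_function \<phi>"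
  shows "(LINT x|lebesgue. u x * (tgrad \<phi> x \<bullet> h)) = - (LINT x|lebesgue. (G x \<bullet> h) * \<phi> x)"
proof -
  note li = has_weak_gradient_locally_integrable[OF w]
  have i1: "integrable lebesgue (\<lambda>x. u x * partial_deriv i \<phi> x)" for i
    using integrable_mult_tgrad[OF li(1) \<phi>, of "axis i 1"] by (simp add: inner_axis tgrad_component)
  have i2: "integrable lebesgue (\<lambda>x. G x $ i * \<phi> x)" for i
    using integrable_mult_test[OF locally_integrable_inner[OF li(2), of "axis i 1"] \<phi>]
    by (simp add: inner_axis)
  have "(LINT x|lebesgue. u x * (tgrad \<phi> x \<bullet> h))
      = (LINT x|lebesgue. (\<Sum>i\<in>UNIV. h $ i * (u x * partial_deriv i \<phi> x)))"
    by (simp add: inner_vec_def tgrad_component sum_distrib_left mult_ac)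
  also have "\<dots> = (\<Sum>i\<in>UNIV. h $ i * (LINT x|lebesgue. u x * partial_deriv i \<phi> x))"
    using i1 by (subst Bochner_Integration.integral_sum) auto
  also have "\<dots> = - (\<Sum>i\<in>UNIV. h $ i * (LINT x|lebesgue. G x $ i * \<phi> x))"
    using w \<phi> by (simp add: has_weak_gradient_def sum_negf)
  also have "(\<Sum>i\<in>UNIV. h $ i * (LINT x|lebesgue. G x $ i * \<phi> x))
      = (LINT x|lebesgue. (\<Sum>i\<in>UNIV. h $ i * (G x $ i * \<phi> x)))"
    using i2 by (subst Bochner_Integration.integral_sum) auto
  also have "\<dots> = (LINT x|lebesgue. (G x \<bullet> h) * \<phi> x)"
    by (simp add: inner_vec_def sum_distrib_left sum_distrib_right mult_ac)
  finally show ?thesis .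
qed

lemma has_weak_gradientI:
  assumes "locally_integrable u" "locally_integrable G"
    "\<And>\<phi> i. test_function \<phi> \<Longrightarrow>
      (LINT x|lebesgue. u x * (tgrad \<phi> x \<bullet> axis i 1)) = - (LINT x|lebesgue. (G x \<bullet> axis i 1) * \<phi> x)"
  shows "has_weak_gradient u G"
  using assms by (auto simp: has_weak_gradient_def inner_axis tgrad_component)

lemma has_weak_gradient_unique:
  assumes G: "has_weak_gradient u G" and H: "has_weak_gradient u H"
  shows "AE x in lebesgue. G x = H x"
proof -
  note liG = has_weak_gradient_locally_integrable[OF G]
  note liH = has_weak_gradient_locally_integrable[OF H]
  have "AE x in lebesgue. G x $ i = H x $ i" for i
  proof -
    have G': "locally_integrable (\<lambda>x. G x $ i)"
      using locally_integrable_inner[OF liG(2), of "axis i 1"] by (simp add: inner_axis)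
    have H': "locally_integrable (\<lambda>x. H x $ i)"
      using locally_integrable_inner[OF liH(2), of "axis i 1"] by (simp add: inner_axis)
    have "AE x in lebesgue. G x $ i - H x $ i = 0"
    proof (rule AE_zero_by_duality[OF locally_integrable_diff[OF G' H']])
      fix \<phi> :: "real ^ 'a \<Rightarrow> real" assume \<phi>: "test_function \<phi>"
      have "(LINT x|lebesgue. (G x $ i - H x $ i) * \<phi> x)
        = (LINT x|lebesgue. G x $ i * \<phi> x) - (LINT x|lebesgue. H x $ i * \<phi> x)"
        using integrable_mult_test[OF G' \<phi>] integrable_mult_test[OF H' \<phi>]
        by (simp add: left_diff_distrib)
      also have "\<dots> = 0"
        using G H \<phi> by (simp add: has_weak_gradient_def minus_equation_iff)
      finally show "(LINT x|lebesgue. (G x $ i - H x $ i) * \<phi> x) = 0" .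
    qed
    then show ?thesis by auto
  qed
  then have "AE x in lebesgue. \<forall>i. G x $ i = H x $ i"
    by (simp only: AE_all_countable) blast
  then show ?thesis by (simp add: vec_eq_iff)
qed

lemma has_weak_gradient_weak_grad:
  "has_weak_gradient u G \<Longrightarrow> has_weak_gradient u (weak_grad u)"
  unfolding weak_grad_def by (rule someI[of "has_weak_gradient u"])

lemma weak_grad_AE_eq:
  "has_weak_gradient u G \<Longrightarrow> AE x in lebesgue. weak_grad u x = G x"
  using has_weak_gradient_unique has_weak_gradient_weak_grad by blast

section \<open>Weak gradients as limits of difference quotients\<close>

lemma integral_shift_test:
  fixes u :: "real ^ 'n::finite \<Rightarrow> real"
  assumes u: "locally_integrable u" and \<phi>: "test_function \<phi>"
  shows "(LINT x|lebesgue. u x * \<phi> (x - a)) = (LINT x|lebesgue. u (x + a) * \<phi> x)"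
  using integral_lebesgue_translation[of "\<lambda>x. u x * \<phi> (x - a)" a]
    integrable_mult_test[OF u test_shift[OF \<phi>, of "- a"]] by auto

lemma test_difference_quotient:
  fixes f :: "real ^ 'n::finite \<Rightarrow> real"
  assumes f: "locally_integrable f" and \<phi>: "test_function \<phi>"
    and X: "X \<longlonglongrightarrow> 0" "\<And>n. X n \<noteq> 0"
  shows "(\<lambda>n. LINT x|lebesgue. f x * ((\<phi> (x + X n *\<^sub>R h) - \<phi> x) / X n))
      \<longlonglongrightarrow> (LINT x|lebesgue. f x * (tgrad \<phi> x \<bullet> h))"
proof -
  obtain r where r: "r > 0" "\<And>x. norm x \<ge> r \<Longrightarrow> \<phi> x = 0"
    using test_function_support[OF \<phi>] by blast
  obtain L where L: "L > 0" "\<And>x. norm (tgrad \<phi> x) \<le> L"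
    using tgrad_bounded[OF \<phi>] by blast
  \<comment> \<open>A convergent sequence is bounded, so all the shifted supports lie in one ball
    and a single dominating function suffices.\<close>
  have "Bseq X" using X(1) convergent_imp_Bseq convergentI by blast
  then obtain B where B: "B > 0" "\<And>n. \<bar>X n\<bar> \<le> B" by (auto simp: Bseq_def)
  have meas: "(\<lambda>x. f x * ((\<phi> (x + X n *\<^sub>R h) - \<phi> x) / X n)) \<in> borel_measurable lebesgue" for n
    by (intro borel_measurable_times borel_measurable_divide borel_measurable_diff borel_measurable_const
        locally_integrable_measurable[OF f] borel_measurable_lebesgue_continuous test_continuous test_shift \<phi>)
  show ?thesis
  proof (rule integral_dominated_convergence[where w = "\<lambda>x. (L * norm h) * (indicator (cball 0 (r + B * norm h)) x * \<bar>f x\<bar>)"])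
    show "(\<lambda>x. f x * (tgrad \<phi> x \<bullet> h)) \<in> borel_measurable lebesgue"
      using integrable_mult_tgrad[OF f \<phi>] by auto
    show "integrable lebesgue (\<lambda>x. (L * norm h) * (indicator (cball 0 (r + B * norm h)) x * \<bar>f x\<bar>))"
      by (intro integrable_mult_right locally_integrable_abs_cball[OF f])
    show "AE x in lebesgue. (\<lambda>n. f x * ((\<phi> (x + X n *\<^sub>R h) - \<phi> x) / X n)) \<longlonglongrightarrow> f x * (tgrad \<phi> x \<bullet> h)"
    proof (intro AE_I2 tendsto_mult_left)
      fix x
      show "(\<lambda>n. (\<phi> (x + X n *\<^sub>R h) - \<phi> x) / X n) \<longlonglongrightarrow> tgrad \<phi> x \<bullet> h"
        by (rule test_directional_limit[OF \<phi> X])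
    qed
    have "norm (f x * ((\<phi> (x + X n *\<^sub>R h) - \<phi> x) / X n))
        \<le> (L * norm h) * (indicator (cball 0 (r + B * norm h)) x * \<bar>f x\<bar>)" for n x
    proof (cases "norm x \<le> r + B * norm h")
      case True
      have "\<bar>\<phi> (x + X n *\<^sub>R h) - \<phi> x\<bar> \<le> L * (\<bar>X n\<bar> * norm h)"
        using test_lipschitz[OF \<phi> L(2), of "x + X n *\<^sub>R h" x] by simp
      then have "\<bar>(\<phi> (x + X n *\<^sub>R h) - \<phi> x) / X n\<bar> \<le> L * norm h"
        using X(2)[of n] by (simp add: field_simps)
      then have "\<bar>f x\<bar> * \<bar>(\<phi> (x + X n *\<^sub>R h) - \<phi> x) / X n\<bar> \<le> \<bar>f x\<bar> * (L * norm h)"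
        by (rule mult_left_mono) simp
      then show ?thesis using True by (simp add: abs_mult mult.commute)
    next
      case False
      have "norm (X n *\<^sub>R h) \<le> B * norm h" using B(2)[of n] by (simp add: mult_right_mono)
      then have "norm (x + X n *\<^sub>R h) \<ge> r" "norm x \<ge> r"
        using False norm_diff_ineq[of x "X n *\<^sub>R h"] norm_ge_zero[of "X n *\<^sub>R h"] by linarith+
      then show ?thesis using r False by simp
    qed
    then show "AE x in lebesgue. norm (f x * ((\<phi> (x + X n *\<^sub>R h) - \<phi> x) / X n))
        \<le> (L * norm h) * (indicator (cball 0 (r + B * norm h)) x * \<bar>f x\<bar>)" for n by simp
  qed (rule meas)
qed

text \<open>The translation falls on \<phi>, so the pairing of \<open>u\<close> with the shifted
  \<phi> is differentiable in the shift parameter and the one-dimensional mean value theorem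
  applies. The intermediate point \<open>s\<close> depends on \<phi>; what is derived from it must
  be uniform in \<open>s\<close>.\<close>

lemma weak_mean_value:
  assumes w: "has_weak_gradient u G" and \<phi>: "test_function \<phi>"
  shows "\<exists>s. 0 < s \<and> s < 1 \<and>
    (LINT x|lebesgue. (u (x + h) - u x) * \<phi> x) = (LINT x|lebesgue. (G (x + s *\<^sub>R h) \<bullet> h) * \<phi> x)"
proof -
  note li = has_weak_gradient_locally_integrable[OF w]
  note liG = locally_integrable_inner[OF li(2), of h]
  define k where "k s = (LINT x|lebesgue. u x * \<phi> (x - s *\<^sub>R h))" for s
  have int: "integrable lebesgue (\<lambda>x. u x * \<phi> (x - a))" for a
    using integrable_mult_test[OF li(1) test_shift[OF \<phi>, of "- a"]] by simp
  have "(k has_real_derivative (LINT x|lebesgue. (G (x + s *\<^sub>R h) \<bullet> h) * \<phi> x)) (at s)" for s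
    unfolding DERIV_def tendsto_at_iff_sequentially
  proof (intro allI impI)
    fix X :: "nat \<Rightarrow> real" assume X: "\<forall>i. X i \<in> UNIV - {0}" "X \<longlonglongrightarrow> 0"
    let ?\<psi> = "\<lambda>x. \<phi> (x - s *\<^sub>R h)"
    have \<psi>: "test_function ?\<psi>" using test_shift[OF \<phi>, of "- (s *\<^sub>R h)"] by simp
    have "(\<lambda>n. LINT x|lebesgue. u x * ((?\<psi> (x + X n *\<^sub>R (- h)) - ?\<psi> x) / X n))
        \<longlonglongrightarrow> (LINT x|lebesgue. u x * (tgrad ?\<psi> x \<bullet> (- h)))"
      using X by (intro test_difference_quotient li \<psi>) auto
    also have "(LINT x|lebesgue. u x * (tgrad ?\<psi> x \<bullet> (- h))) = (LINT x|lebesgue. (G x \<bullet> h) * ?\<psi> x)"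
      using has_weak_gradient_inner[OF w \<psi>, of "- h"] by simp
    also have "\<dots> = (LINT x|lebesgue. (G (x + s *\<^sub>R h) \<bullet> h) * \<phi> x)"
      by (rule integral_shift_test[OF liG \<phi>])
    also have "(\<lambda>n. LINT x|lebesgue. u x * ((?\<psi> (x + X n *\<^sub>R (- h)) - ?\<psi> x) / X n))
        = (\<lambda>t. (k (s + t) - k s) / t) \<circ> X"
    proof
      fix n
      have "(LINT x|lebesgue. u x * ((?\<psi> (x + X n *\<^sub>R (- h)) - ?\<psi> x) / X n))
          = (LINT x|lebesgue. (u x * \<phi> (x - (s + X n) *\<^sub>R h) - u x * \<phi> (x - s *\<^sub>R h)) / X n)"
        by (intro Bochner_Integration.integral_cong) (auto simp: algebra_simps diff_divide_distrib)
      also have "\<dots> = (k (s + X n) - k s) / X n"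
        using int by (simp add: k_def)
      finally show "(LINT x|lebesgue. u x * ((?\<psi> (x + X n *\<^sub>R (- h)) - ?\<psi> x) / X n))
          = ((\<lambda>t. (k (s + t) - k s) / t) \<circ> X) n" by simp
    qed
    finally show "((\<lambda>t. (k (s + t) - k s) / t) \<circ> X)
        \<longlonglongrightarrow> (LINT x|lebesgue. (G (x + s *\<^sub>R h) \<bullet> h) * \<phi> x)" .
  qed
  then obtain s where s: "0 < s" "s < 1" "k 1 - k 0 = (LINT x|lebesgue. (G (x + s *\<^sub>R h) \<bullet> h) * \<phi> x)"
    using MVT2[of 0 1 k "\<lambda>s. LINT x|lebesgue. (G (x + s *\<^sub>R h) \<bullet> h) * \<phi> x"] by auto
  have "k 1 - k 0 = (LINT x|lebesgue. u (x + h) * \<phi> x) - (LINT x|lebesgue. u x * \<phi> x)"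
    using integral_shift_test[OF li(1) \<phi>, of h] by (simp add: k_def)
  also have "\<dots> = (LINT x|lebesgue. (u (x + h) - u x) * \<phi> x)"
    using integrable_mult_test[OF li(1) \<phi>] integrable_mult_test[OF locally_integrable_shift[OF li(1), of h] \<phi>]
    by (simp add: left_diff_distrib)
  finally show ?thesis using s by auto
qed

lemma abs_integral_test_le:
  fixes f :: "real ^ 'n::finite \<Rightarrow> real"
  assumes f: "locally_integrable f" and \<phi>: "test_function \<phi>"
    and M: "\<And>x. \<bar>\<phi> x\<bar> \<le> M" and r: "\<And>x. norm x \<ge> r \<Longrightarrow> \<phi> x = 0"
  shows "\<bar>LINT x|lebesgue. f x * \<phi> x\<bar> \<le> M * (LINT x|lebesgue. indicator (cball 0 r) x * \<bar>f x\<bar>)"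
proof -
  have "\<bar>LINT x|lebesgue. f x * \<phi> x\<bar> \<le> (LINT x|lebesgue. \<bar>f x * \<phi> x\<bar>)"
    by (rule integral_abs_bound)
  also have "\<dots> \<le> (LINT x|lebesgue. M * (indicator (cball 0 r) x * \<bar>f x\<bar>))"
  proof (rule integral_mono)
    show "integrable lebesgue (\<lambda>x. \<bar>f x * \<phi> x\<bar>)"
      using integrable_mult_test[OF f \<phi>] by auto
    show "integrable lebesgue (\<lambda>x. M * (indicator (cball 0 r) x * \<bar>f x\<bar>))"
      by (intro integrable_mult_right locally_integrable_abs_cball[OF f])
    show "\<bar>f x * \<phi> x\<bar> \<le> M * (indicator (cball 0 r) x * \<bar>f x\<bar>)" for x
      using mult_right_mono[OF M[of x], of "\<bar>f x\<bar>"] r[of x]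
      by (cases "norm x \<le> r") (auto simp: abs_mult mult_ac)
  qed
  finally show ?thesis by simp
qed

text \<open>By duality it suffices to bound the pairing with each \<phi>, which the mean value
  theorem turns into an integral of the shifted \<open>G\<close>. Undoing the shift enlarges the
  ball by at most \<open>norm h\<close> and so removes the unknown \<open>s\<close>; the
  \<open>2 * r\<close> stems from the duality.\<close>

lemma translation_L1_estimate:
  assumes w: "has_weak_gradient u G" and r: "r > 0"
  shows "(LINT x|lebesgue. indicator (cball 0 r) x * \<bar>u (x + h) - u x\<bar>)
    \<le> (LINT x|lebesgue. indicator (cball 0 (2 * r + norm h)) x * \<bar>G x \<bullet> h\<bar>)"
proof -
  note li = has_weak_gradient_locally_integrable[OF w]
  note liG = locally_integrable_inner[OF li(2), of h]
  show ?thesis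
  proof (rule L1_norm_le_by_duality)
    show "locally_integrable (\<lambda>x. u (x + h) - u x)"
      by (intro locally_integrable_diff locally_integrable_shift li)
    fix \<phi> :: "real ^ 'a \<Rightarrow> real"
    assume \<phi>: "test_function \<phi>" "\<And>x. \<bar>\<phi> x\<bar> \<le> 1" "\<And>x. norm x \<ge> 2 * r \<Longrightarrow> \<phi> x = 0"
    obtain s where s: "0 < s" "s < 1" and eq:
      "(LINT x|lebesgue. (u (x + h) - u x) * \<phi> x) = (LINT x|lebesgue. (G (x + s *\<^sub>R h) \<bullet> h) * \<phi> x)"
      using weak_mean_value[OF w \<phi>(1)] by blast
    have "\<bar>LINT x|lebesgue. (G (x + s *\<^sub>R h) \<bullet> h) * \<phi> x\<bar>
        \<le> 1 * (LINT x|lebesgue. indicator (cball 0 (2 * r)) x * \<bar>G (x + s *\<^sub>R h) \<bullet> h\<bar>)"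
      using \<phi> by (intro abs_integral_test_le locally_integrable_shift[OF liG]) auto
    also have "\<dots> \<le> (LINT x|lebesgue. indicator (cball 0 (2 * r + norm h)) (x + s *\<^sub>R h) * \<bar>G (x + s *\<^sub>R h) \<bullet> h\<bar>)"
      unfolding mult_1
    proof (rule integral_mono)
      show "integrable lebesgue (\<lambda>x. indicator (cball 0 (2 * r)) x * \<bar>G (x + s *\<^sub>R h) \<bullet> h\<bar>)"
        using locally_integrable_abs_cball[OF locally_integrable_shift[OF liG]] .
      show "integrable lebesgue (\<lambda>x. indicator (cball 0 (2 * r + norm h)) (x + s *\<^sub>R h) * \<bar>G (x + s *\<^sub>R h) \<bullet> h\<bar>)"
        using integrable_lebesgue_translation[OF locally_integrable_abs_cball[OF liG]] .
      fix x
      have "norm (s *\<^sub>R h) \<le> norm h" using s by (simp add: mult_left_le_one_le)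
      then show "indicator (cball 0 (2 * r)) x * \<bar>G (x + s *\<^sub>R h) \<bullet> h\<bar>
        \<le> indicator (cball 0 (2 * r + norm h)) (x + s *\<^sub>R h) * \<bar>G (x + s *\<^sub>R h) \<bullet> h\<bar>"
        using norm_triangle_ineq[of x "s *\<^sub>R h"] by (auto simp: indicator_def)
    qed
    also have "\<dots> = (LINT x|lebesgue. indicator (cball 0 (2 * r + norm h)) x * \<bar>G x \<bullet> h\<bar>)"
      using integral_lebesgue_translation[OF borel_measurable_integrable[OF locally_integrable_abs_cball[OF liG]]] .
    finally show "\<bar>LINT x|lebesgue. (u (x + h) - u x) * \<phi> x\<bar>
        \<le> (LINT x|lebesgue. indicator (cball 0 (2 * r + norm h)) x * \<bar>G x \<bullet> h\<bar>)"
      using eq by simp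
  qed (rule r)
qed

text \<open>Against a test function the quotient equals \<open>G\<close> shifted by
  \<open>s *\<^sub>R (t *\<^sub>R h)\<close>. Since \<open>s\<close> < 1, the continuity of
  translation in the mean controls the difference from \<open>G\<close> for all \<phi> at
  once.\<close>

lemma difference_quotient_tendsto_L1:
  assumes w: "has_weak_gradient u G" and r: "r > 0"
  shows "((\<lambda>t. LINT x|lebesgue. indicator (cball 0 r) x * \<bar>(u (x + t *\<^sub>R h) - u x) / t - G x \<bullet> h\<bar>) \<longlongrightarrow> 0) (at 0)"
proof (rule tendstoI)
  note li = has_weak_gradient_locally_integrable[OF w]
  note liG = locally_integrable_inner[OF li(2), of h]
  fix e :: real assume e: "e > 0"
  obtain d where d: "d > 0" "\<And>k. norm k < d \<Longrightarrow>
      (LINT x|lebesgue. indicator (cball 0 (2 * r)) x * \<bar>G (x + k) \<bullet> h - G x \<bullet> h\<bar>) < e / 2"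
    using L1_translation_continuous[OF liG, of "2 * r" "e / 2"] r e by auto
  \<comment> \<open>The added 1 covers \<open>h = 0\<close> too.\<close>
  define d' where "d' = d / (norm h + 1)"
  have d': "d' > 0" using d(1) unfolding d'_def by (intro divide_pos_pos) (auto intro: add_nonneg_pos)
  have le: "(LINT x|lebesgue. indicator (cball 0 r) x * \<bar>(u (x + t *\<^sub>R h) - u x) / t - G x \<bullet> h\<bar>) \<le> e / 2"
    if t: "t \<noteq> 0" "\<bar>t\<bar> < d'" for t
  proof -
    have quot: "locally_integrable (\<lambda>x. (u (x + t *\<^sub>R h) - u x) / t)"
      by (rule locally_integrable_difference_quotient[OF li(1)])
    show ?thesis
    proof (rule L1_norm_le_by_duality)
      show "locally_integrable (\<lambda>x. (u (x + t *\<^sub>R h) - u x) / t - G x \<bullet> h)"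
        by (intro locally_integrable_diff quot liG)
      fix \<phi> :: "real ^ 'a \<Rightarrow> real"
    assume \<phi>: "test_function \<phi>" "\<And>x. \<bar>\<phi> x\<bar> \<le> 1" "\<And>x. norm x \<ge> 2 * r \<Longrightarrow> \<phi> x = 0"
      obtain s where s: "0 < s" "s < 1" and eq:
        "(LINT x|lebesgue. (u (x + t *\<^sub>R h) - u x) * \<phi> x) = (LINT x|lebesgue. (G (x + s *\<^sub>R (t *\<^sub>R h)) \<bullet> (t *\<^sub>R h)) * \<phi> x)"
        using weak_mean_value[OF w \<phi>(1)] by blast
      have i1: "integrable lebesgue (\<lambda>x. (u (x + t *\<^sub>R h) - u x) / t * \<phi> x)"
        by (rule integrable_mult_test[OF quot \<phi>(1)])
      have i2: "integrable lebesgue (\<lambda>x. (G x \<bullet> h) * \<phi> x)"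
        by (rule integrable_mult_test[OF liG \<phi>(1)])
      have i3: "integrable lebesgue (\<lambda>x. (G (x + s *\<^sub>R (t *\<^sub>R h)) \<bullet> h) * \<phi> x)"
        by (rule integrable_mult_test[OF locally_integrable_shift[OF liG] \<phi>(1)])
      have "(LINT x|lebesgue. ((u (x + t *\<^sub>R h) - u x) / t - G x \<bullet> h) * \<phi> x)
          = (LINT x|lebesgue. (u (x + t *\<^sub>R h) - u x) / t * \<phi> x) - (LINT x|lebesgue. (G x \<bullet> h) * \<phi> x)"
        unfolding left_diff_distrib by (rule Bochner_Integration.integral_diff[OF i1 i2])
      also have "(LINT x|lebesgue. (u (x + t *\<^sub>R h) - u x) / t * \<phi> x)
          = (LINT x|lebesgue. (u (x + t *\<^sub>R h) - u x) * \<phi> x) / t"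
        by simp
      also have "\<dots> = (LINT x|lebesgue. (G (x + s *\<^sub>R (t *\<^sub>R h)) \<bullet> h) * \<phi> x)"
        unfolding eq using t(1) by (simp add: mult.assoc)
      also have "\<dots> - (LINT x|lebesgue. (G x \<bullet> h) * \<phi> x)
          = (LINT x|lebesgue. (G (x + s *\<^sub>R (t *\<^sub>R h)) \<bullet> h - G x \<bullet> h) * \<phi> x)"
        unfolding left_diff_distrib by (rule Bochner_Integration.integral_diff[OF i3 i2, symmetric])
      finally have "\<bar>LINT x|lebesgue. ((u (x + t *\<^sub>R h) - u x) / t - G x \<bullet> h) * \<phi> x\<bar>
          = \<bar>LINT x|lebesgue. (G (x + s *\<^sub>R (t *\<^sub>R h)) \<bullet> h - G x \<bullet> h) * \<phi> x\<bar>" by simp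
      also have "\<dots> \<le> 1 * (LINT x|lebesgue. indicator (cball 0 (2 * r)) x * \<bar>G (x + s *\<^sub>R (t *\<^sub>R h)) \<bullet> h - G x \<bullet> h\<bar>)"
        using \<phi> by (intro abs_integral_test_le locally_integrable_diff locally_integrable_shift[OF liG] liG) auto
      also have "\<dots> \<le> e / 2"
      proof -
        have "norm (s *\<^sub>R (t *\<^sub>R h)) \<le> \<bar>t\<bar> * (norm h + 1)"
        proof -
          have "s * (\<bar>t\<bar> * norm h) \<le> \<bar>t\<bar> * norm h" using s by (intro mult_left_le_one_le) auto
          also have "\<dots> \<le> \<bar>t\<bar> * (norm h + 1)" by (intro mult_left_mono) auto
          finally show ?thesis using s by (simp add: abs_mult mult.assoc)
        qed
        also have "\<dots> < d" using t(2) unfolding d'_def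
          by (subst (asm) pos_less_divide_eq) (auto intro: add_nonneg_pos)
        finally show ?thesis using d(2) by (simp add: less_imp_le)
      qed
      finally show "\<bar>LINT x|lebesgue. ((u (x + t *\<^sub>R h) - u x) / t - G x \<bullet> h) * \<phi> x\<bar> \<le> e / 2" .
    qed (rule r)
  qed
  have ge: "(LINT x|lebesgue. indicator (cball 0 r) x * \<bar>(u (x + t *\<^sub>R h) - u x) / t - G x \<bullet> h\<bar>) \<ge> 0" for t
    by (intro integral_nonneg_AE) auto
  have "\<forall>\<^sub>F t in at 0. t \<noteq> 0 \<and> \<bar>t\<bar> < d'"
    using d' by (auto simp: eventually_at intro!: exI[of _ d'])
  then show "\<forall>\<^sub>F t in at 0. dist (LINT x|lebesgue. indicator (cball 0 r) x * \<bar>(u (x + t *\<^sub>R h) - u x) / t - G x \<bullet> h\<bar>) 0 < e"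
  proof eventually_elim
    case (elim t)
    then show ?case using le[of t] ge[of t] e by (simp add: dist_real_def)
  qed
qed

text \<open>The converse direction. One sequence of steps for each ball and direction is enough, so
  a subsequence chosen for a.e. convergence can serve here.\<close>

lemma has_weak_gradient_by_difference_quotients:
  fixes w :: "real ^ 'n::finite \<Rightarrow> real" and H :: "real ^ 'n \<Rightarrow> real ^ 'n"
  assumes li: "locally_integrable w" "locally_integrable H"
    and dq: "\<And>r i. r > 0 \<Longrightarrow> \<exists>X. X \<longlonglongrightarrow> 0 \<and> (\<forall>n. X n \<noteq> 0) \<and>
      (\<lambda>n. LINT x|lebesgue. indicator (cball 0 r) x * \<bar>(w (x + X n *\<^sub>R axis i 1) - w x) / X n - H x \<bullet> axis i 1\<bar>) \<longlonglongrightarrow> 0"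
  shows "has_weak_gradient w H"
proof (rule has_weak_gradientI[OF li])
  fix \<phi> :: "real ^ 'n \<Rightarrow> real" and i :: 'n
  assume \<phi>: "test_function \<phi>"
  let ?e = "axis i 1 :: real ^ 'n"
  obtain r where r: "r > 0" "\<And>x. norm x \<ge> r \<Longrightarrow> \<phi> x = 0"
    using test_function_support[OF \<phi>] by blast
  obtain M where M: "M > 0" "\<And>x. \<bar>\<phi> x\<bar> \<le> M"
    using test_bounded[OF \<phi>] by blast
  obtain X where X: "X \<longlonglongrightarrow> 0" "\<And>n. X n \<noteq> 0"
    and lim: "(\<lambda>n. LINT x|lebesgue. indicator (cball 0 r) x * \<bar>(w (x + X n *\<^sub>R ?e) - w x) / X n - H x \<bullet> ?e\<bar>) \<longlonglongrightarrow> 0"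
    using dq[OF r(1), of i] by blast
  note liH = locally_integrable_inner[OF li(2), of ?e]
  \<comment> \<open>Discrete integration by parts: a change of variables moves the quotient of
    \<open>w\<close> with step \<open>X n\<close> onto \<phi>, where it becomes a quotient with step
    \<open>- X n\<close> and changes sign.\<close>
  define A where "A n = (LINT x|lebesgue. w x * ((\<phi> (x + (- X n) *\<^sub>R ?e) - \<phi> x) / (- X n)))" for n
  have A: "A \<longlonglongrightarrow> (LINT x|lebesgue. w x * (tgrad \<phi> x \<bullet> ?e))"
    unfolding A_def using X tendsto_minus[OF X(1)] by (intro test_difference_quotient li \<phi>) auto
  have le: "\<bar>A n + (LINT x|lebesgue. (H x \<bullet> ?e) * \<phi> x)\<bar>
      \<le> M * (LINT x|lebesgue. indicator (cball 0 r) x * \<bar>(w (x + X n *\<^sub>R ?e) - w x) / X n - H x \<bullet> ?e\<bar>)" for n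
  proof -
    have quot: "locally_integrable (\<lambda>x. (w (x + X n *\<^sub>R ?e) - w x) / X n)"
      by (rule locally_integrable_difference_quotient[OF li(1)])
    have i1: "integrable lebesgue (\<lambda>x. w x * \<phi> (x - X n *\<^sub>R ?e))"
      using integrable_mult_test[OF li(1) test_shift[OF \<phi>, of "- (X n *\<^sub>R ?e)"]] by simp
    have i2: "integrable lebesgue (\<lambda>x. w x * \<phi> x)"
      by (rule integrable_mult_test[OF li(1) \<phi>])
    have i3: "integrable lebesgue (\<lambda>x. w (x + X n *\<^sub>R ?e) * \<phi> x)"
      by (rule integrable_mult_test[OF locally_integrable_shift[OF li(1)] \<phi>])
    have "A n = (LINT x|lebesgue. (w x * \<phi> (x - X n *\<^sub>R ?e) - w x * \<phi> x) / (- X n))"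
      unfolding A_def by (intro Bochner_Integration.integral_cong) (auto simp: algebra_simps diff_divide_distrib)
    also have "\<dots> = ((LINT x|lebesgue. w x * \<phi> (x - X n *\<^sub>R ?e)) - (LINT x|lebesgue. w x * \<phi> x)) / (- X n)"
      using Bochner_Integration.integral_diff[OF i1 i2] by (simp only: integral_divide_zero)
    also have "\<dots> = ((LINT x|lebesgue. w (x + X n *\<^sub>R ?e) * \<phi> x) - (LINT x|lebesgue. w x * \<phi> x)) / (- X n)"
      by (simp only: integral_shift_test[OF li(1) \<phi>])
    also have "\<dots> = - (LINT x|lebesgue. (w (x + X n *\<^sub>R ?e) * \<phi> x - w x * \<phi> x) / X n)"
      using Bochner_Integration.integral_diff[OF i3 i2] by simp
    also have "\<dots> = - (LINT x|lebesgue. (w (x + X n *\<^sub>R ?e) - w x) / X n * \<phi> x)"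
      by (simp add: algebra_simps)
    finally have "A n + (LINT x|lebesgue. (H x \<bullet> ?e) * \<phi> x)
        = - (LINT x|lebesgue. ((w (x + X n *\<^sub>R ?e) - w x) / X n - H x \<bullet> ?e) * \<phi> x)"
      using Bochner_Integration.integral_diff[OF integrable_mult_test[OF quot \<phi>] integrable_mult_test[OF liH \<phi>]]
      by (simp only: left_diff_distrib)
    then show ?thesis
      using abs_integral_test_le[OF locally_integrable_diff[OF quot liH] \<phi> M(2) r(2)] by simp
  qed
  have "(\<lambda>n. A n + (LINT x|lebesgue. (H x \<bullet> ?e) * \<phi> x)) \<longlonglongrightarrow> 0"
    by (rule Lim_null_comparison[OF always_eventually tendsto_mult_right_zero[OF lim, of M]])
      (use le in auto)
  moreover have "(\<lambda>n. A n + (LINT x|lebesgue. (H x \<bullet> ?e) * \<phi> x))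
      \<longlonglongrightarrow> (LINT x|lebesgue. w x * (tgrad \<phi> x \<bullet> ?e)) + (LINT x|lebesgue. (H x \<bullet> ?e) * \<phi> x)"
    by (intro tendsto_intros A)
  ultimately have "(LINT x|lebesgue. w x * (tgrad \<phi> x \<bullet> ?e)) + (LINT x|lebesgue. (H x \<bullet> ?e) * \<phi> x) = 0"
    using LIMSEQ_unique by blast
  then show "(LINT x|lebesgue. w x * (tgrad \<phi> x \<bullet> ?e)) = - (LINT x|lebesgue. (H x \<bullet> ?e) * \<phi> x)"
    by linarith
qed

section \<open>Shifts, multiples and products with test functions\<close>

lemma has_weak_gradient_shift:
  assumes w: "has_weak_gradient u G"
  shows "has_weak_gradient (\<lambda>x. u (x + a)) (\<lambda>x. G (x + a))"
proof (rule has_weak_gradientI)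
  note li = has_weak_gradient_locally_integrable[OF w]
  show "locally_integrable (\<lambda>x. u (x + a))" "locally_integrable (\<lambda>x. G (x + a))"
    using li by (auto intro: locally_integrable_shift)
  fix \<phi> :: "real ^ 'a \<Rightarrow> real" and i :: 'a
  assume \<phi>: "test_function \<phi>"
  let ?\<psi> = "\<lambda>x. \<phi> (x - a)"
  have \<psi>: "test_function ?\<psi>" using test_shift[OF \<phi>, of "- a"] by simp
  have "(LINT x|lebesgue. u (x + a) * (tgrad \<phi> x \<bullet> axis i 1)) = (LINT x|lebesgue. u (x + a) * (tgrad ?\<psi> (x + a) \<bullet> axis i 1))"
    using tgrad_shift[OF \<phi>, of "- a"] by simp
  also have "\<dots> = (LINT x|lebesgue. u x * (tgrad ?\<psi> x \<bullet> axis i 1))"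
    by (rule integral_lebesgue_translation[OF borel_measurable_integrable[OF integrable_mult_tgrad[OF li(1) \<psi>]]])
  also have "\<dots> = - (LINT x|lebesgue. (G x \<bullet> axis i 1) * ?\<psi> x)"
    by (rule has_weak_gradient_inner[OF w \<psi>])
  also have "(LINT x|lebesgue. (G x \<bullet> axis i 1) * ?\<psi> x) = (LINT x|lebesgue. (G (x + a) \<bullet> axis i 1) * \<phi> x)"
    by (rule integral_shift_test[OF locally_integrable_inner[OF li(2)] \<phi>])
  finally show "(LINT x|lebesgue. u (x + a) * (tgrad \<phi> x \<bullet> axis i 1)) = - (LINT x|lebesgue. (G (x + a) \<bullet> axis i 1) * \<phi> x)" .
qed

lemma has_weak_gradient_scaleR:
  assumes w: "has_weak_gradient u G"
  shows "has_weak_gradient (\<lambda>x. c * u x) (\<lambda>x. c *\<^sub>R G x)"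
proof (rule has_weak_gradientI)
  note li = has_weak_gradient_locally_integrable[OF w]
  show "locally_integrable (\<lambda>x. c * u x)" "locally_integrable (\<lambda>x. c *\<^sub>R G x)"
    using locally_integrable_scaleR[OF li(1), of c] locally_integrable_scaleR[OF li(2), of c] by auto
  fix \<phi> :: "real ^ 'a \<Rightarrow> real" and i :: 'a
  assume \<phi>: "test_function \<phi>"
  show "(LINT x|lebesgue. c * u x * (tgrad \<phi> x \<bullet> axis i 1)) = - (LINT x|lebesgue. (c *\<^sub>R G x \<bullet> axis i 1) * \<phi> x)"
    using has_weak_gradient_inner[OF w \<phi>, of "axis i 1"] by (simp add: mult.assoc)
qed

lemma locally_integrable_test_mult:
  fixes f :: "real ^ 'n::finite \<Rightarrow> 'b::euclidean_space"
  assumes f: "locally_integrable f" and \<phi>: "test_function \<phi>"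
  shows "locally_integrable (\<lambda>x. \<phi> x *\<^sub>R f x)"
proof -
  obtain M where M: "M > 0" "\<And>x. \<bar>\<phi> x\<bar> \<le> M"
    using test_bounded[OF \<phi>] by blast
  show ?thesis
  proof (rule locally_integrable_cong_bound[OF locally_integrable_scaleR[OF f, of M]])
    show "(\<lambda>x. \<phi> x *\<^sub>R f x) \<in> borel_measurable lebesgue"
      by (intro borel_measurable_scaleR borel_measurable_lebesgue_continuous
        test_continuous \<phi> locally_integrable_measurable f)
    show "norm (\<phi> x *\<^sub>R f x) \<le> norm (M *\<^sub>R f x)" for x
      using M by (simp add: mult_right_mono)
  qed
qed

lemma locally_integrable_mult_tgrad:
  fixes f :: "real ^ 'n::finite \<Rightarrow> real"
  assumes f: "locally_integrable f" and \<phi>: "test_function \<phi>"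
  shows "locally_integrable (\<lambda>x. f x *\<^sub>R tgrad \<phi> x)"
proof -
  obtain L where L: "L > 0" "\<And>x. norm (tgrad \<phi> x) \<le> L"
    using tgrad_bounded[OF \<phi>] by blast
  show ?thesis
  proof (rule locally_integrable_cong_bound[OF locally_integrable_scaleR[OF f, of L]])
    show "(\<lambda>x. f x *\<^sub>R tgrad \<phi> x) \<in> borel_measurable lebesgue"
      by (intro borel_measurable_scaleR borel_measurable_lebesgue_continuous
        tgrad_continuous \<phi> locally_integrable_measurable f)
    show "norm (f x *\<^sub>R tgrad \<phi> x) \<le> norm (L *\<^sub>R f x)" for x
      using L mult_right_mono[OF L(2)[of x], of "\<bar>f x\<bar>"] by (simp add: abs_mult mult.commute)
  qed
qed

text \<open>The product of \<psi> with a test function is a test function, so the weak identity for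
  \<open>u\<close> can be tested with it and the classical product rule does the rest.\<close>

lemma has_weak_gradient_test_mult:
  assumes w: "has_weak_gradient u G" and \<psi>: "test_function \<psi>"
  shows "has_weak_gradient (\<lambda>x. \<psi> x * u x) (\<lambda>x. \<psi> x *\<^sub>R G x + u x *\<^sub>R tgrad \<psi> x)"
proof (rule has_weak_gradientI)
  note li = has_weak_gradient_locally_integrable[OF w]
  show "locally_integrable (\<lambda>x. \<psi> x * u x)"
    using locally_integrable_test_mult[OF li(1) \<psi>] by simp
  show "locally_integrable (\<lambda>x. \<psi> x *\<^sub>R G x + u x *\<^sub>R tgrad \<psi> x)"
    by (intro locally_integrable_add locally_integrable_test_mult locally_integrable_mult_tgrad li \<psi>)
  fix \<phi> :: "real ^ 'a \<Rightarrow> real" and i :: 'a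
  assume \<phi>: "test_function \<phi>"
  let ?e = "axis i 1 :: real ^ 'a"
  have prod: "test_function (\<lambda>x. \<psi> x * \<phi> x)"
    by (rule test_mult[OF \<phi> test_smooth[OF \<psi>]])
  have i1: "integrable lebesgue (\<lambda>x. u x * (tgrad (\<lambda>x. \<psi> x * \<phi> x) x \<bullet> ?e))"
    by (rule integrable_mult_tgrad[OF li(1) prod])
  have i2: "integrable lebesgue (\<lambda>x. u x * (tgrad \<psi> x \<bullet> ?e) * \<phi> x)"
    using integrable_mult_test[OF locally_integrable_inner[OF locally_integrable_mult_tgrad[OF li(1) \<psi>], of ?e] \<phi>] by simp
  have i3: "integrable lebesgue (\<lambda>x. (G x \<bullet> ?e) * (\<psi> x * \<phi> x))"
    by (rule integrable_mult_test[OF locally_integrable_inner[OF li(2)] prod])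
  have "(LINT x|lebesgue. \<psi> x * u x * (tgrad \<phi> x \<bullet> ?e))
      = (LINT x|lebesgue. u x * (tgrad (\<lambda>x. \<psi> x * \<phi> x) x \<bullet> ?e) - u x * (tgrad \<psi> x \<bullet> ?e) * \<phi> x)"
    by (intro Bochner_Integration.integral_cong) (simp_all only: tgrad_mult[OF \<psi> \<phi>] inner_add_left inner_scaleR_left, simp_all add: algebra_simps)
  also have "\<dots> = (LINT x|lebesgue. u x * (tgrad (\<lambda>x. \<psi> x * \<phi> x) x \<bullet> ?e)) - (LINT x|lebesgue. u x * (tgrad \<psi> x \<bullet> ?e) * \<phi> x)"
    by (rule Bochner_Integration.integral_diff[OF i1 i2])
  also have "\<dots> = - ((LINT x|lebesgue. (G x \<bullet> ?e) * (\<psi> x * \<phi> x)) + (LINT x|lebesgue. u x * (tgrad \<psi> x \<bullet> ?e) * \<phi> x))"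
    by (simp add: has_weak_gradient_inner[OF w prod])
  also have "\<dots> = - (LINT x|lebesgue. (G x \<bullet> ?e) * (\<psi> x * \<phi> x) + u x * (tgrad \<psi> x \<bullet> ?e) * \<phi> x)"
    by (simp only: Bochner_Integration.integral_add[OF i3 i2])
  also have "\<dots> = - (LINT x|lebesgue. ((\<psi> x *\<^sub>R G x + u x *\<^sub>R tgrad \<psi> x) \<bullet> ?e) * \<phi> x)"
    by (simp add: inner_add_left algebra_simps)
  finally show "(LINT x|lebesgue. \<psi> x * u x * (tgrad \<phi> x \<bullet> ?e))
      = - (LINT x|lebesgue. ((\<psi> x *\<^sub>R G x + u x *\<^sub>R tgrad \<psi> x) \<bullet> ?e) * \<phi> x)" .
qed

section \<open>Chain rule\<close>

text \<open>Both modes of convergence along one sequence: the pointwise one identifies limits after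
  composition, the one in the mean supplies the domination.\<close>

lemma difference_quotient_AE_subseq:
  assumes w: "has_weak_gradient u G" and r: "r > 0"
  shows "\<exists>X. X \<longlonglongrightarrow> 0 \<and> (\<forall>n. X n \<noteq> 0) \<and>
    (\<lambda>n. LINT x|lebesgue. indicator (cball 0 r) x * \<bar>(u (x + X n *\<^sub>R h) - u x) / X n - G x \<bullet> h\<bar>) \<longlonglongrightarrow> 0 \<and>
    (AE x in lebesgue. norm x \<le> r \<longrightarrow> (\<lambda>n. (u (x + X n *\<^sub>R h) - u x) / X n) \<longlonglongrightarrow> G x \<bullet> h)"
proof -
  note li = has_weak_gradient_locally_integrable[OF w]
  define Y where "Y n = inverse (real (Suc n))" for n
  have Y: "Y \<longlonglongrightarrow> 0" "\<And>n. Y n \<noteq> 0"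
    using LIMSEQ_inverse_real_of_nat by (auto simp: Y_def[abs_def])
  define D where "D n x = indicator (cball 0 r) x * ((u (x + Y n *\<^sub>R h) - u x) / Y n - G x \<bullet> h)" for n x
  have quot: "locally_integrable (\<lambda>x. (u (x + t *\<^sub>R h) - u x) / t)" for t
    by (rule locally_integrable_difference_quotient[OF li(1)])
  have D_int: "integrable lebesgue (D n)" for n
    using locally_integrable_diff[OF quot[of "Y n"] locally_integrable_inner[OF li(2), of h]]
    unfolding D_def locally_integrable_iff by simp
  have abs_D: "\<bar>D n x\<bar> = indicator (cball 0 r) x * \<bar>(u (x + Y n *\<^sub>R h) - u x) / Y n - G x \<bullet> h\<bar>" for n x
    by (simp add: D_def abs_mult)
  have "filterlim Y (at 0) sequentially"
    using Y by (simp add: filterlim_at)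
  from filterlim_compose[OF difference_quotient_tendsto_L1[OF w r] this, of h]
  have lim: "(\<lambda>n. LINT x|lebesgue. norm (D n x)) \<longlonglongrightarrow> 0"
    by (simp add: abs_D)
  obtain \<rho> where \<rho>: "strict_mono \<rho>" "AE x in lebesgue. (\<lambda>n. D (\<rho> n) x) \<longlonglongrightarrow> 0"
    using tendsto_L1_AE_subseq[OF D_int lim] by blast
  show ?thesis
  proof (intro exI[of _ "Y \<circ> \<rho>"] conjI allI)
    show "(Y \<circ> \<rho>) \<longlonglongrightarrow> 0" by (rule LIMSEQ_subseq_LIMSEQ[OF Y(1) \<rho>(1)])
    show "(Y \<circ> \<rho>) n \<noteq> 0" for n using Y(2) by simp
    show "(\<lambda>n. LINT x|lebesgue. indicator (cball 0 r) x * \<bar>(u (x + (Y \<circ> \<rho>) n *\<^sub>R h) - u x) / (Y \<circ> \<rho>) n - G x \<bullet> h\<bar>) \<longlonglongrightarrow> 0"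
      using LIMSEQ_subseq_LIMSEQ[OF lim \<rho>(1)] by (simp add: abs_D o_def)
    show "AE x in lebesgue. norm x \<le> r \<longrightarrow> (\<lambda>n. (u (x + (Y \<circ> \<rho>) n *\<^sub>R h) - u x) / (Y \<circ> \<rho>) n) \<longlonglongrightarrow> G x \<bullet> h"
      using \<rho>(2)
    proof eventually_elim
      case (elim x)
      show ?case
      proof
        assume "norm x \<le> r"
        then have "(\<lambda>n. (u (x + Y (\<rho> n) *\<^sub>R h) - u x) / Y (\<rho> n) - G x \<bullet> h) \<longlonglongrightarrow> 0"
          using elim by (simp add: D_def)
        then show "(\<lambda>n. (u (x + (Y \<circ> \<rho>) n *\<^sub>R h) - u x) / (Y \<circ> \<rho>) n) \<longlonglongrightarrow> G x \<bullet> h"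
          by (simp add: Lim_null[of _ "G x \<bullet> h"])
      qed
    qed
  qed
qed

text \<open>Integration by parts for smooth functions, obtained by reading \<phi> as \<phi> times
  the constant 1: the constant has difference quotients 0, and the product rule adds the gradient of
  \<phi>.\<close>

lemma has_weak_gradient_test:
  assumes \<phi>: "test_function \<phi>"
  shows "has_weak_gradient \<phi> (tgrad \<phi>)"
proof -
  have one: "has_weak_gradient (\<lambda>x. 1) (\<lambda>x. 0 :: real ^ 'a)"
  proof (rule has_weak_gradient_by_difference_quotients)
    fix r :: real and i :: 'a
    show "\<exists>X. X \<longlonglongrightarrow> 0 \<and> (\<forall>n. X n \<noteq> 0) \<and>
      (\<lambda>n. LINT x|lebesgue. indicator (cball 0 r) x * \<bar>(1 - 1) / X n - (0 :: real ^ 'a) \<bullet> axis i 1\<bar>) \<longlonglongrightarrow> 0"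
      by (rule exI[of _ "\<lambda>n. inverse (real (Suc n))"]) (use LIMSEQ_inverse_real_of_nat in auto)
  qed (auto intro: locally_integrable_const)
  show ?thesis using has_weak_gradient_test_mult[OF one \<phi>] by simp
qed

text \<open>The direction \<open>v n\<close> varies with \<open>n\<close>. Along the fixed limit
  direction the quotient converges by differentiability; replacing \<open>v n\<close> by its limit
  costs at most \<open>K\<close> times their distance, by the Lipschitz bound.\<close>

lemma difference_quotient_compose_tendsto:
  fixes F :: "real \<times> real \<Rightarrow> real"
  assumes F: "(F has_derivative (\<lambda>(s, t). a * s + b * t)) (at z)"
    and lip: "\<And>z z'. \<bar>F z - F z'\<bar> \<le> K * (\<bar>fst z - fst z'\<bar> + \<bar>snd z - snd z'\<bar>)"
    and X: "X \<longlonglongrightarrow> 0" "\<And>n. X n \<noteq> 0"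
    and y: "\<And>n. y n = z + X n *\<^sub>R v n" and v: "v \<longlonglongrightarrow> (v1, v2)"
  shows "(\<lambda>n. (F (y n) - F z) / X n) \<longlonglongrightarrow> a * v1 + b * v2"
proof -
  let ?v = "(v1, v2)"
  have "((\<lambda>t. z + t *\<^sub>R ?v) has_derivative (\<lambda>t. t *\<^sub>R ?v)) (at 0)"
    by (auto intro!: derivative_eq_intros)
  moreover have "(F has_derivative (\<lambda>(s, t). a * s + b * t)) (at (z + 0 *\<^sub>R ?v))"
    using F by (simp only: scaleR_zero_left add_0_right)
  ultimately have "((\<lambda>t. F (z + t *\<^sub>R ?v)) has_derivative (\<lambda>t. (\<lambda>(s, t). a * s + b * t) (t *\<^sub>R ?v))) (at 0)"
    by (rule has_derivative_compose)
  moreover have "(\<lambda>t. (\<lambda>(s, t). a * s + b * t) (t *\<^sub>R ?v)) = (*) (a * v1 + b * v2)"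
    by (auto simp: algebra_simps fun_eq_iff)
  ultimately have "((\<lambda>t. F (z + t *\<^sub>R ?v)) has_real_derivative a * v1 + b * v2) (at 0)"
    by (simp add: has_field_derivative_def)
  then have "((\<lambda>t. (F (z + t *\<^sub>R ?v) - F z) / t) \<longlongrightarrow> a * v1 + b * v2) (at 0)"
    by (simp add: DERIV_def flip: zero_prod_def)
  moreover have "filterlim X (at 0) sequentially"
    using X by (simp add: filterlim_at)
  ultimately have l1: "(\<lambda>n. (F (z + X n *\<^sub>R ?v) - F z) / X n) \<longlonglongrightarrow> a * v1 + b * v2"
    by (rule filterlim_compose)
  have l2: "(\<lambda>n. (F (y n) - F (z + X n *\<^sub>R ?v)) / X n) \<longlonglongrightarrow> 0"
  proof (rule Lim_null_comparison)
    have "norm ((F (y n) - F (z + X n *\<^sub>R ?v)) / X n) \<le> K * (\<bar>fst (v n) - v1\<bar> + \<bar>snd (v n) - v2\<bar>)" for n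
    proof -
      have e: "fst (y n) - fst (z + X n *\<^sub>R ?v) = X n * (fst (v n) - v1)"
        "snd (y n) - snd (z + X n *\<^sub>R ?v) = X n * (snd (v n) - v2)"
        by (simp_all add: y right_diff_distrib)
      have "\<bar>F (y n) - F (z + X n *\<^sub>R ?v)\<bar> \<le> K * (\<bar>X n\<bar> * \<bar>fst (v n) - v1\<bar> + \<bar>X n\<bar> * \<bar>snd (v n) - v2\<bar>)"
        using lip[of "y n" "z + X n *\<^sub>R ?v"] unfolding e abs_mult .
      also have "\<dots> = \<bar>X n\<bar> * (K * (\<bar>fst (v n) - v1\<bar> + \<bar>snd (v n) - v2\<bar>))"
        by (simp add: distrib_left mult.left_commute)
      finally show ?thesis using X(2)[of n] by (simp add: field_simps)
    qed
    then show "\<forall>\<^sub>F n in sequentially. norm ((F (y n) - F (z + X n *\<^sub>R ?v)) / X n)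
        \<le> K * (\<bar>fst (v n) - v1\<bar> + \<bar>snd (v n) - v2\<bar>)" by simp
    have "(\<lambda>n. K * (\<bar>fst (v n) - v1\<bar> + \<bar>snd (v n) - v2\<bar>)) \<longlonglongrightarrow> K * (\<bar>fst ?v - v1\<bar> + \<bar>snd ?v - v2\<bar>)"
      by (intro tendsto_intros v)
    then show "(\<lambda>n. K * (\<bar>fst (v n) - v1\<bar> + \<bar>snd (v n) - v2\<bar>)) \<longlonglongrightarrow> 0" by simp
  qed
  show ?thesis using tendsto_add[OF l1 l2] by (simp add: diff_divide_distrib)
qed

text \<open>\<open>F\<close> acts on \<open>u\<close> together with a test function, so that one
  rule yields both the competitor mixing \<open>u\<close> with a cutoff and, with the zero test
  function, the logarithm of \<open>u\<close>. Quotients of the composition converge a.e. along a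
  subsequence, and the Lipschitz bound on \<open>F\<close> transfers their domination to the
  quotients of \<open>u\<close>.\<close>

lemma has_weak_gradient_chain:
  fixes F :: "real \<times> real \<Rightarrow> real" and u \<psi> :: "real ^ 'n::finite \<Rightarrow> real"
  assumes w: "has_weak_gradient u G" and \<psi>: "test_function \<psi>"
    and F: "\<And>z. (F has_derivative (\<lambda>(s, t). A z * s + B z * t)) (at z)"
    and cont: "continuous_on UNIV A" "continuous_on UNIV B"
    and L: "\<And>z. \<bar>A z\<bar> \<le> L" "\<And>z. \<bar>B z\<bar> \<le> L"
  shows "has_weak_gradient (\<lambda>x. F (u x, \<psi> x))
    (\<lambda>x. A (u x, \<psi> x) *\<^sub>R G x + B (u x, \<psi> x) *\<^sub>R tgrad \<psi> x)"
proof -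
  note li = has_weak_gradient_locally_integrable[OF w]
  note li\<psi> = has_weak_gradient_locally_integrable[OF has_weak_gradient_test[OF \<psi>]]
  \<comment> \<open>Two partial derivatives, each at most \<open>L\<close> in absolute value, acting
    on coordinates that are at most the norm of the pair.\<close>
  define K where "K = 2 * L"
  have L0: "L \<ge> 0" using L(1)[of 0] by linarith
  have K0: "K \<ge> 0" using L0 by (simp add: K_def)
  have lip: "\<bar>F z - F z'\<bar> \<le> K * (\<bar>fst z - fst z'\<bar> + \<bar>snd z - snd z'\<bar>)" for z z'
  proof -
    have "norm (F z - F z') \<le> K * norm (z - z')"
    proof (rule differentiable_bound[of UNIV])
      fix y :: "real \<times> real"
      show "onorm (\<lambda>(s, t). A y * s + B y * t) \<le> K"
      proof (rule onorm_le)
        fix v :: "real \<times> real"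
        have "\<bar>A y * fst v + B y * snd v\<bar> \<le> \<bar>A y\<bar> * \<bar>fst v\<bar> + \<bar>B y\<bar> * \<bar>snd v\<bar>"
          by (metis abs_mult abs_triangle_ineq)
        also have "\<dots> \<le> L * norm v + L * norm v"
          using L L0 norm_fst_le[of "fst v" "snd v"] norm_snd_le[of "snd v" "fst v"]
          by (intro add_mono mult_mono) auto
        finally show "norm (case v of (s, t) \<Rightarrow> A y * s + B y * t) \<le> K * norm v"
          by (simp add: K_def case_prod_beta)
      qed
    qed (use F in auto)
    also have "\<dots> \<le> K * (\<bar>fst z - fst z'\<bar> + \<bar>snd z - snd z'\<bar>)"
      using K0 norm_Pair_le[of "fst z - fst z'" "snd z - snd z'"]
      by (intro mult_left_mono) (auto simp: minus_prod_def)
    finally show ?thesis by simp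
  qed
  have F_cont: "continuous_on UNIV F"
    using has_derivative_continuous[OF F] by (intro continuous_at_imp_continuous_on ballI)
  have meas: "u \<in> borel_measurable lebesgue" "\<psi> \<in> borel_measurable lebesgue"
    "G \<in> borel_measurable lebesgue" "tgrad \<psi> \<in> borel_measurable lebesgue"
    using li li\<psi> locally_integrable_measurable by auto
  have pair: "(\<lambda>x. (u x, \<psi> x)) \<in> borel_measurable lebesgue"
    using meas by (intro borel_measurable_Pair)
  define H where "H x = A (u x, \<psi> x) *\<^sub>R G x + B (u x, \<psi> x) *\<^sub>R tgrad \<psi> x" for x
  have liw: "locally_integrable (\<lambda>x. F (u x, \<psi> x))"
  proof (rule locally_integrable_cong_bound)
    show "locally_integrable (\<lambda>x. \<bar>F (0, 0)\<bar> + K *\<^sub>R (\<bar>u x\<bar> + \<bar>\<psi> x\<bar>))"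
      using locally_integrable_abs_cball[OF li(1)] locally_integrable_abs_cball[OF li\<psi>(1)]
      by (intro locally_integrable_add locally_integrable_scaleR locally_integrable_const)
        (simp_all add: locally_integrable_iff)
    show "(\<lambda>x. F (u x, \<psi> x)) \<in> borel_measurable lebesgue"
      by (rule borel_measurable_continuous_on[OF F_cont pair])
    show "norm (F (u x, \<psi> x)) \<le> norm (\<bar>F (0, 0)\<bar> + K *\<^sub>R (\<bar>u x\<bar> + \<bar>\<psi> x\<bar>))" for x
      using lip[of "(u x, \<psi> x)" "(0, 0)"] K0 by auto
  qed
  have liH: "locally_integrable H"
  proof (rule locally_integrable_cong_bound)
    have "locally_integrable (\<lambda>x. norm (G x))" "locally_integrable (\<lambda>x. norm (tgrad \<psi> x))"
      by (rule locally_integrable_cong_bound[OF li(2)], use meas in auto)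
        (rule locally_integrable_cong_bound[OF li\<psi>(2)], use meas in auto)
    then show "locally_integrable (\<lambda>x. L *\<^sub>R (norm (G x) + norm (tgrad \<psi> x)))"
      by (intro locally_integrable_add locally_integrable_scaleR)
    show "H \<in> borel_measurable lebesgue"
      unfolding H_def using meas pair cont
      by (intro borel_measurable_add borel_measurable_scaleR borel_measurable_continuous_on[OF _ pair])
    show "norm (H x) \<le> norm (L *\<^sub>R (norm (G x) + norm (tgrad \<psi> x)))" for x
    proof -
      have "norm (H x) \<le> \<bar>A (u x, \<psi> x)\<bar> * norm (G x) + \<bar>B (u x, \<psi> x)\<bar> * norm (tgrad \<psi> x)"
        using norm_triangle_ineq[of "A (u x, \<psi> x) *\<^sub>R G x" "B (u x, \<psi> x) *\<^sub>R tgrad \<psi> x"]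
        by (simp add: H_def)
      also have "\<dots> \<le> L * norm (G x) + L * norm (tgrad \<psi> x)"
        using L by (intro add_mono mult_right_mono) auto
      also have "\<dots> = norm (L *\<^sub>R (norm (G x) + norm (tgrad \<psi> x)))"
        using L0 by (simp add: algebra_simps)
      finally show ?thesis .
    qed
  qed
  have "has_weak_gradient (\<lambda>x. F (u x, \<psi> x)) H"
  proof (rule has_weak_gradient_by_difference_quotients[OF liw liH])
    fix r :: real and i :: 'n assume r: "r > 0"
    let ?e = "axis i 1 :: real ^ 'n"
    obtain X where X: "X \<longlonglongrightarrow> 0" "\<And>n. X n \<noteq> 0"
      and lim: "(\<lambda>n. LINT x|lebesgue. indicator (cball 0 r) x * \<bar>(u (x + X n *\<^sub>R ?e) - u x) / X n - G x \<bullet> ?e\<bar>) \<longlonglongrightarrow> 0"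
      and ae: "AE x in lebesgue. norm x \<le> r \<longrightarrow> (\<lambda>n. (u (x + X n *\<^sub>R ?e) - u x) / X n) \<longlonglongrightarrow> G x \<bullet> ?e"
      using difference_quotient_AE_subseq[OF w r] by blast
    obtain M where M: "M > 0" "\<And>x. norm (tgrad \<psi> x) \<le> M"
      using tgrad_bounded[OF \<psi>] by blast
    define W where "W x = F (u x, \<psi> x)" for x
    define g where "g n x = indicator (cball 0 r) x * \<bar>(u (x + X n *\<^sub>R ?e) - u x) / X n - G x \<bullet> ?e\<bar>" for n x
    define d where "d n x = indicator (cball 0 r) x * \<bar>(W (x + X n *\<^sub>R ?e) - W x) / X n - H x \<bullet> ?e\<bar>" for n x
    define b where "b x = indicator (cball 0 r) x * (K * \<bar>G x \<bullet> ?e\<bar> + K * M + \<bar>H x \<bullet> ?e\<bar>)" for x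
    have g_int: "integrable lebesgue (g n)" for n
      unfolding g_def by (intro locally_integrable_abs_cball locally_integrable_diff locally_integrable_difference_quotient li locally_integrable_inner)
    have d_int: "integrable lebesgue (d n)" for n
      unfolding d_def W_def
      by (intro locally_integrable_abs_cball locally_integrable_diff
          locally_integrable_difference_quotient[OF liw] locally_integrable_inner liH)
    have b_int: "integrable lebesgue b"
    proof -
      have "integrable lebesgue (\<lambda>x. K * (indicator (cball 0 r) x * \<bar>G x \<bullet> ?e\<bar>) + indicator (cball 0 r) x * (K * M)
        + indicator (cball 0 r) x * \<bar>H x \<bullet> ?e\<bar>)"
        by (intro Bochner_Integration.integrable_add integrable_mult_right integrable_mult_left integrable_indicator_cball
           locally_integrable_abs_cball locally_integrable_inner li liH)
      moreover have "(\<lambda>x. K * (indicator (cball 0 r) x * \<bar>G x \<bullet> ?e\<bar>) + indicator (cball 0 r) x * (K * M)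
        + indicator (cball 0 r) x * \<bar>H x \<bullet> ?e\<bar>) = b"
        by (simp add: fun_eq_iff b_def algebra_simps)
      ultimately show ?thesis by simp
    qed
    have d_le: "d n x \<le> K * g n x + b x" for n x
    proof (cases "norm x \<le> r")
      case True
      have "\<bar>W (x + X n *\<^sub>R ?e) - W x\<bar> \<le> K * (\<bar>u (x + X n *\<^sub>R ?e) - u x\<bar> + \<bar>\<psi> (x + X n *\<^sub>R ?e) - \<psi> x\<bar>)"
        using lip[of "(u (x + X n *\<^sub>R ?e), \<psi> (x + X n *\<^sub>R ?e))" "(u x, \<psi> x)"] by (simp add: W_def)
      also have "\<dots> \<le> K * (\<bar>u (x + X n *\<^sub>R ?e) - u x\<bar> + M * \<bar>X n\<bar>)"
        using test_lipschitz[OF \<psi> M(2), of "x + X n *\<^sub>R ?e" x] K0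
        by (intro mult_left_mono add_left_mono) (auto simp: norm_axis_1)
      finally have "\<bar>(W (x + X n *\<^sub>R ?e) - W x) / X n\<bar> \<le> K * (\<bar>(u (x + X n *\<^sub>R ?e) - u x) / X n\<bar> + M)"
        using X(2)[of n] by (simp add: field_simps)
      also have "\<dots> \<le> K * (\<bar>(u (x + X n *\<^sub>R ?e) - u x) / X n - G x \<bullet> ?e\<bar> + \<bar>G x \<bullet> ?e\<bar> + M)"
        using K0 by (intro mult_left_mono) auto
      also have "\<dots> = K * g n x + (K * \<bar>G x \<bullet> ?e\<bar> + K * M)"
        using True by (simp add: g_def distrib_left)
      finally have "\<bar>(W (x + X n *\<^sub>R ?e) - W x) / X n - H x \<bullet> ?e\<bar>
          \<le> K * g n x + (K * \<bar>G x \<bullet> ?e\<bar> + K * M) + \<bar>H x \<bullet> ?e\<bar>"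
        by linarith
      then show ?thesis using True by (simp add: d_def b_def)
    qed (simp add: d_def g_def b_def)
    have d_lim: "AE x in lebesgue. (\<lambda>n. d n x) \<longlonglongrightarrow> 0"
      using ae
    proof eventually_elim
      case (elim x)
      show ?case
      proof (cases "norm x \<le> r")
        case True
        define v where "v n = ((u (x + X n *\<^sub>R ?e) - u x) / X n, (\<psi> (x + X n *\<^sub>R ?e) - \<psi> x) / X n)" for n
        have "(\<lambda>n. (\<psi> (x + X n *\<^sub>R ?e) - \<psi> x) / X n) \<longlonglongrightarrow> tgrad \<psi> x \<bullet> ?e"
          by (rule test_directional_limit[OF \<psi> X])
        then have "v \<longlonglongrightarrow> (G x \<bullet> ?e, tgrad \<psi> x \<bullet> ?e)"
          unfolding v_def using elim True by (intro tendsto_Pair) auto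
        then have "(\<lambda>n. (F (u (x + X n *\<^sub>R ?e), \<psi> (x + X n *\<^sub>R ?e)) - F (u x, \<psi> x)) / X n)
            \<longlonglongrightarrow> A (u x, \<psi> x) * (G x \<bullet> ?e) + B (u x, \<psi> x) * (tgrad \<psi> x \<bullet> ?e)"
          by (intro difference_quotient_compose_tendsto[OF F lip X]) (auto simp: v_def X(2))
        then have "(\<lambda>n. (W (x + X n *\<^sub>R ?e) - W x) / X n) \<longlonglongrightarrow> H x \<bullet> ?e"
          by (simp add: W_def H_def inner_add_left)
        then have "(\<lambda>n. \<bar>(W (x + X n *\<^sub>R ?e) - W x) / X n - H x \<bullet> ?e\<bar>) \<longlonglongrightarrow> \<bar>H x \<bullet> ?e - H x \<bullet> ?e\<bar>"
          by (intro tendsto_intros)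
        then show ?thesis using True by (simp add: d_def)
      qed (simp add: d_def)
    qed
    \<comment> \<open>\<open>d n\<close> is dominated only up to \<open>K * g n\<close>, which tends to 0 in \<open>L\<^sup>1\<close>.\<close>
    have "(\<lambda>n. LINT x|lebesgue. max 0 (d n x - K * g n x)) \<longlonglongrightarrow> (LINT x|(lebesgue :: (real ^ 'n) measure). 0)"
    proof (rule integral_dominated_convergence[OF _ _ b_int])
      show "AE x in lebesgue. (\<lambda>n. max 0 (d n x - K * g n x)) \<longlonglongrightarrow> 0"
        using d_lim
      proof eventually_elim
        case (elim x)
        have "g n x \<ge> 0" "d n x \<ge> 0" for n by (auto simp: g_def d_def)
        then show ?case using K0
          by (intro tendsto_sandwich[OF always_eventually always_eventually tendsto_const elim]) auto
      qed
      have "b x \<ge> 0" for x using K0 M(1) by (simp add: b_def)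
      then show "AE x in lebesgue. norm (max 0 (d n x - K * g n x)) \<le> b x" for n
        using d_le[of n] by (intro AE_I2) (auto simp: algebra_simps)
    qed (use d_int g_int in auto)
    then have lim_sum: "(\<lambda>n. (LINT x|lebesgue. max 0 (d n x - K * g n x)) + K * (LINT x|lebesgue. g n x)) \<longlonglongrightarrow> 0 + K * 0"
      using lim by (intro tendsto_intros) (auto simp: g_def)
    have le_sum: "(LINT x|lebesgue. d n x) \<le> (LINT x|lebesgue. max 0 (d n x - K * g n x)) + K * (LINT x|lebesgue. g n x)" for n
    proof -
      have i: "integrable lebesgue (\<lambda>x. max 0 (d n x - K * g n x))" "integrable lebesgue (\<lambda>x. K * g n x)"
        using d_int g_int by auto
      have "(LINT x|lebesgue. d n x) \<le> (LINT x|lebesgue. max 0 (d n x - K * g n x) + K * g n x)"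
        using d_int i by (intro integral_mono) auto
      also have "\<dots> = (LINT x|lebesgue. max 0 (d n x - K * g n x)) + K * (LINT x|lebesgue. g n x)"
        using Bochner_Integration.integral_add[OF i] by simp
      finally show ?thesis .
    qed
    have "(LINT x|lebesgue. d n x) \<ge> 0" for n
      by (intro integral_nonneg_AE) (auto simp: d_def)
    then have "(\<lambda>n. LINT x|lebesgue. d n x) \<longlonglongrightarrow> 0"
      using le_sum by (intro Lim_null_comparison[OF always_eventually lim_sum[simplified]]) auto
    then show "\<exists>X. X \<longlonglongrightarrow> 0 \<and> (\<forall>n. X n \<noteq> 0) \<and>
      (\<lambda>n. LINT x|lebesgue. indicator (cball 0 r) x * \<bar>(F (u (x + X n *\<^sub>R ?e), \<psi> (x + X n *\<^sub>R ?e)) - F (u x, \<psi> x)) / X n - H x \<bullet> ?e\<bar>) \<longlonglongrightarrow> 0"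
      using X by (intro exI[of _ X]) (simp add: d_def W_def)
  qed
  then show ?thesis unfolding H_def[abs_def] .
qed

text \<open>The mean value identity makes \<open>u\<close> invariant under every translation up to
  null sets. Then \<bar>\<open>u\<close>\<bar>^q has the same integral over all balls of one radius,
  and as it is integrable, that integral must be 0.\<close>

lemma zero_gradient_imp_zero:
  fixes u :: "real ^ 'n::finite \<Rightarrow> real"
  assumes w: "has_weak_gradient u G" and G: "AE x in lebesgue. G x = 0"
    and int: "integrable lebesgue (\<lambda>x. \<bar>u x\<bar> powr q)"
  shows "AE x in lebesgue. u x = 0"
proof -
  note li = has_weak_gradient_locally_integrable[OF w]
  have inv: "AE x in lebesgue. u (x + h) = u x" for h
  proof (rule AE_zero_by_duality[where f = "\<lambda>x. u (x + h) - u x", THEN AE_mp, OF _ _ AE_I2])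
    show "locally_integrable (\<lambda>x. u (x + h) - u x)"
      by (intro locally_integrable_diff locally_integrable_shift li)
    fix \<phi> :: "real ^ 'n \<Rightarrow> real" assume \<phi>: "test_function \<phi>"
    obtain s where s: "(LINT x|lebesgue. (u (x + h) - u x) * \<phi> x) = (LINT x|lebesgue. (G (x + s *\<^sub>R h) \<bullet> h) * \<phi> x)"
      using weak_mean_value[OF w \<phi>] by blast
    have "AE x in lebesgue. (G (x + s *\<^sub>R h) \<bullet> h) * \<phi> x = 0"
      using AE_lebesgue_translation[OF G, of "s *\<^sub>R h"] by auto
    then show "(LINT x|lebesgue. (u (x + h) - u x) * \<phi> x) = 0"
      unfolding s by (rule integral_eq_zero_AE)
  qed auto
  define f where "f x = \<bar>u x\<bar> powr q" for x
  have f: "integrable lebesgue f" using int by (simp add: f_def[abs_def])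
  have fm: "f \<in> borel_measurable lebesgue" using f by auto
  have inv_f: "AE x in lebesgue. f (x + h) = f x" for h
    using inv[of h] by (auto simp: f_def)
  obtain e :: "real ^ 'n" where e: "norm e = 1"
    using vector_choose_size[of 1] by auto
  have zero: "AE x in lebesgue. indicator (cball 0 r) x * f x = 0" for r
  proof -
    have i: "integrable lebesgue (\<lambda>x. indicator (cball 0 r) (x - a) * f x)" for a
    proof (rule Bochner_Integration.integrable_bound[OF f])
      have "(\<lambda>x. indicator (cball 0 r) (x - a) :: real) = indicator (cball a r)"
        by (auto simp: indicator_def dist_norm norm_minus_commute)
      then show "(\<lambda>x. indicator (cball 0 r) (x - a) * f x) \<in> borel_measurable lebesgue"
        using fm by (auto intro!: borel_measurable_times borel_measurable_indicator)
    qed (auto simp: indicator_def)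
    have eq: "(LINT x|lebesgue. indicator (cball 0 r) x * f x) = (LINT x|lebesgue. indicator (cball 0 r) (x - a) * f x)" for a
    proof -
      have "(LINT x|lebesgue. indicator (cball 0 r) (x - a) * f x) = (LINT x|lebesgue. indicator (cball 0 r) x * f (x + a))"
        using integral_lebesgue_translation[OF borel_measurable_integrable[OF i[of a]], of a] by simp
      also have "\<dots> = (LINT x|lebesgue. indicator (cball 0 r) x * f x)"
      proof (rule integral_cong_AE)
        show "AE x in lebesgue. indicator (cball 0 r) x * f (x + a) = indicator (cball 0 r) x * f x"
          using inv_f[of a] by auto
      qed (use fm borel_measurable_lebesgue_translation[OF fm, of a] in
          \<open>auto intro!: borel_measurable_times borel_measurable_indicator\<close>)
      finally show ?thesis by simp
    qed
    \<comment> \<open>The balls centred at \<open>real n *\<^sub>R e\<close> eventually leave every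
      point, so these integrals tend to 0, although by \<open>eq\<close> they do not depend on
      \<open>n\<close>.\<close>
    have "(\<lambda>n. LINT x|lebesgue. indicator (cball 0 r) (x - real n *\<^sub>R e) * f x) \<longlonglongrightarrow> (LINT x|(lebesgue :: (real ^ 'n) measure). 0)"
    proof (rule integral_dominated_convergence[OF _ _ f])
      show "AE x in lebesgue. (\<lambda>n. indicator (cball 0 r) (x - real n *\<^sub>R e) * f x) \<longlonglongrightarrow> 0"
      proof (intro AE_I2 tendsto_eventually)
        fix x
        show "\<forall>\<^sub>F n in sequentially. indicator (cball 0 r) (x - real n *\<^sub>R e) * f x = 0"
          using eventually_le_real[of "r + norm x + 1"]
        proof eventually_elim
          case (elim n)
          have "norm (real n *\<^sub>R e) - norm x \<le> norm (x - real n *\<^sub>R e)"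
            by (metis norm_minus_commute norm_triangle_ineq2)
          then show ?case using elim e by simp
        qed
      qed
      show "AE x in lebesgue. norm (indicator (cball 0 r) (x - real n *\<^sub>R e) * f x) \<le> f x" for n
        by (auto simp: indicator_def f_def)
    qed (use i in auto)
    then have "(LINT x|lebesgue. indicator (cball 0 r) x * f x) = 0"
      unfolding eq[symmetric] by (simp add: LIMSEQ_const_iff)
    then show ?thesis
      using i[of 0] by (subst (asm) integral_nonneg_eq_0_iff_AE) (auto simp: f_def)
  qed
  have "AE x in lebesgue. \<forall>n. indicator (cball 0 (real n)) x * f x = 0"
    using zero by (simp only: AE_all_countable) blast
  then show ?thesis
  proof eventually_elim
    case (elim x)
    obtain n where "norm x \<le> real n" using real_arch_simple by blast
    with elim[rule_format, of n] show ?case by (simp add: f_def)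
  qed
qed

section \<open>Regularised \<open>p\<close>-norms\<close>

lemma abs_powr_has_derivative:
  assumes p: "p > 1"
  shows "((\<lambda>a::real. \<bar>a\<bar> powr p) has_real_derivative p * (sgn a * \<bar>a\<bar> powr (p - 1))) (at a)"
proof (cases "a = 0")
  case True
  have "((\<lambda>h::real. \<bar>h\<bar> powr p / h) \<longlongrightarrow> 0) (at 0)"
  proof (rule Lim_null_comparison)
    show "\<forall>\<^sub>F h in at 0. norm (\<bar>h\<bar> powr p / h) \<le> \<bar>h\<bar> powr (p - 1)"
      by (intro always_eventually allI) (auto simp: powr_diff)
    have "((\<lambda>h::real. \<bar>h\<bar> powr (p - 1)) \<longlongrightarrow> \<bar>0\<bar> powr (p - 1)) (at 0)"
      using p by (intro tendsto_powr' tendsto_intros) auto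
    then show "((\<lambda>h::real. \<bar>h\<bar> powr (p - 1)) \<longlongrightarrow> 0) (at 0)" by simp
  qed
  then show ?thesis using True by (simp add: DERIV_def)
next
  case False
  define e where "e = sgn a"
  have e: "e * a = \<bar>a\<bar>" by (simp add: e_def abs_sgn mult.commute)
  have "((\<lambda>x. (e * x) powr p) has_real_derivative p * (e * \<bar>a\<bar> powr (p - 1))) (at a)"
    using False e by (auto intro!: derivative_eq_intros)
  moreover have "\<forall>\<^sub>F x in nhds a. (e * x) powr p = \<bar>x\<bar> powr p"
  proof (cases "a > 0")
    case True
    then show ?thesis using eventually_nhds_in_open[of "{0<..}" a]
      by (auto simp: e_def elim: eventually_mono)
  next
    case F: False
    then show ?thesis using eventually_nhds_in_open[of "{..<0}" a] False
      by (auto simp: e_def elim: eventually_mono)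
  qed
  ultimately show ?thesis
    unfolding e_def by (subst (asm) DERIV_cong_ev[OF refl _ refl])
qed

lemma signed_powr_continuous:
  assumes "r > 0" shows "continuous_on UNIV (\<lambda>a::real. sgn a * \<bar>a\<bar> powr r)"
proof -
  have "isCont (\<lambda>a::real. sgn a * \<bar>a\<bar> powr r) a" for a
  proof (cases "a = 0")
    case True
    have "((\<lambda>a::real. sgn a * \<bar>a\<bar> powr r) \<longlongrightarrow> 0) (at 0)"
    proof (rule Lim_null_comparison)
      show "\<forall>\<^sub>F a in at 0. norm (sgn a * \<bar>a\<bar> powr r) \<le> \<bar>a\<bar> powr r"
        by (intro always_eventually allI) (auto simp: abs_mult sgn_if)
      have "((\<lambda>h::real. \<bar>h\<bar> powr r) \<longlongrightarrow> \<bar>0\<bar> powr r) (at 0)"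
        using assms by (intro tendsto_powr' tendsto_intros) auto
      then show "((\<lambda>h::real. \<bar>h\<bar> powr r) \<longlongrightarrow> 0) (at 0)" by simp
    qed
    then show ?thesis using True by (simp add: isCont_def)
  next
    case False
    then show ?thesis
      by (intro continuous_intros) auto
  qed
  then show ?thesis by (simp add: continuous_at_imp_continuous_on)
qed

text \<open>Hoelder's inequality for two terms, with weights of total at most 1. After division by
  the \<open>p\<close>-norm \<open>Z\<close> of (X, Y), Young's inequality bounds the sum by (1 -
  1/p) (l + m) + 1/p, which is at most 1.\<close>

lemma two_term_holder:
  fixes X Y l m p :: real
  assumes p: "p > 1" and l: "l \<ge> 0" "m \<ge> 0" "l + m \<le> 1" and X: "X \<ge> 0" "Y \<ge> 0"
  shows "(l powr (1 - 1 / p) * X + m powr (1 - 1 / p) * Y) powr p \<le> X powr p + Y powr p"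
proof (cases "X = 0 \<and> Y = 0")
  case True
  then show ?thesis by simp
next
  case False
  define Z where "Z = (X powr p + Y powr p) powr (1 / p)"
  have pos: "X powr p + Y powr p > 0"
    using False X by (auto intro: add_pos_nonneg add_nonneg_pos)
  then have Z: "Z > 0" by (simp add: Z_def)
  have Zp: "Z powr p = X powr p + Y powr p"
    using p pos by (simp add: Z_def powr_powr)
  have young: "t powr (1 - 1 / p) * (W / Z) \<le> (1 - 1 / p) * t + (W powr p / Z powr p) / p"
    if "t \<ge> 0" "W \<ge> 0" for t W
  proof -
    have "t powr (1 - 1 / p) * (W / Z) \<le> (t powr (1 - 1 / p)) powr (p / (p - 1)) / (p / (p - 1)) + (W / Z) powr p / p"
      using p that Z by (intro Youngs_inequality) (auto simp: field_simps)
    also have "(t powr (1 - 1 / p)) powr (p / (p - 1)) = t"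
    proof -
      have e: "(1 - 1 / p) * (p / (p - 1)) = 1" using p by (simp add: field_simps)
      show ?thesis unfolding powr_powr e by (simp only: powr_one that)
    qed
    also have "t / (p / (p - 1)) = (1 - 1 / p) * t" using p by (simp add: field_simps)
    also have "(W / Z) powr p = W powr p / Z powr p" using that Z by (simp add: powr_divide)
    finally show ?thesis .
  qed
  have "(l powr (1 - 1 / p) * X + m powr (1 - 1 / p) * Y) / Z
      = l powr (1 - 1 / p) * (X / Z) + m powr (1 - 1 / p) * (Y / Z)"
    by (simp add: add_divide_distrib)
  also have "\<dots> \<le> ((1 - 1 / p) * l + (X powr p / Z powr p) / p) + ((1 - 1 / p) * m + (Y powr p / Z powr p) / p)"
    by (intro add_mono young l X)
  also have "\<dots> = (1 - 1 / p) * (l + m) + ((X powr p + Y powr p) / Z powr p) / p"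
    by (simp add: algebra_simps add_divide_distrib)
  also have "\<dots> = (1 - 1 / p) * (l + m) + 1 / p"
    using pos by (simp add: Zp)
  also have "\<dots> \<le> (1 - 1 / p) * 1 + 1 / p"
    using p l by (intro add_right_mono mult_left_mono) auto
  finally have "l powr (1 - 1 / p) * X + m powr (1 - 1 / p) * Y \<le> Z"
    using Z by (simp add: field_simps)
  then have "(l powr (1 - 1 / p) * X + m powr (1 - 1 / p) * Y) powr p \<le> Z powr p"
    using p l X by (intro powr_mono2) auto
  then show ?thesis by (simp add: Zp)
qed

text \<open>For r \<ge> 1 the power only decreases the base; for r < 1 this is the tangent bound of
  a concave power, taken from Young's inequality. With r = p - 1 it is the source of the constant
  \<open>min 1 (p - 1)\<close>.\<close>

lemma one_minus_powr_le:
  fixes s r :: real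
  assumes "0 \<le> s" "s \<le> 1" "r > 0"
  shows "(1 - s) powr r \<le> 1 - min 1 r * s"
proof (cases "s = 1")
  case True
  then show ?thesis by simp
next
  case False
  show ?thesis
  proof (cases "r \<ge> 1")
    case True
    have "(1 - s) powr r \<le> (1 - s) powr 1"
      using assms True False by (intro powr_mono') auto
    then show ?thesis using assms True by simp
  next
    case r: False
    have "(1 - s) powr r * 1 powr (1 - r) \<le> r * (1 - s) + (1 - r) * 1"
      using assms r False by (intro Youngs_inequality_0) auto
    then show ?thesis using r by (simp add: algebra_simps)
  qed
qed

text \<open>The sum is at most twice the maximum, which works for every positive exponent, whether
  or not the power is convex.\<close>

lemma powr_add_le:
  fixes x y q :: real
  assumes "x \<ge> 0" "y \<ge> 0" "q > 0"
  shows "(x + y) powr q \<le> 2 powr q * (x powr q + y powr q)"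
proof -
  have "(x + y) powr q \<le> (2 * max x y) powr q"
    using assms by (intro powr_mono2) auto
  also have "\<dots> = 2 powr q * (max x y) powr q"
    using assms by (simp add: powr_mult)
  also have "\<dots> \<le> 2 powr q * (x powr q + y powr q)"
    by (intro mult_left_mono) (auto simp: max_def)
  finally show ?thesis .
qed

text \<open>The \<open>p\<close>-norm of a pair is not differentiable at the origin, so a third entry \<open>d\<close> is added; its
  subtraction keeps the value 0 at the origin.\<close>

definition smooth_pnorm :: "real \<Rightarrow> real \<Rightarrow> real \<times> real \<Rightarrow> real" where
  "smooth_pnorm p d z = (\<bar>fst z\<bar> powr p + \<bar>snd z\<bar> powr p + d powr p) powr (1 / p) - d"

context
  fixes p d :: real
  assumes p: "p > 1" and d: "d > 0"
begin

lemma pnorm_pos: "\<bar>a\<bar> powr p + \<bar>b\<bar> powr p + d powr p > 0"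
  using d by (intro add_nonneg_pos) auto

lemma powr_inverse_ge:
  assumes "x \<ge> 0" "x powr p \<le> T" shows "x \<le> T powr (1 / p)"
proof -
  have "(x powr p) powr (1 / p) \<le> T powr (1 / p)"
    using assms p by (intro powr_mono2) auto
  then show ?thesis using assms p by (simp add: powr_powr)
qed

lemma smooth_pnorm_ge: "smooth_pnorm p d z \<ge> 0" "smooth_pnorm p d z \<ge> \<bar>fst z\<bar> - d"
proof -
  have "d \<le> (\<bar>fst z\<bar> powr p + \<bar>snd z\<bar> powr p + d powr p) powr (1 / p)"
    using d by (intro powr_inverse_ge) auto
  moreover have "\<bar>fst z\<bar> \<le> (\<bar>fst z\<bar> powr p + \<bar>snd z\<bar> powr p + d powr p) powr (1 / p)"
    by (intro powr_inverse_ge) auto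
  ultimately show "smooth_pnorm p d z \<ge> 0" "smooth_pnorm p d z \<ge> \<bar>fst z\<bar> - d"
    by (auto simp: smooth_pnorm_def)
qed

text \<open>The \<open>p\<close>-norm of the three entries is at most their sum, and the summand
  \<open>d\<close> cancels.\<close>

lemma smooth_pnorm_le: "smooth_pnorm p d z \<le> \<bar>fst z\<bar> + \<bar>snd z\<bar>"
proof -
  define s where "s = \<bar>fst z\<bar> + \<bar>snd z\<bar> + d"
  have s: "s > 0" using d by (simp add: s_def add_nonneg_pos)
  have le: "x powr p \<le> x * s powr (p - 1)" if "0 \<le> x" "x \<le> s" for x
  proof -
    have "x powr p = x * x powr (p - 1)" using that by (simp add: powr_mult_base)
    also have "\<dots> \<le> x * s powr (p - 1)" using that p by (intro mult_left_mono powr_mono2) auto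
    finally show ?thesis .
  qed
  have "\<bar>fst z\<bar> powr p + \<bar>snd z\<bar> powr p + d powr p
      \<le> \<bar>fst z\<bar> * s powr (p - 1) + \<bar>snd z\<bar> * s powr (p - 1) + d * s powr (p - 1)"
    using d by (intro add_mono le) (auto simp: s_def)
  also have "\<dots> = s * s powr (p - 1)" by (simp add: s_def algebra_simps)
  also have "\<dots> = s powr p" using s by (simp add: powr_mult_base)
  finally have "(\<bar>fst z\<bar> powr p + \<bar>snd z\<bar> powr p + d powr p) powr (1 / p) \<le> (s powr p) powr (1 / p)"
    using p by (intro powr_mono2) auto
  also have "\<dots> = s" using s p by (simp add: powr_powr)
  finally show ?thesis by (simp add: smooth_pnorm_def s_def)
qed

text \<open>The partial derivative of \<open>smooth_pnorm\<close> in the coordinate whose value is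
  \<open>a\<close>; by symmetry one formula serves both coordinates.\<close>

definition pnorm_coeff :: "real \<Rightarrow> real \<times> real \<Rightarrow> real" where
  "pnorm_coeff a z = sgn a * \<bar>a\<bar> powr (p - 1) * (\<bar>fst z\<bar> powr p + \<bar>snd z\<bar> powr p + d powr p) powr (1 / p - 1)"

lemma smooth_pnorm_has_derivative:
  "(smooth_pnorm p d has_derivative (\<lambda>(s, t). pnorm_coeff (fst z) z * s + pnorm_coeff (snd z) z * t)) (at z)"
proof -
  define \<sigma> where "\<sigma> a = sgn a * \<bar>a\<bar> powr (p - 1)" for a :: real
  define T where "T z = \<bar>fst z\<bar> powr p + \<bar>snd z\<bar> powr p + d powr p" for z :: "real \<times> real"
  have T0: "T z > 0" by (simp add: T_def pnorm_pos)
  have abs: "((\<lambda>a::real. \<bar>a\<bar> powr p) has_derivative (*) (p * \<sigma> a)) (at a)" for a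
    using abs_powr_has_derivative[OF p, of a] by (simp add: has_field_derivative_def \<sigma>_def)
  have "((\<lambda>z. \<bar>fst z\<bar> powr p) has_derivative (\<lambda>h. p * \<sigma> (fst z) * fst h)) (at z)"
    using has_derivative_compose[OF has_derivative_fst[OF has_derivative_ident] abs, of z UNIV] by simp
  moreover have "((\<lambda>z. \<bar>snd z\<bar> powr p) has_derivative (\<lambda>h. p * \<sigma> (snd z) * snd h)) (at z)"
    using has_derivative_compose[OF has_derivative_snd[OF has_derivative_ident] abs, of z UNIV] by simp
  ultimately have "(T has_derivative (\<lambda>h. p * \<sigma> (fst z) * fst h + p * \<sigma> (snd z) * snd h + 0)) (at z)"
    unfolding T_def[abs_def] by (intro has_derivative_add has_derivative_const)
  moreover have "((\<lambda>t. t powr (1 / p)) has_derivative (*) (1 / p * T z powr (1 / p - 1))) (at (T z))"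
    using has_real_derivative_powr[OF T0, of "1 / p"] by (simp add: has_field_derivative_def)
  ultimately have "((\<lambda>z. T z powr (1 / p)) has_derivative
     (\<lambda>h. 1 / p * T z powr (1 / p - 1) * (p * \<sigma> (fst z) * fst h + p * \<sigma> (snd z) * snd h + 0))) (at z)"
    by (rule has_derivative_compose)
  then have "((\<lambda>z. T z powr (1 / p) - d) has_derivative
     (\<lambda>h. 1 / p * T z powr (1 / p - 1) * (p * \<sigma> (fst z) * fst h + p * \<sigma> (snd z) * snd h + 0) - 0)) (at z)"
    by (intro has_derivative_diff has_derivative_const)
  moreover have "(\<lambda>h. 1 / p * T z powr (1 / p - 1) * (p * \<sigma> (fst z) * fst h + p * \<sigma> (snd z) * snd h + 0) - 0)
     = (\<lambda>(s, t). pnorm_coeff (fst z) z * s + pnorm_coeff (snd z) z * t)"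
    using p by (simp add: fun_eq_iff pnorm_coeff_def \<sigma>_def T_def field_simps)
  moreover have "(\<lambda>z. T z powr (1 / p) - d) = smooth_pnorm p d"
    by (simp add: fun_eq_iff T_def smooth_pnorm_def)
  ultimately show ?thesis by simp
qed

lemma pnorm_coeff_continuous:
  "continuous_on UNIV (\<lambda>z. pnorm_coeff (fst z) z)" "continuous_on UNIV (\<lambda>z. pnorm_coeff (snd z) z)"
proof -
  have s: "continuous_on UNIV (\<lambda>z::real \<times> real. sgn (f z) * \<bar>f z\<bar> powr (p - 1))" if "continuous_on UNIV f" for f
    using continuous_on_compose2[OF signed_powr_continuous[of "p - 1"] that] p by simp
  have ne: "\<bar>a\<bar> powr p + \<bar>b\<bar> powr p + d powr p \<noteq> 0" for a b
    using pnorm_pos[of a b] by simp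
  have T: "continuous_on UNIV (\<lambda>z::real \<times> real. \<bar>fst z\<bar> powr p + \<bar>snd z\<bar> powr p + d powr p)"
    using p by (intro continuous_intros continuous_on_powr') auto
  show "continuous_on UNIV (\<lambda>z. pnorm_coeff (fst z) z)" "continuous_on UNIV (\<lambda>z. pnorm_coeff (snd z) z)"
    unfolding pnorm_coeff_def
    by (intro continuous_on_mult[OF s] continuous_on_powr[OF T continuous_on_const] continuous_intros ballI ne)+
qed

text \<open>In this form the coefficient is a Hoelder weight: the base is the share of one entry in
  the total of \<open>p\<close>-th powers, and the shares of both coordinates sum to less than
  1.\<close>

lemma abs_pnorm_coeff:
  "\<bar>pnorm_coeff a z\<bar> = (\<bar>a\<bar> powr p / (\<bar>fst z\<bar> powr p + \<bar>snd z\<bar> powr p + d powr p)) powr (1 - 1 / p)"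
proof -
  define T where "T = \<bar>fst z\<bar> powr p + \<bar>snd z\<bar> powr p + d powr p"
  have T: "T > 0" by (simp add: T_def pnorm_pos)
  have "\<bar>pnorm_coeff a z\<bar> = \<bar>a\<bar> powr (p - 1) * T powr (1 / p - 1)"
    by (auto simp: pnorm_coeff_def T_def abs_mult sgn_if)
  also have "\<bar>a\<bar> powr (p - 1) = (\<bar>a\<bar> powr p) powr (1 - 1 / p)"
    using p by (simp add: powr_powr right_diff_distrib)
  also have "T powr (1 / p - 1) = 1 / T powr (1 - 1 / p)"
    using T powr_minus_divide[of T "1 - 1 / p"] by simp
  finally show ?thesis using T by (simp add: powr_divide T_def)
qed

lemma pnorm_coeff_le_1:
  "\<bar>pnorm_coeff (fst z) z\<bar> \<le> 1" "\<bar>pnorm_coeff (snd z) z\<bar> \<le> 1"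
  unfolding abs_pnorm_coeff using p pnorm_pos[of "fst z" "snd z"]
  by (auto intro!: powr_le1 simp: divide_le_eq)

end

lemma integrable_compact_support_powr:
  fixes f :: "real ^ 'n::finite \<Rightarrow> 'b::real_normed_vector"
  assumes "continuous_on UNIV f" "\<And>x. norm (f x) \<le> L" "\<And>x. norm x > r \<Longrightarrow> f x = 0" "q > 0"
  shows "integrable lebesgue (\<lambda>x. norm (f x) powr q)"
proof -
  have "(\<lambda>x. norm (f x)) \<in> borel_measurable lebesgue"
    using assms(1) by (intro borel_measurable_lebesgue_continuous continuous_intros)
  then have "(\<lambda>x. norm (f x) powr q) \<in> borel_measurable lebesgue"
    by (intro powr_real_measurable) auto
  moreover have "\<bar>norm (f x) powr q\<bar> \<le> L powr q" for x
    using assms(2)[of x] assms(4) by (auto intro!: powr_mono2)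
  ultimately have "integrable lebesgue (\<lambda>x. norm (f x) powr q *\<^sub>R (1 :: real))"
    using assms(3) by (intro integrable_mult_bounded_support[OF locally_integrable_const]) auto
  then show ?thesis by simp
qed

lemma test_powr_integrable:
  assumes \<phi>: "test_function \<phi>" and q: "q > 0"
  shows "integrable lebesgue (\<lambda>x. \<bar>\<phi> x\<bar> powr q)" "integrable lebesgue (\<lambda>x. norm (tgrad \<phi> x) powr q)"
proof -
  obtain r where r: "r > 0" "\<And>x. norm x \<ge> r \<Longrightarrow> \<phi> x = 0"
    using test_function_support[OF \<phi>] by blast
  obtain L where "\<And>x. \<bar>\<phi> x\<bar> \<le> L" using test_bounded[OF \<phi>] by blast
  then show "integrable lebesgue (\<lambda>x. \<bar>\<phi> x\<bar> powr q)"
    using integrable_compact_support_powr[OF test_continuous[OF \<phi>], of L r q] r q by simp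
  obtain L where "\<And>x. norm (tgrad \<phi> x) \<le> L" using tgrad_bounded[OF \<phi>] by blast
  then show "integrable lebesgue (\<lambda>x. norm (tgrad \<phi> x) powr q)"
    using integrable_compact_support_powr[OF tgrad_continuous[OF \<phi>] _ tgrad_support[OF \<phi> r(2)] q, of L] by simp
qed

text \<open>If every translate of \<open>u\<close> vanished a.e. on the zero set of
  \<open>u\<close>, Fubini would give, for almost every zero \<open>x\<close>, that u (x + h) = 0
  for almost all \<open>h\<close>. As the zero set is not null there is such an \<open>x\<close>,
  and then \<open>u\<close> vanishes a.e.\<close>

lemma exists_nonzero_translate:
  fixes u :: "real ^ 'n::finite \<Rightarrow> real"
  assumes u: "u \<in> borel_measurable lebesgue"
    and Z: "\<not> (AE x in lebesgue. u x \<noteq> 0)" and P: "\<not> (AE x in lebesgue. u x = 0)"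
  shows "\<exists>h. \<not> (AE x in lebesgue. u x \<noteq> 0 \<or> u (x + h) = 0)"
proof (rule ccontr)
  assume "\<not> ?thesis"
  then have all: "AE x in lebesgue. u x \<noteq> 0 \<or> u (x + h) = 0" for h by blast
  \<comment> \<open>A Borel representative makes the condition measurable jointly in (x, h), so that
    the two quantifiers can be exchanged on the product of Borel measures.\<close>
  obtain v where v[measurable]: "v \<in> borel_measurable lborel" and "AE x in lborel. u x = v x"
    using completion_ex_borel_measurable_real[OF u] by blast
  then have uv: "AE x in lebesgue. u x = v x" by (simp add: AE_completion)
  have v_borel[measurable]: "v \<in> borel_measurable borel" using v by simp
  have "AE x in lborel. v x \<noteq> 0 \<or> v (x + h) = 0" for h
  proof -
    have "AE x in lebesgue. v x \<noteq> 0 \<or> v (x + h) = 0"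
      using all[of h] uv AE_lebesgue_translation[OF uv, of h] by eventually_elim auto
    then show ?thesis by (simp add: AE_completion_iff)
  qed
  then have "AE h in lborel. AE x in lborel. v x \<noteq> 0 \<or> v (x + h) = 0" by simp
  also have "(AE h in lborel. AE x in lborel. v x \<noteq> 0 \<or> v (x + h) = 0)
     \<longleftrightarrow> (AE x in lborel. AE h in lborel. v x \<noteq> 0 \<or> v (x + h) = 0)"
    by (rule lborel_pair.AE_commute) measurable
  finally have ae: "AE x in lborel. AE h in lborel. v x \<noteq> 0 \<or> v (x + h) = 0" .
  have "\<not> (AE x in lborel. v x \<noteq> 0)"
  proof
    assume "AE x in lborel. v x \<noteq> 0"
    then have "AE x in lebesgue. v x \<noteq> 0" by (rule AE_completion)
    with uv have "AE x in lebesgue. u x \<noteq> 0" by eventually_elim auto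
    with Z show False by blast
  qed
  moreover have "AE x in lborel. v x \<noteq> 0" if "\<And>x. v x \<noteq> 0 \<or> \<not> (AE h in lborel. v x \<noteq> 0 \<or> v (x + h) = 0)"
    using ae by eventually_elim (use that in blast)
  ultimately obtain x where x: "v x = 0" "AE h in lborel. v x \<noteq> 0 \<or> v (x + h) = 0"
    by blast
  then have "AE h in lebesgue. v (h + x) = 0"
    by (intro AE_completion) (auto simp: add.commute)
  from AE_lebesgue_translation[OF this, of "- x"] have "AE h in lebesgue. v h = 0" by simp
  with uv have "AE h in lebesgue. u h = 0" by eventually_elim auto
  with P show False by blast
qed

section \<open>Extremals of the Sobolev inequality do not vanish\<close>

lemma integrable_nonneg_bound:
  fixes f :: "'a \<Rightarrow> real"
  assumes "integrable M g" "f \<in> borel_measurable M" "\<And>x. 0 \<le> f x" "\<And>x. f x \<le> g x"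
  shows "integrable M f"
proof (rule Bochner_Integration.integrable_bound[OF assms(1,2)])
  have "norm (f x) \<le> norm (g x)" for x
    using assms(3)[of x] assms(4)[of x] by simp
  then show "AE x in M. norm (f x) \<le> norm (g x)" by simp
qed

context
  fixes u :: "real ^ 'n::finite \<Rightarrow> real" and G :: "real ^ 'n \<Rightarrow> real ^ 'n" and p q \<theta> S :: real
  assumes p: "p > 1" and q: "q > 0" and \<theta>: "\<theta> > 0" and S: "S \<ge> 0"
    and w: "has_weak_gradient u G"
    and G_int: "integrable lebesgue (\<lambda>x. norm (G x) powr p)"
    and u_int: "integrable lebesgue (\<lambda>x. \<bar>u x\<bar> powr q)"
    and extremal: "(LINT x|lebesgue. norm (G x) powr p) = S * (LINT x|lebesgue. \<bar>u x\<bar> powr q) powr \<theta>"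
    and sobolev: "\<And>(w :: real ^ 'n \<Rightarrow> real) H. has_weak_gradient w H \<Longrightarrow> integrable lebesgue (\<lambda>x. norm (H x) powr p) \<Longrightarrow>
      integrable lebesgue (\<lambda>x. \<bar>w x\<bar> powr q) \<Longrightarrow>
      S * (LINT x|lebesgue. \<bar>w x\<bar> powr q) powr \<theta> \<le> (LINT x|lebesgue. norm (H x) powr p)"
begin

lemma meas_u: "u \<in> borel_measurable lebesgue" and meas_G: "G \<in> borel_measurable lebesgue"
  using has_weak_gradient_locally_integrable[OF w] locally_integrable_measurable by auto

text \<open>The regularised \<open>p\<close>-norm stays above \<bar>\<open>u\<close>\<bar> only up
  to \<open>d\<close>. The mass of the truncation bounds that of the competitor from below, and the
  loss disappears as \<open>d\<close> tends to 0.\<close>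

lemma truncated_mass_tendsto:
  "(\<lambda>n. LINT x|lebesgue. (max 0 (\<bar>u x\<bar> - 1 / real (Suc n))) powr q)
    \<longlonglongrightarrow> (LINT x|lebesgue. \<bar>u x\<bar> powr q)"
proof (rule integral_dominated_convergence[OF _ _ u_int])
  show "(\<lambda>x. \<bar>u x\<bar> powr q) \<in> borel_measurable lebesgue" using u_int by auto
  show "(\<lambda>x. (max 0 (\<bar>u x\<bar> - 1 / real (Suc n))) powr q) \<in> borel_measurable lebesgue" for n
    using meas_u by (intro powr_real_measurable) auto
  show "AE x in lebesgue. (\<lambda>n. (max 0 (\<bar>u x\<bar> - 1 / real (Suc n))) powr q) \<longlonglongrightarrow> \<bar>u x\<bar> powr q"
  proof (rule AE_I2)
    fix x
    have "(\<lambda>n. 1 / real (Suc n)) \<longlonglongrightarrow> 0"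
      using LIMSEQ_inverse_real_of_nat by (simp add: inverse_eq_divide)
    then have "(\<lambda>n. max 0 (\<bar>u x\<bar> - 1 / real (Suc n))) \<longlonglongrightarrow> max 0 (\<bar>u x\<bar> - 0)"
      by (intro tendsto_intros)
    then have "(\<lambda>n. max 0 (\<bar>u x\<bar> - 1 / real (Suc n))) \<longlonglongrightarrow> \<bar>u x\<bar>" by simp
    then show "(\<lambda>n. (max 0 (\<bar>u x\<bar> - 1 / real (Suc n))) powr q) \<longlonglongrightarrow> \<bar>u x\<bar> powr q"
      using q by (intro tendsto_powr' tendsto_const) auto
  qed
  have "norm ((max 0 (\<bar>u x\<bar> - 1 / real (Suc n))) powr q) \<le> \<bar>u x\<bar> powr q" for x n
    using q by (auto intro!: powr_mono2)
  then show "AE x in lebesgue. norm ((max 0 (\<bar>u x\<bar> - 1 / real (Suc n))) powr q) \<le> \<bar>u x\<bar> powr q" for n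
    by simp
qed

text \<open>Extremality forces the Dirichlet integral of the competitor up to that of
  \<open>u\<close>, because its mass is no smaller in the limit d \<rightarrow> 0. The saving on the
  ball is therefore at most the cost of the cutoff; both carry \<open>e powr p\<close>, which
  cancels.\<close>

lemma competitor_estimate:
  assumes R: "R > 0" and e: "e > 0"
  shows "min 1 (p - 1) * (LINT x|lebesgue. indicator (cball 0 R) x * (norm (G x) powr p / (\<bar>u x\<bar> powr p + e powr p)))
    \<le> (LINT x|lebesgue. norm (tgrad (cutoff (R + 1) :: real ^ 'n \<Rightarrow> real) x) powr p)" (is "?c * ?I \<le> ?M")
proof -
  \<comment> \<open>The plateau must contain the closed ball of radius \<open>R\<close> in its
    interior, so that the cutoff has gradient 0 on all of it.\<close>
  let ?\<phi> = "cutoff (R + 1) :: real ^ 'n \<Rightarrow> real"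
  have \<phi>: "test_function ?\<phi>" using R by (intro test_cutoff) auto
  define \<psi> where "\<psi> x = e * ?\<phi> x" for x
  have \<psi>: "test_function \<psi>" unfolding \<psi>_def by (rule test_cmult[OF \<phi>])
  have tg\<psi>: "tgrad \<psi> x = e *\<^sub>R tgrad ?\<phi> x" for x
    unfolding \<psi>_def by (rule tgrad_cmult[OF \<phi>])
  have tg0: "tgrad ?\<phi> x = 0" if "norm x \<le> R" for x
    using R that by (intro tgrad_cutoff_plateau) auto
  \<comment> \<open>On the ball, where \<psi> = e, the weight of \<open>G x\<close> is at most
    \<open>1 - s x\<close>; so \<open>s\<close> measures what is saved.\<close>
  define s where "s x = e powr p / (\<bar>u x\<bar> powr p + e powr p)" for x
  have ep: "e powr p > 0" using e by simp
  have s: "0 \<le> s x" "s x \<le> 1" for x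
    using ep by (auto simp: s_def divide_le_eq add_nonneg_pos add_nonneg_nonneg intro!: divide_nonneg_pos)
  have c: "0 < ?c" using p by simp
  define J where "J x = indicator (cball 0 R) x * (norm (G x) powr p * s x)" for x
  have meas_s: "s \<in> borel_measurable lebesgue"
    unfolding s_def[abs_def] using meas_u
    by (intro borel_measurable_divide borel_measurable_add powr_real_measurable) auto
  have J_int: "integrable lebesgue J"
  proof (rule integrable_nonneg_bound[OF G_int])
    show "J \<in> borel_measurable lebesgue"
      unfolding J_def[abs_def] using meas_s meas_G
      by (intro borel_measurable_times powr_real_measurable borel_measurable_indicator) auto
    show "0 \<le> J x" "J x \<le> norm (G x) powr p" for x
      using s[of x] by (auto simp: J_def indicator_def intro!: mult_left_le)
  qed
  have T_int: "integrable lebesgue (\<lambda>x. norm (tgrad ?\<phi> x) powr p)"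
    using p by (intro test_powr_integrable \<phi>) auto
  let ?E = "LINT x|lebesgue. norm (G x) powr p"
  \<comment> \<open>The Sobolev inequality for the competitor at a fixed regularisation
    \<open>d\<close>; the right-hand side is free of \<open>d\<close>.\<close>
  have step: "S * (LINT x|lebesgue. (max 0 (\<bar>u x\<bar> - d)) powr q) powr \<theta>
      \<le> ?E + e powr p * ?M - ?c * (LINT x|lebesgue. J x)" if d: "d > 0" for d
  proof -
    define A where "A z = pnorm_coeff p d (fst z) z" for z
    define B where "B z = pnorm_coeff p d (snd z) z" for z
    define W where "W x = smooth_pnorm p d (u x, \<psi> x)" for x
    define H where "H x = A (u x, \<psi> x) *\<^sub>R G x + B (u x, \<psi> x) *\<^sub>R tgrad \<psi> x" for x
    have WH: "has_weak_gradient W H"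
      unfolding W_def[abs_def] H_def[abs_def]
    proof (rule has_weak_gradient_chain[OF w \<psi>, where L = 1])
      show "(smooth_pnorm p d has_derivative (\<lambda>(s, t). A z * s + B z * t)) (at z)" for z
        unfolding A_def B_def by (rule smooth_pnorm_has_derivative[OF p d])
      show "continuous_on UNIV A" "continuous_on UNIV B"
        unfolding A_def[abs_def] B_def[abs_def] by (rule pnorm_coeff_continuous[OF p d])+
      show "\<bar>A z\<bar> \<le> 1" "\<bar>B z\<bar> \<le> 1" for z
        unfolding A_def B_def by (rule pnorm_coeff_le_1[OF p d])+
    qed
    have meas: "W \<in> borel_measurable lebesgue" "H \<in> borel_measurable lebesgue"
      using has_weak_gradient_locally_integrable[OF WH] locally_integrable_measurable by auto
    have H_le: "norm (H x) powr p \<le> norm (G x) powr p + e powr p * norm (tgrad ?\<phi> x) powr p - ?c * J x" for x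
    proof -
      define l where "l = \<bar>u x\<bar> powr p / (\<bar>u x\<bar> powr p + \<bar>\<psi> x\<bar> powr p + d powr p)"
      define m where "m = \<bar>\<psi> x\<bar> powr p / (\<bar>u x\<bar> powr p + \<bar>\<psi> x\<bar> powr p + d powr p)"
      have pos: "\<bar>u x\<bar> powr p + \<bar>\<psi> x\<bar> powr p + d powr p > 0"
        by (rule pnorm_pos[OF p d])
      have lm: "l \<ge> 0" "m \<ge> 0" "l + m \<le> 1"
        using pos by (auto simp: l_def m_def simp flip: add_divide_distrib)
      have A: "\<bar>A (u x, \<psi> x)\<bar> = l powr (1 - 1 / p)" and B: "\<bar>B (u x, \<psi> x)\<bar> = m powr (1 - 1 / p)"
        unfolding A_def B_def by (simp_all add: abs_pnorm_coeff[OF p d] l_def m_def)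
      have nH: "norm (H x) \<le> l powr (1 - 1 / p) * norm (G x) + m powr (1 - 1 / p) * norm (tgrad \<psi> x)"
        using norm_triangle_ineq[of "A (u x, \<psi> x) *\<^sub>R G x" "B (u x, \<psi> x) *\<^sub>R tgrad \<psi> x"]
        by (simp add: H_def A B)
      show ?thesis
      proof (cases "norm x \<le> R")
        case True
        have \<psi>e: "\<psi> x = e" using True R by (simp add: \<psi>_def cutoff_eq_1)
        \<comment> \<open>Inside the ball \<psi> has gradient 0, so only the weighted
          \<open>G\<close> survives. Outside, the weights are absorbed by Hoelder and nothing needs
          to be saved.\<close>
        have "norm (H x) powr p \<le> (l powr (1 - 1 / p) * norm (G x)) powr p"
          using nH p True by (intro powr_mono2) (auto simp: tg\<psi> tg0)
        also have "\<dots> = l powr (p - 1) * norm (G x) powr p"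
          using lm p by (simp add: powr_mult powr_powr left_diff_distrib)
        also have "l \<le> 1 - s x"
        proof -
          have "l \<le> \<bar>u x\<bar> powr p / (\<bar>u x\<bar> powr p + e powr p)"
            unfolding l_def \<psi>e using e d ep
            by (intro divide_left_mono mult_pos_pos add_nonneg_pos) (auto simp: add_nonneg_pos)
          also have "\<dots> = 1 - s x"
            using ep add_nonneg_pos[of "\<bar>u x\<bar> powr p" "e powr p"] by (simp add: s_def field_simps)
          finally show ?thesis .
        qed
        then have "l powr (p - 1) * norm (G x) powr p \<le> (1 - s x) powr (p - 1) * norm (G x) powr p"
          using lm p by (intro mult_right_mono powr_mono2) auto
        also have "\<dots> \<le> (1 - ?c * s x) * norm (G x) powr p"
          using s[of x] p by (intro mult_right_mono one_minus_powr_le) auto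
        also have "(1 - ?c * s x) * norm (G x) powr p = norm (G x) powr p - ?c * J x"
          using True by (simp add: J_def algebra_simps)
        finally have "norm (H x) powr p \<le> norm (G x) powr p - ?c * J x" .
        moreover have "0 \<le> e powr p * norm (tgrad ?\<phi> x) powr p" by simp
        ultimately show ?thesis by linarith
      next
        case False
        have "norm (H x) powr p \<le> (l powr (1 - 1 / p) * norm (G x) + m powr (1 - 1 / p) * norm (tgrad \<psi> x)) powr p"
          using nH p by (intro powr_mono2) auto
        also have "\<dots> \<le> norm (G x) powr p + norm (tgrad \<psi> x) powr p"
          using p lm by (intro two_term_holder) auto
        finally show ?thesis using False e by (simp add: J_def tg\<psi> powr_mult)
      qed
    qed
    have bound_int: "integrable lebesgue (\<lambda>x. norm (G x) powr p + e powr p * norm (tgrad ?\<phi> x) powr p - ?c * J x)"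
      using G_int T_int J_int by auto
    have H_int: "integrable lebesgue (\<lambda>x. norm (H x) powr p)"
      using H_le meas by (intro integrable_nonneg_bound[OF bound_int] powr_real_measurable) auto
    have W_int: "integrable lebesgue (\<lambda>x. \<bar>W x\<bar> powr q)"
    proof (rule integrable_nonneg_bound)
      show "integrable lebesgue (\<lambda>x. 2 powr q * (\<bar>u x\<bar> powr q + \<bar>\<psi> x\<bar> powr q))"
        using u_int test_powr_integrable(1)[OF \<psi> q] by auto
      show "(\<lambda>x. \<bar>W x\<bar> powr q) \<in> borel_measurable lebesgue"
        using meas by (intro powr_real_measurable) auto
      show "\<bar>W x\<bar> powr q \<le> 2 powr q * (\<bar>u x\<bar> powr q + \<bar>\<psi> x\<bar> powr q)" for x
      proof -
        have "\<bar>W x\<bar> \<le> \<bar>u x\<bar> + \<bar>\<psi> x\<bar>"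
          using smooth_pnorm_ge(1)[OF p d, of "(u x, \<psi> x)"] smooth_pnorm_le[OF p d, of "(u x, \<psi> x)"]
          by (simp add: W_def)
        then have "\<bar>W x\<bar> powr q \<le> (\<bar>u x\<bar> + \<bar>\<psi> x\<bar>) powr q"
          using q by (intro powr_mono2) auto
        also have "\<dots> \<le> 2 powr q * (\<bar>u x\<bar> powr q + \<bar>\<psi> x\<bar> powr q)"
          using q by (intro powr_add_le) auto
        finally show ?thesis .
      qed
    qed auto
    have "(LINT x|lebesgue. (max 0 (\<bar>u x\<bar> - d)) powr q) \<le> (LINT x|lebesgue. \<bar>W x\<bar> powr q)"
    proof (rule integral_mono[OF _ W_int])
      show le: "(max 0 (\<bar>u x\<bar> - d)) powr q \<le> \<bar>W x\<bar> powr q" for x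
        using q smooth_pnorm_ge[OF p d, of "(u x, \<psi> x)"] by (intro powr_mono2) (auto simp: W_def)
      show "integrable lebesgue (\<lambda>x. (max 0 (\<bar>u x\<bar> - d)) powr q)"
        using le meas_u by (intro integrable_nonneg_bound[OF W_int] powr_real_measurable) auto
    qed
    then have "S * (LINT x|lebesgue. (max 0 (\<bar>u x\<bar> - d)) powr q) powr \<theta> \<le> S * (LINT x|lebesgue. \<bar>W x\<bar> powr q) powr \<theta>"
      using S \<theta> by (intro mult_left_mono powr_mono2) (auto intro!: integral_nonneg_AE)
    also have "\<dots> \<le> (LINT x|lebesgue. norm (H x) powr p)"
      by (rule sobolev[OF WH H_int W_int])
    also have "\<dots> \<le> (LINT x|lebesgue. norm (G x) powr p + e powr p * norm (tgrad ?\<phi> x) powr p - ?c * J x)"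
      by (rule integral_mono[OF H_int bound_int H_le])
    also have "\<dots> = ?E + e powr p * ?M - ?c * (LINT x|lebesgue. J x)"
    proof -
      have i: "integrable lebesgue (\<lambda>x. e powr p * norm (tgrad ?\<phi> x) powr p)" "integrable lebesgue (\<lambda>x. ?c * J x)"
        using T_int J_int by auto
      show ?thesis
        using Bochner_Integration.integral_diff[OF Bochner_Integration.integrable_add[OF G_int i(1)] i(2)]
          Bochner_Integration.integral_add[OF G_int i(1)] by simp
    qed
    finally show ?thesis .
  qed
  \<comment> \<open>The sequence d = 1 / Suc n removes the regularisation.\<close>
  have "(\<lambda>n. S * (LINT x|lebesgue. (max 0 (\<bar>u x\<bar> - 1 / real (Suc n))) powr q) powr \<theta>)
      \<longlonglongrightarrow> S * (LINT x|lebesgue. \<bar>u x\<bar> powr q) powr \<theta>"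
    using \<theta> by (intro tendsto_mult_left tendsto_powr' truncated_mass_tendsto tendsto_const)
      (auto intro!: integral_nonneg_AE always_eventually)
  then have "S * (LINT x|lebesgue. \<bar>u x\<bar> powr q) powr \<theta> \<le> ?E + e powr p * ?M - ?c * (LINT x|lebesgue. J x)"
    by (rule LIMSEQ_le_const2) (intro exI allI impI step, simp)
  then have "?c * (LINT x|lebesgue. J x) \<le> e powr p * ?M"
    using extremal by simp
  moreover have "(LINT x|lebesgue. J x) = e powr p * ?I"
    unfolding J_def s_def
    by (subst integral_mult_right_zero[symmetric]) (intro Bochner_Integration.integral_cong, auto)
  ultimately have "e powr p * (?c * ?I) \<le> e powr p * ?M" by (simp add: mult.left_commute)
  then show ?thesis using ep by simp
qed

text \<open>Some translation by \<open>h\<close> carries a set of zeros of positive measure to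
  points where \<bar>\<open>u\<close>\<bar> is bounded below. There ln (1 + u^2 / e^2) jumps by an
  amount unbounded as e \<rightarrow> 0, whereas \<open>translation_L1_estimate\<close> bounds the
  integral of the jump by that of its gradient, which \<open>competitor_estimate\<close> controls
  uniformly in \<open>e\<close>.\<close>

lemma extremal_nonvanishing:
  assumes nz: "\<not> (AE x in lebesgue. u x = 0)"
  shows "AE x in lebesgue. u x \<noteq> 0"
proof (rule ccontr)
  assume "\<not> ?thesis"
  then obtain h where h: "\<not> (AE x in lebesgue. u x \<noteq> 0 \<or> u (x + h) = 0)"
    using exists_nonzero_translate[OF meas_u _ nz] by blast
  \<comment> \<open>A single index fixes both a bound for the points and a lower bound for the
    translate, whence the later pair \<open>r\<close> and \<open>1 / r\<close>.\<close>
  define E where "E k = {x. norm x \<le> real (Suc k) \<and> u x = 0 \<and> \<bar>u (x + h)\<bar> > 1 / real (Suc k)}" for k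
  have meas_uh: "(\<lambda>x. u (x + h)) \<in> borel_measurable lebesgue"
    by (rule borel_measurable_lebesgue_translation[OF meas_u])
  have E_sets: "E k \<in> sets lebesgue" for k
  proof -
    have "E k = cball 0 (real (Suc k)) \<inter> {x \<in> space lebesgue. u x = 0} \<inter> {x \<in> space lebesgue. 1 / real (Suc k) < \<bar>u (x + h)\<bar>}"
      by (auto simp: E_def)
    also have "\<dots> \<in> sets lebesgue"
      by (intro sets.Int borel_measurable_eq borel_measurable_less borel_measurable_const
          borel_measurable_abs meas_u meas_uh) simp
    finally show ?thesis .
  qed
  have "\<exists>k. E k \<notin> null_sets lebesgue"
  proof (rule ccontr)
    assume "\<nexists>k. E k \<notin> null_sets lebesgue"
    then have "AE x in lebesgue. \<forall>k. x \<notin> E k"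
      by (simp add: AE_all_countable AE_not_in)
    then have "AE x in lebesgue. u x \<noteq> 0 \<or> u (x + h) = 0"
    proof eventually_elim
      case (elim x)
      show ?case
      proof (rule ccontr)
        assume c: "\<not> (u x \<noteq> 0 \<or> u (x + h) = 0)"
        obtain k1 where k1: "inverse (real (Suc k1)) < \<bar>u (x + h)\<bar>"
          using reals_Archimedean[of "\<bar>u (x + h)\<bar>"] c by auto
        obtain k2 where k2: "norm x \<le> real k2" using real_arch_simple by blast
        define k where "k = max k1 k2"
        have "1 / real (Suc k) \<le> inverse (real (Suc k1))"
          by (simp add: k_def inverse_eq_divide frac_le)
        moreover have "norm x \<le> real (Suc k)" using k2 by (simp add: k_def)
        ultimately have "x \<in> E k" using c k1 by (simp add: E_def)
        with elim show False by blast
      qed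
    qed
    with h show False by blast
  qed
  then obtain k where k: "E k \<notin> null_sets lebesgue" by blast
  define r where "r = real (Suc k)"
  have r: "r > 0" by (simp add: r_def)
  have E_sub: "E k \<subseteq> cball 0 r" by (auto simp: E_def r_def)
  have E_fin: "emeasure lebesgue (E k) < \<infinity>"
    using emeasure_mono[OF E_sub, of lebesgue] emeasure_lborel_cball_finite[of "0 :: real ^ 'n" r]
    by (simp add: less_top)
  define m where "m = measure lebesgue (E k)"
  have m: "m > 0"
    using k E_sets[of k] E_fin unfolding m_def
    by (metis emeasure_eq_ennreal_measure ennreal_0 infinity_ennreal_def less_irrefl measure_nonneg null_setsI order_le_less)
  \<comment> \<open>The radius on the right of \<open>translation_L1_estimate\<close>.\<close>
  define R where "R = 2 * r + norm h"
  have R: "R > 0" using r by (simp add: R_def add_pos_nonneg)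
  define M where "M = (LINT x|lebesgue. norm (tgrad (cutoff (R + 1) :: real ^ 'n \<Rightarrow> real) x) powr p)"
  define V where "V = measure lebesgue (cball (0 :: real ^ 'n) R)"
  define C where "C = norm h * (V + 2 powr p * 2 * (M / min 1 (p - 1)))"
  have main: "m * ln (1 + (1 / r)\<^sup>2 / e\<^sup>2) \<le> C" if e: "e > 0" for e
  proof -
    \<comment> \<open>The derivative of the logarithm \<open>F\<close> in its first argument. Its
      \<open>p\<close>-th power is comparable to the weight in \<open>competitor_estimate\<close>;
      the extra factor 2 in \<open>A_pow\<close> arises because a maximum of \<open>p\<close>-th
      powers is at least half their sum.\<close>
    define A where "A z = 2 * fst z / ((fst z)\<^sup>2 + e\<^sup>2)" for z :: "real \<times> real"
    define F where "F z = ln (1 + (fst z)\<^sup>2 / e\<^sup>2)" for z :: "real \<times> real"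
    have pos: "(a::real)\<^sup>2 + e\<^sup>2 > 0" for a using e by (simp add: add_nonneg_pos)
    have A_le: "\<bar>A z\<bar> \<le> 2 / max \<bar>fst z\<bar> e" for z
    proof -
      let ?m = "max \<bar>fst z\<bar> e"
      have m0: "?m > 0" using e by auto
      have "?m\<^sup>2 \<le> (fst z)\<^sup>2 + e\<^sup>2" by (auto simp: max_def)
      moreover have "\<bar>fst z\<bar> * ?m \<le> ?m\<^sup>2" using m0 by (simp add: power2_eq_square mult_right_mono)
      ultimately have "\<bar>fst z\<bar> * ?m \<le> (fst z)\<^sup>2 + e\<^sup>2" by linarith
      then show ?thesis using m0 pos[of "fst z"] by (simp add: A_def abs_mult field_simps)
    qed
    have A_pow: "\<bar>A z\<bar> powr p \<le> 2 powr p * 2 / (\<bar>fst z\<bar> powr p + e powr p)" for z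
    proof -
      let ?m = "max \<bar>fst z\<bar> e"
      have m0: "?m > 0" using e by auto
      have "\<bar>A z\<bar> powr p \<le> (2 / ?m) powr p" using A_le[of z] p by (intro powr_mono2) auto
      also have "\<dots> = 2 powr p / ?m powr p" using m0 by (simp add: powr_divide)
      also have "\<dots> \<le> 2 powr p * 2 / (\<bar>fst z\<bar> powr p + e powr p)"
      proof -
        have "\<bar>fst z\<bar> powr p + e powr p \<le> ?m powr p + ?m powr p"
          using p e by (intro add_mono powr_mono2) auto
        then have "2 powr p * (\<bar>fst z\<bar> powr p + e powr p) \<le> 2 powr p * (2 * ?m powr p)"
          by (intro mult_left_mono) auto
        moreover have "\<bar>fst z\<bar> powr p + e powr p > 0" using e by (simp add: add_nonneg_pos)
        moreover have "?m powr p > 0" using m0 by simp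
        ultimately show ?thesis by (simp add: divide_le_eq le_divide_eq mult_ac)
      qed
      finally show ?thesis .
    qed
    define g where "g x = F (u x, 0)" for x
    have g: "has_weak_gradient g (\<lambda>x. A (u x, 0) *\<^sub>R G x)"
    proof -
      have "has_weak_gradient (\<lambda>x. F (u x, (\<lambda>x. 0) x)) (\<lambda>x. A (u x, (\<lambda>x. 0) x) *\<^sub>R G x + 0 *\<^sub>R tgrad (\<lambda>x. 0) x)"
      proof (rule has_weak_gradient_chain[OF w test_zero, where L = "2 / e"])
        fix z :: "real \<times> real"
        have "1 + (fst z)\<^sup>2 / e\<^sup>2 > 0" by (simp add: add_pos_nonneg)
        moreover have "((\<lambda>a. 1 + a\<^sup>2 / e\<^sup>2) has_real_derivative 2 * fst z / e\<^sup>2) (at (fst z))"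
          by (rule DERIV_cong[OF DERIV_add[OF DERIV_const DERIV_cdivide[OF DERIV_power[OF DERIV_ident]]]]) simp
        ultimately have "((\<lambda>a. ln (1 + a\<^sup>2 / e\<^sup>2)) has_real_derivative
            inverse (1 + (fst z)\<^sup>2 / e\<^sup>2) * (2 * fst z / e\<^sup>2)) (at (fst z))"
          by (intro DERIV_chain2[OF DERIV_ln])
        moreover have "inverse (1 + (fst z)\<^sup>2 / e\<^sup>2) * (2 * fst z / e\<^sup>2) = A z"
          using pos[of "fst z"] e by (simp add: A_def field_simps)
        ultimately have "((\<lambda>a. ln (1 + a\<^sup>2 / e\<^sup>2)) has_derivative (*) (A z)) (at (fst z))"
          by (simp add: has_field_derivative_def)
        from has_derivative_compose[OF has_derivative_fst[OF has_derivative_ident] this, of UNIV]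
        show "(F has_derivative (\<lambda>(s, t). A z * s + 0 * t)) (at z)"
          by (simp add: F_def[abs_def] case_prod_unfold)
        show "\<bar>A z\<bar> \<le> 2 / e"
        proof -
          have "2 / max \<bar>fst z\<bar> e \<le> 2 / e" using e by (intro divide_left_mono) auto
          then show ?thesis using A_le[of z] by linarith
        qed
      next
        show "continuous_on UNIV A" unfolding A_def[abs_def]
          using pos by (intro continuous_intros) (metis less_irrefl)
      qed (use e in auto)
      then show ?thesis by (simp add: g_def[abs_def])
    qed
    note lig = has_weak_gradient_locally_integrable[OF g]
    let ?K = "\<lambda>x. indicator (cball 0 R) x * (norm (G x) powr p / (\<bar>u x\<bar> powr p + e powr p))"
    have K_int: "integrable lebesgue ?K"
    proof (rule integrable_nonneg_bound)
      show "integrable lebesgue (\<lambda>x. norm (G x) powr p / e powr p)" using G_int by auto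
      show "?K \<in> borel_measurable lebesgue" using meas_u meas_G
        by (intro borel_measurable_times borel_measurable_divide borel_measurable_add powr_real_measurable borel_measurable_indicator) auto
      show "?K x \<le> norm (G x) powr p / e powr p" for x
        using e by (auto simp: indicator_def intro!: divide_left_mono add_nonneg_pos mult_pos_pos)
      show "0 \<le> ?K x" for x by (auto simp: indicator_def)
    qed
    have "m * ln (1 + (1 / r)\<^sup>2 / e\<^sup>2) = (LINT x|lebesgue. indicator (E k) x * ln (1 + (1 / r)\<^sup>2 / e\<^sup>2))"
      using E_sets[of k] E_fin by (simp add: m_def)
    also have "\<dots> \<le> (LINT x|lebesgue. indicator (cball 0 r) x * \<bar>g (x + h) - g x\<bar>)"
    proof (rule integral_mono)
      show "integrable lebesgue (\<lambda>x. indicator (E k) x * ln (1 + (1 / r)\<^sup>2 / e\<^sup>2))"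
        using E_sets[of k] E_fin by (intro integrable_mult_left integrable_real_indicator) auto
      show "integrable lebesgue (\<lambda>x. indicator (cball 0 r) x * \<bar>g (x + h) - g x\<bar>)"
        by (intro locally_integrable_abs_cball locally_integrable_diff locally_integrable_shift lig)
      show "indicator (E k) x * ln (1 + (1 / r)\<^sup>2 / e\<^sup>2) \<le> indicator (cball 0 r) x * \<bar>g (x + h) - g x\<bar>" for x
      proof (cases "x \<in> E k")
        case True
        then have "x \<in> cball 0 r" and ux: "u x = 0" and uh: "1 / r \<le> \<bar>u (x + h)\<bar>"
          using E_sub by (auto simp: E_def r_def)
        have "(1 / r)\<^sup>2 \<le> \<bar>u (x + h)\<bar>\<^sup>2" using uh r by (intro power_mono) auto
        then have "1 + (1 / r)\<^sup>2 / e\<^sup>2 \<le> 1 + (u (x + h))\<^sup>2 / e\<^sup>2"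
          by (simp add: divide_right_mono)
        moreover have "1 + (1 / r)\<^sup>2 / e\<^sup>2 > 0" by (simp add: add_pos_nonneg)
        ultimately have "ln (1 + (1 / r)\<^sup>2 / e\<^sup>2) \<le> ln (1 + (u (x + h))\<^sup>2 / e\<^sup>2)"
          by (intro ln_mono) auto
        also have "\<dots> = g (x + h) - g x" by (simp add: g_def F_def ux)
        finally show ?thesis using True \<open>x \<in> cball 0 r\<close> by simp
      qed auto
    qed
    also have "\<dots> \<le> (LINT x|lebesgue. indicator (cball 0 R) x * \<bar>(A (u x, 0) *\<^sub>R G x) \<bullet> h\<bar>)"
      unfolding R_def by (rule translation_L1_estimate[OF g r])
    also have "\<dots> \<le> (LINT x|lebesgue. norm h * (indicator (cball 0 R) x + 2 powr p * 2 * ?K x))"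
    proof (rule integral_mono)
      show "integrable lebesgue (\<lambda>x. indicator (cball 0 R) x * \<bar>(A (u x, 0) *\<^sub>R G x) \<bullet> h\<bar>)"
        by (intro locally_integrable_abs_cball locally_integrable_inner lig)
      show "integrable lebesgue (\<lambda>x. norm h * (indicator (cball 0 R) x + 2 powr p * 2 * ?K x))"
        by (intro integrable_mult_right Bochner_Integration.integrable_add integrable_indicator_cball K_int)
      fix x
      \<comment> \<open>The bound t \<le> 1 + t^p passes from the first to the \<open>p\<close>-th
        power of the gradient; on a ball the 1 contributes only the volume \<open>V\<close>.\<close>
      have "norm (A (u x, 0) *\<^sub>R G x) \<le> 1 + norm (A (u x, 0) *\<^sub>R G x) powr p"
      proof (cases "norm (A (u x, 0) *\<^sub>R G x) \<le> 1")
        case False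
        then have "norm (A (u x, 0) *\<^sub>R G x) powr 1 \<le> norm (A (u x, 0) *\<^sub>R G x) powr p"
          using p by (intro powr_mono) auto
        then show ?thesis by simp
      qed (simp add: add_increasing2)
      also have "norm (A (u x, 0) *\<^sub>R G x) powr p = \<bar>A (u x, 0)\<bar> powr p * norm (G x) powr p"
        by (simp add: powr_mult)
      also have "\<dots> \<le> 2 powr p * 2 / (\<bar>u x\<bar> powr p + e powr p) * norm (G x) powr p"
        using A_pow[of "(u x, 0)"] by (intro mult_right_mono) auto
      finally have "norm h * norm (A (u x, 0) *\<^sub>R G x)
          \<le> norm h * (1 + 2 powr p * 2 / (\<bar>u x\<bar> powr p + e powr p) * norm (G x) powr p)"
        by (intro mult_left_mono) auto
      then have "\<bar>(A (u x, 0) *\<^sub>R G x) \<bullet> h\<bar>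
          \<le> norm h * (1 + 2 powr p * 2 / (\<bar>u x\<bar> powr p + e powr p) * norm (G x) powr p)"
        using Cauchy_Schwarz_ineq2[of "A (u x, 0) *\<^sub>R G x" h] by (simp add: mult.commute)
      then show "indicator (cball 0 R) x * \<bar>(A (u x, 0) *\<^sub>R G x) \<bullet> h\<bar>
          \<le> norm h * (indicator (cball 0 R) x + 2 powr p * 2 * ?K x)"
        by (simp add: indicator_def mult.commute)
    qed
    also have "\<dots> = norm h * (V + 2 powr p * 2 * (LINT x|lebesgue. ?K x))"
    proof -
      have i: "integrable lebesgue (\<lambda>x. 2 powr p * 2 * ?K x)"
        by (intro integrable_mult_right K_int)
      have "(LINT x|lebesgue. norm h * (indicator (cball 0 R) x + 2 powr p * 2 * ?K x))
        = norm h * (LINT x|lebesgue. indicator (cball 0 R) x + 2 powr p * 2 * ?K x)"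
        by (rule integral_mult_right_zero)
      also have "(LINT x|lebesgue. indicator (cball 0 R) x + 2 powr p * 2 * ?K x)
        = (LINT x|lebesgue. indicator (cball (0 :: real ^ 'n) R) x) + (LINT x|lebesgue. 2 powr p * 2 * ?K x)"
        by (rule Bochner_Integration.integral_add[OF integrable_indicator_cball i])
      also have "(LINT x|lebesgue. 2 powr p * 2 * ?K x) = 2 powr p * 2 * (LINT x|lebesgue. ?K x)"
        by (rule integral_mult_right_zero)
      finally show ?thesis by (simp only: integral_indicator_cball V_def)
    qed
    also have "\<dots> \<le> C"
    proof -
      have "min 1 (p - 1) * (LINT x|lebesgue. ?K x) \<le> M"
        unfolding M_def by (rule competitor_estimate[OF R e])
      then have "(LINT x|lebesgue. ?K x) \<le> M / min 1 (p - 1)"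
        using p by (simp add: pos_le_divide_eq mult.commute)
      then show ?thesis unfolding C_def by (intro mult_left_mono add_left_mono) auto
    qed
    finally show ?thesis .
  qed
  \<comment> \<open>Chosen so that \<open>m * L\<close> = \<bar>\<open>C\<close>\<bar> +
    \<open>m\<close> exceeds \<open>C\<close>; \<open>e\<close> is then the value at which the
    logarithm equals \<open>L\<close>.\<close>
  define L where "L = \<bar>C\<bar> / m + 1"
  have L: "L > 0" using m by (simp add: L_def add_nonneg_pos)
  define e where "e = 1 / (r * sqrt (exp L - 1))"
  have sq: "sqrt (exp L - 1) > 0" using L by simp
  have "e > 0" using r sq by (simp add: e_def)
  moreover have "1 + (1 / r)\<^sup>2 / e\<^sup>2 = exp L"
    using r L by (simp add: e_def power_divide power_mult_distrib)
  ultimately have "m * L \<le> C" using main[of e] by simp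
  moreover have "m * L = \<bar>C\<bar> + m" using m by (simp add: L_def field_simps)
  ultimately show False using m by linarith
qed

end

section \<open>Near-minimisers with compact support\<close>

lemma crit_exp_facts:
  assumes "1 < p" "p < real N"
  shows "crit_exp N p > p" "p / crit_exp N p = (real N - p) / real N"
    "1 - p / crit_exp N p = p / real N" "p / crit_exp N p > 0"
    "p / crit_exp N p * (real N / p) = (real N - p) / p"
    "p / (crit_exp N p - p) = (real N - p) / p"
    "1 / p - 1 / crit_exp N p = 1 / real N"
proof -
  have N: "real N > 0" "real N - p > 0" using assms by auto
  show q: "crit_exp N p > p" using assms N by (simp add: crit_exp_def field_simps)
  show "p / crit_exp N p = (real N - p) / real N" "1 - p / crit_exp N p = p / real N" "p / crit_exp N p > 0"
    using assms N by (auto simp: crit_exp_def field_simps)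
  show "p / crit_exp N p * (real N / p) = (real N - p) / p"
    using assms N by (simp add: crit_exp_def field_simps)
  have e: "crit_exp N p - p = p * p / (real N - p)"
    using N by (simp add: crit_exp_def field_simps)
  show "p / (crit_exp N p - p) = (real N - p) / p"
    unfolding e using assms N by (simp add: field_simps)
  show "1 / p - 1 / crit_exp N p = 1 / real N"
    using assms N by (simp add: crit_exp_def field_simps)
qed

section \<open>Dirichlet integral, critical mass and Sobolev quotient\<close>

abbreviation dirichlet :: "real \<Rightarrow> (real ^ 'n::finite \<Rightarrow> real) \<Rightarrow> real" where
  "dirichlet p u \<equiv> (LINT x|lebesgue. norm (weak_grad u x) powr p)"

abbreviation crit_mass :: "real \<Rightarrow> (real ^ 'n::finite \<Rightarrow> real) \<Rightarrow> real" where
  "crit_mass p u \<equiv> (LINT x|lebesgue. \<bar>u x\<bar> powr crit_exp CARD('n) p)"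

text \<open>\<open>weak_grad\<close> is an arbitrary choice; uniqueness up to null sets lets any
  explicit weak gradient compute the Dirichlet integral.\<close>

lemma weak_grad_powr:
  assumes G: "has_weak_gradient u G" and int: "integrable lebesgue (\<lambda>x. norm (G x) powr p)"
  shows "integrable lebesgue (\<lambda>x. norm (weak_grad u x) powr p)"
    "dirichlet p u = (LINT x|lebesgue. norm (G x) powr p)"
proof -
  note W = has_weak_gradient_weak_grad[OF G]
  have meas: "(\<lambda>x. norm (weak_grad u x) powr p) \<in> borel_measurable lebesgue"
    "(\<lambda>x. norm (G x) powr p) \<in> borel_measurable lebesgue"
    using locally_integrable_measurable[OF has_weak_gradient_locally_integrable(2)[OF W]]
      locally_integrable_measurable[OF has_weak_gradient_locally_integrable(2)[OF G]]
    by (auto intro!: powr_real_measurable)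
  have ae: "AE x in lebesgue. norm (weak_grad u x) powr p = norm (G x) powr p"
    using weak_grad_AE_eq[OF G] by auto
  show "dirichlet p u = (LINT x|lebesgue. norm (G x) powr p)"
    by (rule integral_cong_AE[OF meas ae])
  show "integrable lebesgue (\<lambda>x. norm (weak_grad u x) powr p)"
    using int integrable_cong_AE[OF meas ae] by simp
qed

lemma D1pD:
  fixes u :: "real ^ 'n::finite \<Rightarrow> real"
  assumes "u \<in> D1p p"
  shows "has_weak_gradient u (weak_grad u)" "integrable lebesgue (\<lambda>x. norm (weak_grad u x) powr p)"
    "integrable lebesgue (\<lambda>x. \<bar>u x\<bar> powr crit_exp CARD('n) p)"
    "u \<in> borel_measurable lebesgue"
  using assms weak_grad_powr has_weak_gradient_weak_grad by (auto simp: D1p_def in_Lp_def)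

lemma D1pI:
  fixes u :: "real ^ 'n::finite \<Rightarrow> real"
  assumes "has_weak_gradient u G" "integrable lebesgue (\<lambda>x. norm (G x) powr p)"
    "integrable lebesgue (\<lambda>x. \<bar>u x\<bar> powr crit_exp CARD('n) p)"
  shows "u \<in> D1p p" "dirichlet p u = (LINT x|lebesgue. norm (G x) powr p)"
  using assms weak_grad_powr(2)[OF assms(1,2)] has_weak_gradient_locally_integrable[OF assms(1)]
  by (auto simp: D1p_def in_Lp_def locally_integrable_measurable)

lemma integral_abs_powr_pos:
  fixes u :: "real ^ 'n::finite \<Rightarrow> real"
  assumes "integrable lebesgue (\<lambda>x. \<bar>u x\<bar> powr q)" "nonzero u"
  shows "(LINT x|lebesgue. \<bar>u x\<bar> powr q) > 0"
proof -
  have "(LINT x|lebesgue. \<bar>u x\<bar> powr q) \<noteq> 0"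
    using assms by (subst integral_nonneg_eq_0_iff_AE) (auto simp: nonzero_def)
  moreover have "(LINT x|lebesgue. \<bar>u x\<bar> powr q) \<ge> 0" by (intro integral_nonneg_AE) auto
  ultimately show ?thesis by (metis order_le_neq_trans)
qed

lemma dirichlet_nonneg: "dirichlet p u \<ge> 0"
  by (intro integral_nonneg_AE) auto

lemma dirichlet_pos:
  fixes u :: "real ^ 'n::finite \<Rightarrow> real"
  assumes u: "u \<in> D1p p" "nonzero u"
  shows "dirichlet p u > 0"
proof -
  have "dirichlet p u \<noteq> 0"
  proof
    assume "dirichlet p u = 0"
    then have "AE x in lebesgue. weak_grad u x = 0"
      using D1pD(2)[OF u(1)] by (subst (asm) integral_nonneg_eq_0_iff_AE) auto
    from zero_gradient_imp_zero[OF D1pD(1)[OF u(1)] this D1pD(3)[OF u(1)]] u(2)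
    show False by (simp add: nonzero_def)
  qed
  then show ?thesis using dirichlet_nonneg[of u p] by (metis order_le_neq_trans)
qed

lemma D1p_cmult:
  fixes u :: "real ^ 'n::finite \<Rightarrow> real"
  assumes u: "u \<in> D1p p" and c: "c > 0"
  shows "(\<lambda>x. c * u x) \<in> D1p p" "dirichlet p (\<lambda>x. c * u x) = c powr p * dirichlet p u"
    "crit_mass p (\<lambda>x. c * u x) = c powr crit_exp CARD('n) p * crit_mass p u"
    "nonzero (\<lambda>x. c * u x) \<longleftrightarrow> nonzero u"
proof -
  have wg: "has_weak_gradient (\<lambda>x. c * u x) (\<lambda>x. c *\<^sub>R weak_grad u x)"
    by (rule has_weak_gradient_scaleR[OF D1pD(1)[OF u]])
  have eq: "norm (c *\<^sub>R weak_grad u x) powr p = c powr p * norm (weak_grad u x) powr p" for x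
    using c by (simp add: powr_mult)
  have eq': "\<bar>c * u x\<bar> powr q = c powr q * \<bar>u x\<bar> powr q" for x q
    using c by (simp add: abs_mult powr_mult)
  have i: "integrable lebesgue (\<lambda>x. norm (c *\<^sub>R weak_grad u x) powr p)"
    unfolding eq by (intro integrable_mult_right D1pD(2)[OF u])
  have i': "integrable lebesgue (\<lambda>x. \<bar>c * u x\<bar> powr crit_exp CARD('n) p)"
    unfolding eq' by (intro integrable_mult_right D1pD(3)[OF u])
  show "(\<lambda>x. c * u x) \<in> D1p p" by (rule D1pI(1)[OF wg i i'])
  show "dirichlet p (\<lambda>x. c * u x) = c powr p * dirichlet p u"
    using D1pI(2)[OF wg i i'] unfolding eq by simp
  show "crit_mass p (\<lambda>x. c * u x) = c powr crit_exp CARD('n) p * crit_mass p u"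
    unfolding eq' by simp
  show "nonzero (\<lambda>x. c * u x) \<longleftrightarrow> nonzero u" using c by (simp add: nonzero_def)
qed

lemma D1p_shift:
  fixes u :: "real ^ 'n::finite \<Rightarrow> real"
  assumes u: "u \<in> D1p p"
  shows "(\<lambda>x. u (x + a)) \<in> D1p p" "dirichlet p (\<lambda>x. u (x + a)) = dirichlet p u"
    "crit_mass p (\<lambda>x. u (x + a)) = crit_mass p u"
proof -
  have wg: "has_weak_gradient (\<lambda>x. u (x + a)) (\<lambda>x. weak_grad u (x + a))"
    by (rule has_weak_gradient_shift[OF D1pD(1)[OF u]])
  note i = integrable_lebesgue_translation[OF D1pD(2)[OF u], of a]
  note i' = integrable_lebesgue_translation[OF D1pD(3)[OF u], of a]
  show "(\<lambda>x. u (x + a)) \<in> D1p p" by (rule D1pI(1)[OF wg i i'])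
  show "dirichlet p (\<lambda>x. u (x + a)) = dirichlet p u"
    using D1pI(2)[OF wg i i'] integral_lebesgue_translation[OF borel_measurable_integrable[OF D1pD(2)[OF u]], of a] by simp
  show "crit_mass p (\<lambda>x. u (x + a)) = crit_mass p u"
    using integral_lebesgue_translation[OF borel_measurable_integrable[OF D1pD(3)[OF u]], of a] by simp
qed

definition sobolev_quotient :: "real \<Rightarrow> (real ^ 'n::finite \<Rightarrow> real) \<Rightarrow> real" where
  "sobolev_quotient p u = dirichlet p u / crit_mass p u powr (p / crit_exp CARD('n) p)"

lemma sobolev_quotient_nonneg: "sobolev_quotient p u \<ge> 0"
  unfolding sobolev_quotient_def by (intro divide_nonneg_nonneg dirichlet_nonneg) auto

lemma sobolev_const_alt:
  "sobolev_const TYPE('n::finite) p = (INF u \<in> {u \<in> (D1p p :: (real ^ 'n \<Rightarrow> real) set). nonzero u}. sobolev_quotient p u)"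
  by (simp add: sobolev_const_def sobolev_quotient_def)

lemma test_in_D1p:
  fixes \<phi> :: "real ^ 'n::finite \<Rightarrow> real"
  assumes "1 < p" "p < real CARD('n)" "test_function \<phi>"
  shows "\<phi> \<in> D1p p"
  using assms crit_exp_facts(1)[OF assms(1,2)]
  by (intro D1pI[OF has_weak_gradient_test] test_powr_integrable) auto

lemma nonzero_D1p_exists:
  assumes "1 < p" "p < real CARD('n::finite)"
  shows "\<exists>u \<in> (D1p p :: (real ^ 'n \<Rightarrow> real) set). nonzero u"
proof
  let ?\<phi> = "cutoff 1 :: real ^ 'n \<Rightarrow> real"
  show "?\<phi> \<in> D1p p" by (rule test_in_D1p[OF assms test_cutoff]) simp
  show "nonzero ?\<phi>"
    unfolding nonzero_def
  proof
    assume "AE x in lebesgue. ?\<phi> x = 0"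
    moreover have "closed {x. ?\<phi> x = 0}"
      by (intro closed_Collect_eq continuous_intros test_continuous test_cutoff) simp
    \<comment> \<open>A closed set of full measure is the whole space, so a cutoff vanishing a.e.
      would vanish at the origin too.\<close>
    ultimately have "0 \<in> {x. ?\<phi> x = 0}"
      by (intro mem_closed_if_AE_lebesgue) auto
    then show False using cutoff_eq_1[of 1 "0 :: real ^ 'n"] by simp
  qed
qed

lemma sobolev_const_nonneg:
  assumes "1 < p" "p < real CARD('n::finite)"
  shows "sobolev_const TYPE('n) p \<ge> 0"
  unfolding sobolev_const_alt using nonzero_D1p_exists[OF assms]
  by (intro cINF_greatest sobolev_quotient_nonneg) auto

text \<open>Extended to functions that are 0 a.e., whose mass is 0 and for which
  \<open>0 powr\<close> a number is 0; competitors can then be inserted without checking that they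
  are nonzero.\<close>

lemma sobolev_inequality:
  fixes u :: "real ^ 'n::finite \<Rightarrow> real"
  assumes p: "1 < p" "p < real CARD('n)" and u: "u \<in> D1p p"
  shows "sobolev_const TYPE('n) p * crit_mass p u powr (p / crit_exp CARD('n) p) \<le> dirichlet p u"
proof (cases "nonzero u")
  case True
  have "sobolev_const TYPE('n) p \<le> sobolev_quotient p u"
    unfolding sobolev_const_alt using True u sobolev_quotient_nonneg
    by (intro cINF_lower bdd_belowI2[of _ 0]) auto
  moreover have "crit_mass p u powr (p / crit_exp CARD('n) p) > 0"
    using integral_abs_powr_pos[OF D1pD(3)[OF u] True] by simp
  ultimately show ?thesis by (simp add: sobolev_quotient_def pos_le_divide_eq)
next
  case False
  then have "AE x in lebesgue. \<bar>u x\<bar> powr crit_exp CARD('n) p = 0"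
    by (auto simp: nonzero_def)
  then have "crit_mass p u = 0" by (rule integral_eq_zero_AE)
  then show ?thesis using dirichlet_nonneg by simp
qed

section \<open>Truncation of near-minimisers\<close>

text \<open>All cutoffs are rescalings of \<open>cutoff 1\<close>, so one gradient bound
  \<open>M\<close> becomes \<open>M / r\<close>.\<close>

lemma tgrad_cutoff_bound:
  "\<exists>M>0. \<forall>r>0. \<forall>x::real ^ 'n::finite. norm (tgrad (cutoff r) x) \<le> M / r \<and>
     (norm x < r \<or> norm x > 2 * r \<longrightarrow> tgrad (cutoff r) x = 0)"
proof -
  let ?\<phi> = "cutoff 1 :: real ^ 'n \<Rightarrow> real"
  have \<phi>: "test_function ?\<phi>" by (rule test_cutoff) simp
  obtain M where M: "M > 0" "\<And>x. norm (tgrad ?\<phi> x) \<le> M"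
    using tgrad_bounded[OF \<phi>] by blast
  have eq: "tgrad (cutoff r) x = (1 / r) *\<^sub>R tgrad ?\<phi> (x /\<^sub>R r)" if r: "r > 0" for r and x :: "real ^ 'n"
  proof (rule tgrad_eqI)
    have "((\<lambda>x. x /\<^sub>R r) has_derivative (\<lambda>h. h /\<^sub>R r)) (at x)"
      by (auto intro!: derivative_eq_intros)
    from has_derivative_compose[OF this test_has_derivative[OF \<phi>]]
    have "((\<lambda>x. ?\<phi> (x /\<^sub>R r)) has_derivative (\<lambda>h. tgrad ?\<phi> (x /\<^sub>R r) \<bullet> (h /\<^sub>R r))) (at x)" .
    moreover have "(\<lambda>x. ?\<phi> (x /\<^sub>R r)) = cutoff r"
      by (intro ext cutoff_scale[OF r, symmetric])
    ultimately show "(cutoff r has_derivative (\<lambda>h. (1 / r) *\<^sub>R tgrad ?\<phi> (x /\<^sub>R r) \<bullet> h)) (at x)"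
      by (simp add: inverse_eq_divide)
  qed
  have "norm (tgrad (cutoff r) x) \<le> M / r" if "r > 0" for r and x :: "real ^ 'n"
    unfolding eq[OF that] using M(2)[of "x /\<^sub>R r"] that by (simp add: divide_right_mono)
  moreover have "tgrad (cutoff r) x = 0" if "r > 0" "norm x > 2 * r" for r and x :: "real ^ 'n"
    using that by (intro tgrad_support[OF test_cutoff, of r "2 * r"]) (auto intro: cutoff_eq_0)
  ultimately show ?thesis using M(1) tgrad_cutoff_plateau by blast
qed

text \<open>The N-th power of the cutoff gradient has a scale-invariant integral, and Hoelder with
  exponents N/(N-p) and N/p pairs it with the critical mass of \<open>u\<close> outside a growing
  ball, which tends to 0. Hoelder is replaced by Young's inequality with a free parameter
  \<open>t\<close>.\<close>

lemma cutoff_gradient_term_tendsto: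
  fixes u :: "real ^ 'n::finite \<Rightarrow> real"
  assumes p: "1 < p" "p < real CARD('n)" and u: "u \<in> D1p p"
  shows "integrable lebesgue (\<lambda>x. norm (u x *\<^sub>R tgrad (cutoff (real (Suc k))) x) powr p)"
    "(\<lambda>k. LINT x|lebesgue. norm (u x *\<^sub>R tgrad (cutoff (real (Suc k))) x) powr p) \<longlonglongrightarrow> 0"
proof -
  note [simp del] = of_nat_Suc
  define n where "n = real CARD('n)"
  define q where "q = crit_exp CARD('n) p"
  have n: "n > 0" "n - p > 0" using p by (auto simp: n_def)
  have q: "q = n * p / (n - p)" by (simp add: q_def crit_exp_def n_def)
  define Q where "Q = n / (n - p)"
  define Q' where "Q' = n / p"
  have Q: "Q > 1" "Q' > 1" "1 / Q + 1 / Q' = 1" "p * Q = q" "p * Q' = n"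
    using p n by (auto simp: Q_def Q'_def q n_def field_simps)
  obtain M where M: "M > 0" "\<And>r (x :: real ^ 'n). r > 0 \<Longrightarrow> norm (tgrad (cutoff r) x) \<le> M / r"
    "\<And>r (x :: real ^ 'n). r > 0 \<Longrightarrow> norm x < r \<or> norm x > 2 * r \<Longrightarrow> tgrad (cutoff r) x = 0"
    using tgrad_cutoff_bound by blast
  define f where "f k x = norm (u x *\<^sub>R tgrad (cutoff (real (Suc k))) x) powr p" for k x
  define tail where "tail k x = (if real (Suc k) \<le> norm x then \<bar>u x\<bar> powr q else 0)" for k and x :: "real ^ 'n"
  \<comment> \<open>The volume of the ball of radius 2(k+1) times the \<open>n\<close>-th power of
    the gradient bound M/(k+1): the dependence on \<open>k\<close> cancels.\<close>
  define V where "V = unit_ball_vol n * 2 powr n * M powr n"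
  have V: "V \<ge> 0" using n by (simp add: V_def)
  have f_meas: "f k \<in> borel_measurable lebesgue" for k
    unfolding f_def[abs_def]
    by (intro powr_real_measurable borel_measurable_const
        measurable_compose[OF borel_measurable_scaleR[OF D1pD(4)[OF u]
          borel_measurable_lebesgue_continuous[OF tgrad_continuous[OF test_cutoff]]] borel_measurable_norm]) simp
  have u_int: "integrable lebesgue (\<lambda>x. \<bar>u x\<bar> powr q)"
    using D1pD(3)[OF u] by (simp add: q_def)
  have tail_meas: "tail k \<in> borel_measurable lebesgue" for k
  proof -
    have "tail k = (\<lambda>x. indicator (- ball 0 (real (Suc k))) x * \<bar>u x\<bar> powr q)"
      by (auto simp: tail_def indicator_def not_less)
    then show ?thesis using u_int by (auto intro!: borel_measurable_times borel_measurable_indicator)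
  qed
  have tail_int: "integrable lebesgue (tail k)" for k
    by (rule integrable_nonneg_bound[OF u_int tail_meas]) (auto simp: tail_def)
  have tail_lim: "(\<lambda>k. LINT x|lebesgue. tail k x) \<longlonglongrightarrow> (LINT x|(lebesgue :: (real ^ 'n) measure). 0)"
  proof (rule integral_dominated_convergence[OF _ tail_meas u_int])
    show "AE x in lebesgue. (\<lambda>k. tail k x) \<longlonglongrightarrow> 0"
    proof (intro AE_I2 tendsto_eventually)
      fix x
      show "\<forall>\<^sub>F k in sequentially. tail k x = 0"
        using eventually_le_real[of "norm x"] by eventually_elim (simp add: tail_def)
    qed
    show "AE x in lebesgue. norm (tail k x) \<le> \<bar>u x\<bar> powr q" for k
      by (auto simp: tail_def)
  qed simp
  let ?b = "\<lambda>t k x. t powr Q * tail k x + indicator (cball 0 (2 * real (Suc k))) x * ((M / real (Suc k)) powr n / t powr Q')"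
  have f_le: "f k x \<le> ?b t k x" if t: "t > 0" for t k x
  proof (cases "real (Suc k) \<le> norm x \<and> norm x \<le> 2 * real (Suc k)")
    case True
    define c where "c = M / real (Suc k)"
    have c: "c > 0" using M(1) by (simp add: c_def)
    define y where "y = c powr p"
    have shrink: "a / b \<le> a" if "a \<ge> 0" "b > 1" for a b :: real
      using that mult_left_mono[of 1 b a] by (simp add: divide_le_eq)
    have "norm (u x *\<^sub>R tgrad (cutoff (real (Suc k))) x) \<le> \<bar>u x\<bar> * c"
      unfolding norm_scaleR c_def by (intro mult_left_mono M(2)) auto
    then have "f k x \<le> (\<bar>u x\<bar> * c) powr p"
      unfolding f_def using p by (intro powr_mono2) auto
    also have "\<dots> = (t * \<bar>u x\<bar> powr p) * (y / t)"
      using t c by (simp add: y_def powr_mult)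
    also have "\<dots> \<le> (t * \<bar>u x\<bar> powr p) powr Q / Q + (y / t) powr Q' / Q'"
      using Q t by (intro Youngs_inequality) (auto simp: y_def)
    also have "\<dots> \<le> (t * \<bar>u x\<bar> powr p) powr Q + (y / t) powr Q'"
      using Q by (intro add_mono shrink) auto
    also have "(t * \<bar>u x\<bar> powr p) powr Q = t powr Q * \<bar>u x\<bar> powr q"
      using t Q(4) by (simp add: powr_mult powr_powr)
    also have "(y / t) powr Q' = (M / real (Suc k)) powr n / t powr Q'"
      using t Q(5) c by (simp add: powr_divide powr_powr y_def flip: c_def)
    finally show ?thesis using True by (simp add: tail_def)
  next
    case False
    then have "f k x = 0" using M(3)[of "real (Suc k)" x] by (auto simp: f_def)
    then show ?thesis by (auto simp: tail_def indicator_def)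
  qed
  have b_int: "integrable lebesgue (?b t k)" for t k
    by (intro Bochner_Integration.integrable_add integrable_mult_right integrable_mult_left
        integrable_indicator_cball tail_int)
  have f_int: "integrable lebesgue (f k)" for k
    using f_le[of 1 k] by (intro integrable_nonneg_bound[OF b_int[of 1 k] f_meas]) (auto simp: f_def)
  show "integrable lebesgue (\<lambda>x. norm (u x *\<^sub>R tgrad (cutoff (real (Suc k))) x) powr p)"
    using f_int[of k] unfolding f_def[abs_def] .
  have int_le: "(LINT x|lebesgue. f k x) \<le> t powr Q * (LINT x|lebesgue. tail k x) + V / t powr Q'" if t: "t > 0" for t k
  proof -
    have i: "integrable lebesgue (\<lambda>x. t powr Q * tail k x)"
      "integrable lebesgue (\<lambda>x. indicator (cball (0 :: real ^ 'n) (2 * real (Suc k))) x * ((M / real (Suc k)) powr n / t powr Q'))"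
      by (intro integrable_mult_right integrable_mult_left integrable_indicator_cball tail_int)+
    have "(LINT x|lebesgue. f k x) \<le> (LINT x|lebesgue. ?b t k x)"
      by (rule integral_mono[OF f_int b_int f_le[OF t]])
    also have "\<dots> = t powr Q * (LINT x|lebesgue. tail k x)
        + measure lebesgue (cball (0 :: real ^ 'n) (2 * real (Suc k))) * ((M / real (Suc k)) powr n / t powr Q')"
      using Bochner_Integration.integral_add[OF i] by simp
    also have "measure lebesgue (cball (0 :: real ^ 'n) (2 * real (Suc k))) = unit_ball_vol n * (2 * real (Suc k)) powr n"
      using content_cball[of "2 * real (Suc k)" "0 :: real ^ 'n"] by (simp add: n_def powr_realpow)
    also have "\<dots> * ((M / real (Suc k)) powr n / t powr Q') = V / t powr Q'"
    proof -
      have "(2 * real (Suc k)) powr n * (M / real (Suc k)) powr n = 2 powr n * M powr n"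
        using M(1) by (simp add: powr_mult powr_divide del: of_nat_Suc)
      then show ?thesis by (simp add: V_def mult.assoc del: of_nat_Suc)
    qed
    finally show ?thesis .
  qed
  have "(\<lambda>k. LINT x|lebesgue. f k x) \<longlonglongrightarrow> 0"
  proof (rule tendstoI)
    fix e :: real assume e: "e > 0"
    \<comment> \<open>Makes \<open>V / t powr Q'\<close> less than \<open>e / 2\<close>; with
      \<open>V + 1\<close> in place of \<open>V\<close> the base is positive even if
      \<open>V\<close> is 0. For this fixed \<open>t\<close>, the tail term becomes small as
      \<open>k\<close> grows.\<close>
    define t where "t = (2 * (V + 1) / e) powr (1 / Q')"
    have "2 * (V + 1) / e > 0" using V e by simp
    then have t: "t > 0" using V e by (simp add: t_def)
    have tQ: "t powr Q' = 2 * (V + 1) / e"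
    proof -
      have "1 / Q' * Q' = 1" using Q(2) by simp
      then have "t powr Q' = (2 * (V + 1) / e) powr 1" by (simp only: t_def powr_powr)
      also have "\<dots> = 2 * (V + 1) / e" using V e by (intro powr_one) auto
      finally show ?thesis .
    qed
    have "V / t powr Q' < e / 2" unfolding tQ using V e by (simp add: field_simps)
    moreover have "\<forall>\<^sub>F k in sequentially. t powr Q * (LINT x|lebesgue. tail k x) < e / 2"
      using tendsto_mult_right_zero[OF tail_lim[simplified], of "t powr Q"] e by (intro order_tendstoD(2)) auto
    ultimately show "\<forall>\<^sub>F k in sequentially. dist (LINT x|lebesgue. f k x) 0 < e"
    proof (elim eventually_mono)
      fix k assume "t powr Q * (LINT x|lebesgue. tail k x) < e / 2" "V / t powr Q' < e / 2"
      then have "(LINT x|lebesgue. f k x) < e" using int_le[OF t, of k] by linarith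
      moreover have "(LINT x|lebesgue. f k x) \<ge> 0" by (intro integral_nonneg_AE) (auto simp: f_def)
      ultimately show "dist (LINT x|lebesgue. f k x) 0 < e" by simp
    qed
  qed
  then show "(\<lambda>k. LINT x|lebesgue. norm (u x *\<^sub>R tgrad (cutoff (real (Suc k))) x) powr p) \<longlonglongrightarrow> 0"
    by (simp add: f_def)
qed

text \<open>Multiplication by wide cutoffs changes mass and Dirichlet integral arbitrarily little.
  Bounded supports are what later allows a translate to be disjoint from the original.\<close>

lemma compactly_supported_approx:
  fixes u :: "real ^ 'n::finite \<Rightarrow> real"
  assumes p: "1 < p" "p < real CARD('n)" and u: "u \<in> D1p p" "nonzero u" and K: "sobolev_quotient p u < K"
  shows "\<exists>w \<in> (D1p p :: (real ^ 'n \<Rightarrow> real) set). nonzero w \<and> sobolev_quotient p w < K \<and> (\<exists>R. \<forall>x. norm x \<ge> R \<longrightarrow> w x = 0)"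
proof -
  define q where "q = crit_exp CARD('n) p"
  define \<theta> where "\<theta> = p / q"
  have q: "q > p" and \<theta>: "\<theta> > 0" using crit_exp_facts[OF p] by (auto simp: q_def \<theta>_def)
  define G where "G = weak_grad u"
  note uG = D1pD[OF u(1), folded G_def q_def]
  let ?\<phi> = "\<lambda>k. cutoff (real (Suc k)) :: real ^ 'n \<Rightarrow> real"
  have \<phi>: "test_function (?\<phi> k)" for k by (rule test_cutoff) simp
  define w where "w k x = ?\<phi> k x * u x" for k x
  define H where "H k x = ?\<phi> k x *\<^sub>R G x + u x *\<^sub>R tgrad (?\<phi> k) x" for k x
  define g where "g k x = 2 powr p * norm (u x *\<^sub>R tgrad (?\<phi> k) x) powr p" for k x
  have wH: "has_weak_gradient (w k) (H k)" for k
    unfolding w_def[abs_def] H_def[abs_def] by (rule has_weak_gradient_test_mult[OF uG(1) \<phi>])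
  have g_int: "integrable lebesgue (g k)" for k
    unfolding g_def[abs_def] by (intro integrable_mult_right cutoff_gradient_term_tendsto[OF p u(1)])
  have g_lim: "(\<lambda>k. LINT x|lebesgue. g k x) \<longlonglongrightarrow> 0"
    unfolding g_def using tendsto_mult_right_zero[OF cutoff_gradient_term_tendsto(2)[OF p u(1)], of "2 powr p"] by simp
  have H_le: "norm (H k x) powr p \<le> 2 powr p * norm (G x) powr p + g k x" for k x
  proof -
    have "norm (H k x) \<le> norm (?\<phi> k x *\<^sub>R G x) + norm (u x *\<^sub>R tgrad (?\<phi> k) x)"
      unfolding H_def by (rule norm_triangle_ineq)
    also have "norm (?\<phi> k x *\<^sub>R G x) \<le> norm (G x)"
      using cutoff_bounds(3)[of "real (Suc k)" x] by (simp add: mult_left_le_one_le)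
    finally have "norm (H k x) powr p \<le> (norm (G x) + norm (u x *\<^sub>R tgrad (?\<phi> k) x)) powr p"
      using p by (intro powr_mono2) auto
    also have "\<dots> \<le> 2 powr p * (norm (G x) powr p + norm (u x *\<^sub>R tgrad (?\<phi> k) x) powr p)"
      using p by (intro powr_add_le) auto
    finally show ?thesis by (simp add: g_def distrib_left)
  qed
  have meas_H: "(\<lambda>x. norm (H k x) powr p) \<in> borel_measurable lebesgue" for k
    using locally_integrable_measurable[OF has_weak_gradient_locally_integrable(2)[OF wH]]
    by (intro powr_real_measurable) auto
  have GP: "integrable lebesgue (\<lambda>x. 2 powr p * norm (G x) powr p)" using uG(2) by simp
  have H_int: "integrable lebesgue (\<lambda>x. norm (H k x) powr p)" for k
    using H_le by (intro integrable_nonneg_bound[OF Bochner_Integration.integrable_add[OF GP g_int[of k]] meas_H]) auto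
  have tg0: "\<forall>\<^sub>F k in sequentially. ?\<phi> k x = 1 \<and> tgrad (?\<phi> k) x = 0" for x
    using eventually_le_real[of "norm x"]
  proof eventually_elim
    case (elim k)
    obtain M where "\<forall>r>0. \<forall>x::real ^ 'n. norm (tgrad (cutoff r) x) \<le> M / r \<and>
        (norm x < r \<or> norm x > 2 * r \<longrightarrow> tgrad (cutoff r) x = 0)"
      using tgrad_cutoff_bound by blast
    with elim show ?case by (auto intro!: cutoff_eq_1)
  qed
  \<comment> \<open>The powers of \<open>H k\<close> have no fixed integrable majorant at hand, but
    after subtraction of \<open>g k\<close>, which vanishes in the mean, they are dominated by
    \<open>2 powr p * norm (G x) powr p\<close>.\<close>
  have m_lim: "(\<lambda>k. LINT x|lebesgue. max 0 (norm (H k x) powr p - g k x)) \<longlonglongrightarrow> (LINT x|lebesgue. norm (G x) powr p)"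
  proof (rule integral_dominated_convergence[OF _ _ GP])
    show "AE x in lebesgue. (\<lambda>k. max 0 (norm (H k x) powr p - g k x)) \<longlonglongrightarrow> norm (G x) powr p"
    proof (intro AE_I2 tendsto_eventually)
      fix x
      show "\<forall>\<^sub>F k in sequentially. max 0 (norm (H k x) powr p - g k x) = norm (G x) powr p"
        using tg0[of x] by eventually_elim (simp add: H_def g_def)
    qed
    have "norm (max 0 (norm (H k x) powr p - g k x)) \<le> 2 powr p * norm (G x) powr p" for k x
    proof -
      have "0 \<le> 2 powr p * norm (G x) powr p" by simp
      then show ?thesis using H_le[of k x] by (simp add: max_def)
    qed
    then show "AE x in lebesgue. norm (max 0 (norm (H k x) powr p - g k x)) \<le> 2 powr p * norm (G x) powr p" for k
      by simp
  qed (use H_int g_int uG(2) in auto)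
  \<comment> \<open>An upper bound for the Dirichlet integral of \<open>w k\<close> with limit
    \<open>dirichlet p u\<close>; an upper bound is all that the strict inequality needs.\<close>
  define b where "b k = (LINT x|lebesgue. max 0 (norm (H k x) powr p - g k x)) + (LINT x|lebesgue. g k x)" for k
  have b_lim: "b \<longlonglongrightarrow> dirichlet p u"
    unfolding b_def[abs_def] using tendsto_add[OF m_lim g_lim] by (simp add: G_def)
  have H_b: "(LINT x|lebesgue. norm (H k x) powr p) \<le> b k" for k
  proof -
    have i: "integrable lebesgue (\<lambda>x. max 0 (norm (H k x) powr p - g k x))" using H_int g_int by auto
    have "(LINT x|lebesgue. norm (H k x) powr p) \<le> (LINT x|lebesgue. max 0 (norm (H k x) powr p - g k x) + g k x)"
      using Bochner_Integration.integrable_add[OF i g_int] by (intro integral_mono[OF H_int]) auto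
    also have "\<dots> = b k" unfolding b_def by (rule Bochner_Integration.integral_add[OF i g_int])
    finally show ?thesis .
  qed
  have w_le: "\<bar>w k x\<bar> powr q \<le> \<bar>u x\<bar> powr q" for k x
    using cutoff_bounds(3)[of "real (Suc k)" x] q p
    by (intro powr_mono2) (auto simp: w_def abs_mult mult_left_le_one_le)
  have w_meas: "(\<lambda>x. \<bar>w k x\<bar> powr q) \<in> borel_measurable lebesgue" for k
    using locally_integrable_measurable[OF has_weak_gradient_locally_integrable(1)[OF wH]]
    by (intro powr_real_measurable) auto
  have w_int: "integrable lebesgue (\<lambda>x. \<bar>w k x\<bar> powr q)" for k
    by (rule integrable_nonneg_bound[OF uG(3) w_meas _ w_le]) auto
  have w_lim: "(\<lambda>k. LINT x|lebesgue. \<bar>w k x\<bar> powr q) \<longlonglongrightarrow> (LINT x|lebesgue. \<bar>u x\<bar> powr q)"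
  proof (rule integral_dominated_convergence[OF _ w_meas uG(3)])
    show "AE x in lebesgue. (\<lambda>k. \<bar>w k x\<bar> powr q) \<longlonglongrightarrow> \<bar>u x\<bar> powr q"
    proof (intro AE_I2 tendsto_eventually)
      fix x
      show "\<forall>\<^sub>F k in sequentially. \<bar>w k x\<bar> powr q = \<bar>u x\<bar> powr q"
        using tg0[of x] by eventually_elim (simp add: w_def)
    qed
  qed (use w_le uG(3) in auto)
  have mass_pos: "(LINT x|lebesgue. \<bar>u x\<bar> powr q) > 0"
    by (rule integral_abs_powr_pos[OF uG(3) u(2)])
  have "(\<lambda>k. b k / (LINT x|lebesgue. \<bar>w k x\<bar> powr q) powr \<theta>) \<longlonglongrightarrow> dirichlet p u / (LINT x|lebesgue. \<bar>u x\<bar> powr q) powr \<theta>"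
    using mass_pos by (intro tendsto_divide b_lim tendsto_powr w_lim tendsto_const) auto
  moreover have "dirichlet p u / (LINT x|lebesgue. \<bar>u x\<bar> powr q) powr \<theta> < K"
    using K by (simp add: sobolev_quotient_def q_def \<theta>_def)
  ultimately have "\<forall>\<^sub>F k in sequentially. b k / (LINT x|lebesgue. \<bar>w k x\<bar> powr q) powr \<theta> < K"
    by (rule order_tendstoD(2))
  moreover have "\<forall>\<^sub>F k in sequentially. (LINT x|lebesgue. \<bar>w k x\<bar> powr q) > 0"
    by (rule order_tendstoD(1)[OF w_lim mass_pos])
  ultimately have "\<forall>\<^sub>F k in sequentially. b k / (LINT x|lebesgue. \<bar>w k x\<bar> powr q) powr \<theta> < K \<and> (LINT x|lebesgue. \<bar>w k x\<bar> powr q) > 0"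
    by (rule eventually_conj)
  then obtain k where k: "b k / (LINT x|lebesgue. \<bar>w k x\<bar> powr q) powr \<theta> < K" "(LINT x|lebesgue. \<bar>w k x\<bar> powr q) > 0"
    using eventually_happens' sequentially_bot by blast
  note w = D1pI[OF wH[of k] H_int w_int[unfolded q_def]]
  show ?thesis
  proof (intro bexI[of _ "w k"] conjI exI[of _ "2 * real (Suc k)"] allI impI)
    show "w k \<in> D1p p" by (rule w(1))
    show "nonzero (w k)"
      unfolding nonzero_def
    proof
      assume "AE x in lebesgue. w k x = 0"
      then have "AE x in lebesgue. \<bar>w k x\<bar> powr q = 0" by auto
      then have "(LINT x|lebesgue. \<bar>w k x\<bar> powr q) = 0" by (rule integral_eq_zero_AE)
      with k(2) show False by simp
    qed
    have "sobolev_quotient p (w k) \<le> b k / (LINT x|lebesgue. \<bar>w k x\<bar> powr q) powr \<theta>"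
      unfolding sobolev_quotient_def w(2) q_def[symmetric] \<theta>_def[symmetric]
      by (intro divide_right_mono H_b) auto
    with k(1) show "sobolev_quotient p (w k) < K" by linarith
    show "w k x = 0" if "norm x \<ge> 2 * real (Suc k)" for x
      using that by (simp add: w_def cutoff_eq_0)
  qed
qed

section \<open>The Nehari set\<close>

lemma coupling_term_bound:
  fixes a b \<alpha> \<beta> :: real
  assumes "\<alpha> > 0" "\<beta> > 0" "a \<ge> 0" "b \<ge> 0"
  shows "a powr \<alpha> * b powr \<beta> \<le> a powr (\<alpha> + \<beta>) + b powr (\<alpha> + \<beta>)"
proof -
  have "a powr \<alpha> * b powr \<beta> \<le> max a b powr \<alpha> * max a b powr \<beta>"
    using assms by (intro mult_mono powr_mono2) auto
  also have "\<dots> = max a b powr (\<alpha> + \<beta>)" by (simp add: powr_add)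
  also have "\<dots> \<le> a powr (\<alpha> + \<beta>) + b powr (\<alpha> + \<beta>)" by (simp add: max_def)
  finally show ?thesis .
qed

text \<open>Inserting m \<ge> a / \<mu> into the Sobolev inequality leaves S (a / \<mu>)^\<theta>
  \<le> a. Since 1 - \<theta> = p / n, division by a^\<theta> and the power n / p give the bound.
  Equality at the end forces equality in both inputs.\<close>

lemma mass_dirichlet_lower_bound:
  fixes a m S \<mu> n p \<theta> :: real
  assumes p: "1 < p" "p < n" and \<theta>: "\<theta> = (n - p) / n" and \<mu>: "\<mu> > 0" and m: "m > 0" and S: "S \<ge> 0"
    and sob: "S * m powr \<theta> \<le> a" and neh: "a \<le> \<mu> * m"
  shows "\<mu> powr (- ((n - p) / p)) * S powr (n / p) \<le> a"
    and "S > 0 \<Longrightarrow> a = \<mu> powr (- ((n - p) / p)) * S powr (n / p) \<Longrightarrow> a = S * m powr \<theta> \<and> a = \<mu> * m"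
proof -
  have \<theta>0: "\<theta> > 0" and n: "n > 0" using p by (auto simp: \<theta>)
  have e: "(1 - \<theta>) * (n / p) = 1" "\<theta> * (n / p) = (n - p) / p" using p by (auto simp: \<theta> field_simps)
  let ?b = "\<mu> powr (- ((n - p) / p)) * S powr (n / p)"
  have am: "S * (a / \<mu>) powr \<theta> \<le> S * m powr \<theta>" if "a \<ge> 0"
    using neh \<mu> S \<theta>0 that by (intro mult_left_mono powr_mono2) (auto simp: field_simps)
  have id: "?b = (S / \<mu> powr \<theta>) powr (n / p)" if "S > 0"
    using that \<mu> e by (simp add: powr_divide powr_powr powr_minus_divide)
  have a0: "a > 0" if "S > 0"
  proof -
    have "S * m powr \<theta> > 0" using that m by simp
    with sob show ?thesis by linarith
  qed
  have split: "a = a powr (1 - \<theta>) * a powr \<theta>" if "S > 0"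
    using a0[OF that] by (simp flip: powr_add)
  show "?b \<le> a"
  proof (cases "S = 0")
    case True
    then show ?thesis using sob by simp
  next
    case False
    then have S: "S > 0" using assms by simp
    have "S * (a / \<mu>) powr \<theta> \<le> a" using am sob a0[OF S] by simp
    then have "S / \<mu> powr \<theta> * a powr \<theta> \<le> a powr (1 - \<theta>) * a powr \<theta>"
      using a0[OF S] \<mu> split[OF S] by (simp add: powr_divide)
    then have "S / \<mu> powr \<theta> \<le> a powr (1 - \<theta>)"
      by (rule mult_right_le_imp_le) (use a0[OF S] in simp)
    then have "(S / \<mu> powr \<theta>) powr (n / p) \<le> (a powr (1 - \<theta>)) powr (n / p)"
      using S p n by (intro powr_mono2) auto
    also have "\<dots> = a" using a0[OF S] by (simp only: powr_powr e powr_one less_imp_le)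
    finally show ?thesis using id[OF S] by simp
  qed
  assume S: "S > 0" and eq: "a = ?b"
  have "a powr (1 - \<theta>) = S / \<mu> powr \<theta>"
  proof -
    have "(n / p) * (1 - \<theta>) = 1" using e(1) by (simp only: mult.commute)
    moreover have "S / \<mu> powr \<theta> > 0" using S \<mu> by simp
    ultimately show ?thesis unfolding eq id[OF S] powr_powr by (simp only: powr_one less_imp_le)
  qed
  then have a: "a = S * (a / \<mu>) powr \<theta>"
    using split[OF S] a0[OF S] \<mu> by (simp add: powr_divide)
  with am sob a0[OF S] have e1: "a = S * m powr \<theta>" "S * (a / \<mu>) powr \<theta> = S * m powr \<theta>" by auto
  then have "(a / \<mu>) powr \<theta> = m powr \<theta>" using S by simp
  then have "((a / \<mu>) powr \<theta>) powr (1 / \<theta>) = (m powr \<theta>) powr (1 / \<theta>)" by simp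
  then have "a / \<mu> = m" using \<theta>0 a0[OF S] \<mu> m by (simp add: powr_powr)
  then have "a = \<mu> * m" using \<mu> by (simp add: field_simps)
  with e1(1) show "a = S * m powr \<theta> \<and> a = \<mu> * m" by blast
qed

context
  fixes p \<alpha> \<beta> \<mu>\<^sub>1 \<mu>\<^sub>2 \<gamma> q S n :: real
    and nehari_set :: "((real ^ 'n::finite \<Rightarrow> real) \<times> (real ^ 'n \<Rightarrow> real)) set"
  assumes p: "1 < p" "p < real CARD('n)"
    and \<alpha>: "\<alpha> > 1" and \<beta>: "\<beta> > 1" and \<alpha>\<beta>': "\<alpha> + \<beta> = crit_exp CARD('n) p"
    and \<mu>: "\<mu>\<^sub>1 > 0" "\<mu>\<^sub>2 > 0" and \<gamma>: "\<gamma> < 0"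
    and nehari_set_def: "nehari_set = nehari p \<alpha> \<beta> \<mu>\<^sub>1 \<mu>\<^sub>2 \<gamma>"
    and q_def: "q = crit_exp CARD('n) p" and S_def: "S = sobolev_const TYPE('n) p" and n_def: "n = real CARD('n)"
begin

text \<open>The infimum of the Dirichlet integral over the Nehari set of the scalar equation with
  coefficient \<mu>, that is, \<open>n\<close> times its least energy.\<close>

abbreviation "level \<mu> \<equiv> \<mu> powr (- ((n - p) / p)) * S powr (n / p)"
abbreviation mass :: "(real ^ 'n \<Rightarrow> real) \<Rightarrow> real" where
  "mass u \<equiv> (LINT x|lebesgue. \<bar>u x\<bar> powr q)"
abbreviation coupling :: "(real ^ 'n \<Rightarrow> real) \<Rightarrow> (real ^ 'n \<Rightarrow> real) \<Rightarrow> real" where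
  "coupling u v \<equiv> (LINT x|lebesgue. \<bar>u x\<bar> powr \<alpha> * \<bar>v x\<bar> powr \<beta>)"

lemmas crit = crit_exp_facts[OF p, folded q_def n_def]
lemmas D1p_mass_integrable = D1pD(3)[where 'n = 'n, of _ p, folded q_def]
lemmas D1p_intro = D1pI[where 'n = 'n and p = p, folded q_def]
lemmas mass_cmult = D1p_cmult(3)[where 'n = 'n and p = p, folded q_def]
lemmas mass_shift = D1p_shift(3)[where 'n = 'n and p = p, folded q_def]
lemmas quotient_eq = sobolev_quotient_def[where 'n = 'n and p = p, folded q_def]
lemmas sob = sobolev_inequality[where 'n = 'n, OF p, folded q_def S_def]
lemmas S_nonneg = sobolev_const_nonneg[where 'n = 'n, OF p, folded S_def]

lemmas \<alpha>\<beta> = \<alpha>\<beta>'[folded q_def]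

lemma q_pos: "q > 0" using crit(1) p(1) by linarith

lemma n_pos: "n > 0" using p n_def by linarith

lemma coupling_integrable:
  fixes u v :: "real ^ 'n \<Rightarrow> real"
  assumes "u \<in> D1p p" "v \<in> D1p p"
  shows "integrable lebesgue (\<lambda>x. \<bar>u x\<bar> powr \<alpha> * \<bar>v x\<bar> powr \<beta>)"
proof (rule integrable_nonneg_bound)
  show "integrable lebesgue (\<lambda>x. \<bar>u x\<bar> powr q + \<bar>v x\<bar> powr q)"
    by (intro Bochner_Integration.integrable_add D1p_mass_integrable assms)
  show "(\<lambda>x. \<bar>u x\<bar> powr \<alpha> * \<bar>v x\<bar> powr \<beta>) \<in> borel_measurable lebesgue"
    using D1pD(4)[OF assms(1)] D1pD(4)[OF assms(2)]
    by (intro borel_measurable_times powr_real_measurable) auto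
  show "\<bar>u x\<bar> powr \<alpha> * \<bar>v x\<bar> powr \<beta> \<le> \<bar>u x\<bar> powr q + \<bar>v x\<bar> powr q" for x
    using coupling_term_bound[of \<alpha> \<beta> "\<bar>u x\<bar>" "\<bar>v x\<bar>"] \<alpha> \<beta> by (simp add: \<alpha>\<beta>)
qed auto

lemma coupling_nonneg: "coupling u v \<ge> 0"
  by (intro integral_nonneg_AE) auto

text \<open>Splitting the integrals is legitimate because mass and coupling densities are integrable
  on \<open>D1p\<close>; outside \<open>D1p\<close> both sides are false.\<close>

lemma nehari_iff:
  "(u, v) \<in> nehari_set \<longleftrightarrow> u \<in> D1p p \<and> v \<in> D1p p \<and> nonzero u \<and> nonzero v \<and>
     dirichlet p u = \<mu>\<^sub>1 * mass u + \<alpha> * \<gamma> / q * coupling u v \<and>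
     dirichlet p v = \<mu>\<^sub>2 * mass v + \<beta> * \<gamma> / q * coupling u v"
proof -
  have split: "(LINT x|lebesgue. c * \<bar>w x\<bar> powr q + d * \<bar>u x\<bar> powr \<alpha> * \<bar>v x\<bar> powr \<beta>) = c * mass w + d * coupling u v"
    if "w \<in> D1p p" "u \<in> D1p p" "v \<in> D1p p" for c d and w :: "real ^ 'n \<Rightarrow> real"
    using Bochner_Integration.integral_add[OF integrable_mult_right[OF D1p_mass_integrable[OF that(1)], of c]
        integrable_mult_right[OF coupling_integrable[OF that(2,3)], of d]]
    by (simp add: mult.assoc)
  show ?thesis
  proof (cases "u \<in> D1p p \<and> v \<in> D1p p")
    case True
    then have uv: "u \<in> D1p p" "v \<in> D1p p" by auto
    show ?thesis
      unfolding nehari_set_def nehari_def mem_Collect_eq prod.case q_def[symmetric]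
        split[OF uv(1) uv] split[OF uv(2) uv] ..
  qed (auto simp: nehari_set_def nehari_def)
qed

text \<open>Since (\<alpha> + \<beta>) / q = 1, the two constraints add up to the whole potential
  integral, and 1/p - 1/q = 1/n remains as coefficient.\<close>

lemma energy_on_nehari:
  assumes "(u, v) \<in> nehari_set"
  shows "energy p \<alpha> \<beta> \<mu>\<^sub>1 \<mu>\<^sub>2 \<gamma> u v = 1 / n * (dirichlet p u + dirichlet p v)"
proof -
  have u: "u \<in> D1p p" "v \<in> D1p p"
    and eq: "dirichlet p u = \<mu>\<^sub>1 * mass u + \<alpha> * \<gamma> / q * coupling u v"
      "dirichlet p v = \<mu>\<^sub>2 * mass v + \<beta> * \<gamma> / q * coupling u v"
    using assms by (auto simp: nehari_iff)
  have i: "integrable lebesgue (\<lambda>x. \<mu>\<^sub>1 * \<bar>u x\<bar> powr q)" "integrable lebesgue (\<lambda>x. \<mu>\<^sub>2 * \<bar>v x\<bar> powr q)"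
    "integrable lebesgue (\<lambda>x. \<gamma> * (\<bar>u x\<bar> powr \<alpha> * \<bar>v x\<bar> powr \<beta>))"
    by (intro integrable_mult_right D1p_mass_integrable coupling_integrable u)+
  have "(LINT x|lebesgue. \<mu>\<^sub>1 * \<bar>u x\<bar> powr q + \<mu>\<^sub>2 * \<bar>v x\<bar> powr q + \<gamma> * \<bar>u x\<bar> powr \<alpha> * \<bar>v x\<bar> powr \<beta>)
      = \<mu>\<^sub>1 * mass u + \<mu>\<^sub>2 * mass v + \<gamma> * coupling u v"
    using Bochner_Integration.integral_add[OF Bochner_Integration.integrable_add[OF i(1,2)] i(3)]
      Bochner_Integration.integral_add[OF i(1,2)] by (simp add: mult.assoc)
  also have "\<dots> = dirichlet p u + dirichlet p v"
  proof -
    have "\<alpha> * \<gamma> / q * coupling u v + \<beta> * \<gamma> / q * coupling u v = (\<alpha> + \<beta>) / q * (\<gamma> * coupling u v)"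
      by (simp add: algebra_simps add_divide_distrib)
    also have "\<dots> = \<gamma> * coupling u v" using \<alpha>\<beta> q_pos by simp
    finally show ?thesis using eq by linarith
  qed
  finally have "energy p \<alpha> \<beta> \<mu>\<^sub>1 \<mu>\<^sub>2 \<gamma> u v = 1 / p * (dirichlet p u + dirichlet p v) - 1 / q * (dirichlet p u + dirichlet p v)"
    using Bochner_Integration.integral_add[OF D1pD(2)[OF u(1)] D1pD(2)[OF u(2)]] by (simp add: energy_def flip: q_def)
  also have "\<dots> = (1 / p - 1 / q) * (dirichlet p u + dirichlet p v)" by (simp only: left_diff_distrib)
  finally show ?thesis by (simp only: crit(7))
qed

lemma level_le_dirichlet:
  assumes w: "w \<in> D1p p" "nonzero w" and \<mu>: "\<mu> > 0" and le: "dirichlet p w \<le> \<mu> * mass w"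
  shows "level \<mu> \<le> dirichlet p w"
    and "S > 0 \<Longrightarrow> dirichlet p w = level \<mu> \<Longrightarrow>
      dirichlet p w = S * mass w powr (p / q) \<and> dirichlet p w = \<mu> * mass w"
  using mass_dirichlet_lower_bound[OF p(1) p(2)[folded n_def] crit(2) \<mu> integral_abs_powr_pos[OF D1p_mass_integrable[OF w(1)] w(2)]
      S_nonneg sob[OF w(1)] le] by auto

text \<open>A negative \<gamma> turns each constraint into a scalar inequality between Dirichlet
  integral and mass, so the two components are bounded independently.\<close>

lemma nehari_lower:
  assumes "(u, v) \<in> nehari_set"
  shows "dirichlet p u \<le> \<mu>\<^sub>1 * mass u" "dirichlet p v \<le> \<mu>\<^sub>2 * mass v"
    "level \<mu>\<^sub>1 \<le> dirichlet p u" "level \<mu>\<^sub>2 \<le> dirichlet p v"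
proof -
  note uv = assms[unfolded nehari_iff]
  have "\<alpha> * \<gamma> / q \<le> 0" "\<beta> * \<gamma> / q \<le> 0"
    using \<alpha> \<beta> \<gamma> q_pos by (auto intro!: divide_nonpos_pos mult_nonneg_nonpos)
  then have "\<alpha> * \<gamma> / q * coupling u v \<le> 0" "\<beta> * \<gamma> / q * coupling u v \<le> 0"
    by (blast intro: mult_nonpos_nonneg coupling_nonneg)+
  with uv show le: "dirichlet p u \<le> \<mu>\<^sub>1 * mass u" "dirichlet p v \<le> \<mu>\<^sub>2 * mass v" by linarith+
  show "level \<mu>\<^sub>1 \<le> dirichlet p u"
    by (rule level_le_dirichlet(1)[OF _ _ \<mu>(1) le(1)]) (use uv in blast)+
  show "level \<mu>\<^sub>2 \<le> dirichlet p v"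
    by (rule level_le_dirichlet(1)[OF _ _ \<mu>(2) le(2)]) (use uv in blast)+
qed

section \<open>The infimum and its non-attainment\<close>

text \<open>Dirichlet integral and mass scale with the different powers \<open>p\<close> and
  \<open>q\<close>, so one factor balances them. The balanced Dirichlet integral depends on
  \<open>w\<close> only through the scale-invariant Sobolev quotient.\<close>

lemma nehari_scaling:
  assumes w: "w \<in> D1p p" "nonzero w" and \<mu>: "\<mu> > 0"
  shows "\<exists>c>0. dirichlet p (\<lambda>x. c * w x) = \<mu> * mass (\<lambda>x. c * w x) \<and>
    dirichlet p (\<lambda>x. c * w x) = \<mu> powr (- ((n - p) / p)) * sobolev_quotient p w powr (n / p)"
proof -
  define a where "a = dirichlet p w"
  define m where "m = mass w"
  have a: "a > 0" unfolding a_def by (rule dirichlet_pos[OF w])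
  have m: "m > 0" unfolding m_def by (rule integral_abs_powr_pos[OF D1p_mass_integrable[OF w(1)] w(2)])
  have n: "n > 0" "n - p > 0" using p by (auto simp: n_def)
  have qp: "q - p > 0" using crit(1) by simp
  \<comment> \<open>The positive solution of c^p a = \<mu> c^q m.\<close>
  define c where "c = (a / (\<mu> * m)) powr (1 / (q - p))"
  have c: "c > 0" using a m \<mu> by (simp add: c_def)
  have "c powr (q - p) = a / (\<mu> * m)"
    using a m \<mu> qp by (simp add: c_def powr_powr)
  then have "c powr q = c powr p * (a / (\<mu> * m))"
    using c by (simp add: powr_diff field_simps)
  then have eq: "c powr p * a = \<mu> * (c powr q * m)"
    using \<mu> m by (simp add: field_simps)
  have "c powr p = (a / (\<mu> * m)) powr ((n - p) / p)"
    using crit(6) by (simp add: c_def powr_powr)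
  then have "c powr p * a = \<mu> powr (- ((n - p) / p)) * (a powr ((n - p) / p) * a powr 1 / m powr ((n - p) / p))"
    using a m \<mu> by (simp add: powr_divide powr_mult powr_minus_divide)
  also have "a powr ((n - p) / p) * a powr 1 = a powr (n / p)"
  proof -
    have "(n - p) / p + 1 = n / p" using p by (simp add: field_simps)
    then show ?thesis by (simp only: flip: powr_add)
  qed
  also have "m powr ((n - p) / p) = (m powr (p / q)) powr (n / p)"
    using crit(5) by (simp add: powr_powr)
  also have "a powr (n / p) / (m powr (p / q)) powr (n / p) = sobolev_quotient p w powr (n / p)"
    using a m by (simp add: quotient_eq powr_divide a_def m_def)
  finally have "c powr p * a = \<mu> powr (- ((n - p) / p)) * sobolev_quotient p w powr (n / p)" .
  then show ?thesis
    using c eq D1p_cmult(2)[OF w(1) c] mass_cmult[OF w(1) c] by (intro exI[of _ c]) (simp add: a_def m_def n_def)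
qed

text \<open>Disjoint supports make the coupling integral 0, so the two constraints separate and each
  function can be rescaled on its own.\<close>

lemma nehari_disjoint_pair:
  assumes K: "S < K"
  shows "\<exists>(u, v) \<in> nehari_set. dirichlet p u + dirichlet p v
    \<le> (\<mu>\<^sub>1 powr (- ((n - p) / p)) + \<mu>\<^sub>2 powr (- ((n - p) / p))) * K powr (n / p)"
proof -
  have "\<exists>u\<in>{u \<in> (D1p p :: (real ^ 'n \<Rightarrow> real) set). nonzero u}. sobolev_quotient p u < K"
    using K nonzero_D1p_exists[OF p] unfolding S_def sobolev_const_alt
    by (subst (asm) cINF_less_iff) (auto intro!: bdd_belowI2[of _ 0] sobolev_quotient_nonneg)
  then obtain u where u: "u \<in> (D1p p :: (real ^ 'n \<Rightarrow> real) set)" "nonzero u" "sobolev_quotient p u < K"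
    by blast
  obtain w R where w: "w \<in> (D1p p :: (real ^ 'n \<Rightarrow> real) set)" "nonzero w" "sobolev_quotient p w < K"
    and R: "\<And>x. norm x \<ge> R \<Longrightarrow> w x = 0"
    using compactly_supported_approx[OF p u] by blast
  \<comment> \<open>If norm x < R, then norm (x + a) \<ge> 2 \<bar>R\<bar> - norm x \<ge> R, so the
    translate vanishes wherever \<open>w\<close> need not.\<close>
  obtain a :: "real ^ 'n" where a: "norm a = 2 * \<bar>R\<bar>"
    using vector_choose_size[of "2 * \<bar>R\<bar>"] by auto
  define z where "z x = w (x + a)" for x
  have disjoint: "w x = 0 \<or> z x = 0" for x
  proof (cases "norm x \<ge> R")
    case False
    then have "norm (x + a) \<ge> R" using norm_diff_ineq[of a x] a by (simp add: add.commute)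
    then show ?thesis using R by (simp add: z_def)
  qed (use R in simp)
  have z: "z \<in> D1p p" "dirichlet p z = dirichlet p w" "mass z = mass w"
    unfolding z_def[abs_def] by (rule D1p_shift(1,2)[OF w(1)] mass_shift[OF w(1)])+
  have zq: "sobolev_quotient p z = sobolev_quotient p w"
    unfolding quotient_eq z ..
  have "mass z > 0" unfolding z by (rule integral_abs_powr_pos[OF D1p_mass_integrable[OF w(1)] w(2)])
  have znz: "nonzero z"
    unfolding nonzero_def
  proof
    assume "AE x in lebesgue. z x = 0"
    then have "AE x in lebesgue. \<bar>z x\<bar> powr q = 0" by auto
    then have "mass z = 0" by (rule integral_eq_zero_AE)
    with \<open>mass z > 0\<close> show False by simp
  qed
  obtain c1 where c1: "c1 > 0" "dirichlet p (\<lambda>x. c1 * w x) = \<mu>\<^sub>1 * mass (\<lambda>x. c1 * w x)"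
    "dirichlet p (\<lambda>x. c1 * w x) = \<mu>\<^sub>1 powr (- ((n - p) / p)) * sobolev_quotient p w powr (n / p)"
    using nehari_scaling[OF w(1,2) \<mu>(1)] by blast
  obtain c2 where c2: "c2 > 0" "dirichlet p (\<lambda>x. c2 * z x) = \<mu>\<^sub>2 * mass (\<lambda>x. c2 * z x)"
    "dirichlet p (\<lambda>x. c2 * z x) = \<mu>\<^sub>2 powr (- ((n - p) / p)) * sobolev_quotient p z powr (n / p)"
    using nehari_scaling[OF z(1) znz \<mu>(2)] by blast
  have "coupling (\<lambda>x. c1 * w x) (\<lambda>x. c2 * z x) = 0"
  proof (rule integral_eq_zero_AE, rule AE_I2)
    show "\<bar>c1 * w x\<bar> powr \<alpha> * \<bar>c2 * z x\<bar> powr \<beta> = 0" for x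
      using disjoint[of x] by auto
  qed
  then have mem: "(\<lambda>x. c1 * w x, \<lambda>x. c2 * z x) \<in> nehari_set"
    using c1(1,2) c2(1,2) D1p_cmult(1,4)[OF w(1)] D1p_cmult(1,4)[OF z(1)] w(2) znz by (simp add: nehari_iff)
  have "sobolev_quotient p w powr (n / p) \<le> K powr (n / p)"
    using w(3) sobolev_quotient_nonneg[of p w] p n_pos by (intro powr_mono2) auto
  then have "dirichlet p (\<lambda>x. c1 * w x) + dirichlet p (\<lambda>x. c2 * z x)
      \<le> \<mu>\<^sub>1 powr (- ((n - p) / p)) * K powr (n / p)
        + \<mu>\<^sub>2 powr (- ((n - p) / p)) * K powr (n / p)"
    unfolding c1(3) c2(3) zq by (intro add_mono mult_left_mono) auto
  then show ?thesis using mem by (intro bexI[OF _ mem]) (simp add: distrib_right)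
qed

lemma least_energy_eq:
  "least_energy TYPE('n) p \<alpha> \<beta> \<mu>\<^sub>1 \<mu>\<^sub>2 \<gamma> = 1 / n * (level \<mu>\<^sub>1 + level \<mu>\<^sub>2)"
proof (rule antisym)
  let ?I = "\<lambda>(u :: real ^ 'n \<Rightarrow> real, v). energy p \<alpha> \<beta> \<mu>\<^sub>1 \<mu>\<^sub>2 \<gamma> u v"
  have def: "least_energy TYPE('n) p \<alpha> \<beta> \<mu>\<^sub>1 \<mu>\<^sub>2 \<gamma> = Inf (?I ` nehari_set)"
    by (simp add: least_energy_def nehari_set_def)
  have lower: "1 / n * (level \<mu>\<^sub>1 + level \<mu>\<^sub>2) \<le> ?I z" if "z \<in> nehari_set" for z
  proof -
    obtain u v where z: "z = (u, v)" by (cases z)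
    have "level \<mu>\<^sub>1 + level \<mu>\<^sub>2 \<le> dirichlet p u + dirichlet p v"
      using nehari_lower(3,4)[of u v] that z by simp
    then have "1 / n * (level \<mu>\<^sub>1 + level \<mu>\<^sub>2) \<le> 1 / n * (dirichlet p u + dirichlet p v)"
      using n_pos by (intro mult_left_mono) auto
    then show ?thesis using energy_on_nehari[of u v] that z by simp
  qed
  have ne: "nehari_set \<noteq> {}" using nehari_disjoint_pair[of "S + 1"] by auto
  show "1 / n * (level \<mu>\<^sub>1 + level \<mu>\<^sub>2) \<le> least_energy TYPE('n) p \<alpha> \<beta> \<mu>\<^sub>1 \<mu>\<^sub>2 \<gamma>"
    unfolding def by (rule cINF_greatest[OF ne lower])
  let ?c = "\<mu>\<^sub>1 powr (- ((n - p) / p)) + \<mu>\<^sub>2 powr (- ((n - p) / p))"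
  have upper: "least_energy TYPE('n) p \<alpha> \<beta> \<mu>\<^sub>1 \<mu>\<^sub>2 \<gamma> \<le> 1 / n * (?c * K powr (n / p))"
    if K: "S < K" for K
  proof -
    obtain u v where uv: "(u, v) \<in> nehari_set"
      and le: "dirichlet p u + dirichlet p v \<le> ?c * K powr (n / p)"
      using nehari_disjoint_pair[OF K] by auto
    have "least_energy TYPE('n) p \<alpha> \<beta> \<mu>\<^sub>1 \<mu>\<^sub>2 \<gamma> \<le> ?I (u, v)"
      unfolding def by (rule cINF_lower[OF bdd_belowI2[OF lower] uv])
    also have "\<dots> = 1 / n * (dirichlet p u + dirichlet p v)"
      using energy_on_nehari[OF uv] by simp
    also have "\<dots> \<le> 1 / n * (?c * K powr (n / p))"
      using n_pos by (intro mult_left_mono le) auto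
    finally show ?thesis .
  qed
  \<comment> \<open>The bound holds for every K > S; letting K decrease to S needs continuity of the
    power at S, which for the positive exponent \<open>n / p\<close> includes S = 0.\<close>
  have "(\<lambda>k. S + inverse (real (Suc k))) \<longlonglongrightarrow> S + 0"
    by (intro tendsto_intros LIMSEQ_inverse_real_of_nat)
  then have "(\<lambda>k. 1 / n * (?c * (S + inverse (real (Suc k))) powr (n / p)))
      \<longlonglongrightarrow> 1 / n * (?c * (S + 0) powr (n / p))"
    using S_nonneg p n_pos
    by (intro tendsto_mult_left tendsto_powr' tendsto_const) (auto intro!: always_eventually add_nonneg_nonneg)
  then have "least_energy TYPE('n) p \<alpha> \<beta> \<mu>\<^sub>1 \<mu>\<^sub>2 \<gamma> \<le> 1 / n * (?c * (S + 0) powr (n / p))"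
    by (rule LIMSEQ_le_const) (intro exI allI impI upper, simp)
  then show "least_energy TYPE('n) p \<alpha> \<beta> \<mu>\<^sub>1 \<mu>\<^sub>2 \<gamma> \<le> 1 / n * (level \<mu>\<^sub>1 + level \<mu>\<^sub>2)"
    by (simp add: distrib_right)
qed

text \<open>Each component is at least its own level, so equality of the sums forces equality for
  \<open>u\<close>. This makes \<open>u\<close> extremal and satisfy the scalar constraint exactly,
  which leaves no room for the coupling.\<close>

lemma energy_not_least:
  assumes uv: "(u, v) \<in> nehari_set"
  shows "energy p \<alpha> \<beta> \<mu>\<^sub>1 \<mu>\<^sub>2 \<gamma> u v \<noteq> least_energy TYPE('n) p \<alpha> \<beta> \<mu>\<^sub>1 \<mu>\<^sub>2 \<gamma>"
proof
  assume "energy p \<alpha> \<beta> \<mu>\<^sub>1 \<mu>\<^sub>2 \<gamma> u v = least_energy TYPE('n) p \<alpha> \<beta> \<mu>\<^sub>1 \<mu>\<^sub>2 \<gamma>"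
  then have "dirichlet p u + dirichlet p v = level \<mu>\<^sub>1 + level \<mu>\<^sub>2"
    unfolding energy_on_nehari[OF uv] least_energy_eq using n_pos by simp
  then have eq: "dirichlet p u = level \<mu>\<^sub>1"
    using nehari_lower(3,4)[OF uv] by linarith
  have u: "u \<in> D1p p" "nonzero u" and v: "v \<in> D1p p" "nonzero v"
    and neh: "dirichlet p u = \<mu>\<^sub>1 * mass u + \<alpha> * \<gamma> / q * coupling u v"
    using uv by (auto simp: nehari_iff)
  \<comment> \<open>For S = 0 the level would be 0, contradicting
    \<open>dirichlet_pos\<close>.\<close>
  have "S \<noteq> 0"
  proof
    assume "S = 0"
    then have "dirichlet p u = 0" using eq by simp
    with dirichlet_pos[OF u] show False by simp
  qed
  then have S: "S > 0" using S_nonneg by simp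
  have ext: "dirichlet p u = S * mass u powr (p / q)" and mass: "dirichlet p u = \<mu>\<^sub>1 * mass u"
    using level_le_dirichlet(2)[OF u \<mu>(1) nehari_lower(1)[OF uv] S eq] by auto
  have "\<alpha> * \<gamma> / q * coupling u v = 0" using neh mass by linarith
  then have "coupling u v = 0" using \<alpha> \<gamma> q_pos by auto
  then have "AE x in lebesgue. \<bar>u x\<bar> powr \<alpha> * \<bar>v x\<bar> powr \<beta> = 0"
    using coupling_integrable[OF u(1) v(1)] by (subst (asm) integral_nonneg_eq_0_iff_AE) auto
  moreover have "AE x in lebesgue. u x \<noteq> 0"
  proof (rule extremal_nonvanishing[OF p(1) q_pos crit(4) less_imp_le[OF S] D1pD(1,2)[OF u(1)]
        D1p_mass_integrable[OF u(1)] ext])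
    fix w :: "real ^ 'n \<Rightarrow> real" and H
    assume "has_weak_gradient w H" "integrable lebesgue (\<lambda>x. norm (H x) powr p)"
      "integrable lebesgue (\<lambda>x. \<bar>w x\<bar> powr q)"
    from D1p_intro[OF this] sob[of w]
    show "S * mass w powr (p / q) \<le> (LINT x|lebesgue. norm (H x) powr p)" by simp
  qed (use u(2) in \<open>simp add: nonzero_def\<close>)
  ultimately have "AE x in lebesgue. v x = 0" by eventually_elim auto
  with v(2) show False by (simp add: nonzero_def)
qed

end

theorem theorem1p1:
  fixes p \<alpha> \<beta> \<mu>\<^sub>1 \<mu>\<^sub>2 \<gamma> :: real and N :: nat
  defines "N \<equiv> CARD('n::finite)"
  assumes "N \<ge> 3"
    and "1 < p" and "p < real N"
    and "\<alpha> > 1" and "\<beta> > 1" and "\<alpha> + \<beta> = crit_exp N p"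
    and "\<mu>\<^sub>1 > 0" and "\<mu>\<^sub>2 > 0" and "\<gamma> < 0"
  shows "least_energy TYPE('n) p \<alpha> \<beta> \<mu>\<^sub>1 \<mu>\<^sub>2 \<gamma> =
           1 / real N *
           (\<mu>\<^sub>1 powr (- ((real N - p) / p)) + \<mu>\<^sub>2 powr (- ((real N - p) / p))) *
           sobolev_const TYPE('n) p powr (real N / p)
         \<and> \<not> (\<exists>(u, v) \<in> (nehari p \<alpha> \<beta> \<mu>\<^sub>1 \<mu>\<^sub>2 \<gamma> ::
                 ((real ^ 'n \<Rightarrow> real) \<times> (real ^ 'n \<Rightarrow> real)) set).
                energy p \<alpha> \<beta> \<mu>\<^sub>1 \<mu>\<^sub>2 \<gamma> u v = least_energy TYPE('n) p \<alpha> \<beta> \<mu>\<^sub>1 \<mu>\<^sub>2 \<gamma>)"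
proof -
  \<comment> \<open>The four reflexivity facts instantiate the abbreviating equations for
    \<open>nehari_set\<close>, \<open>q\<close>, \<open>S\<close> and \<open>n\<close>.\<close>
  note hyps = assms(3-10)[unfolded N_def] refl refl refl refl
  have "least_energy TYPE('n) p \<alpha> \<beta> \<mu>\<^sub>1 \<mu>\<^sub>2 \<gamma> =
     1 / real N * (\<mu>\<^sub>1 powr (- ((real N - p) / p)) + \<mu>\<^sub>2 powr (- ((real N - p) / p))) *
     sobolev_const TYPE('n) p powr (real N / p)"
    unfolding N_def least_energy_eq[OF hyps] by (simp add: distrib_right add_divide_distrib)
  moreover have "energy p \<alpha> \<beta> \<mu>\<^sub>1 \<mu>\<^sub>2 \<gamma> u v \<noteq> least_energy TYPE('n) p \<alpha> \<beta> \<mu>\<^sub>1 \<mu>\<^sub>2 \<gamma>"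
    if "(u, v) \<in> nehari p \<alpha> \<beta> \<mu>\<^sub>1 \<mu>\<^sub>2 \<gamma>" for u v :: "real ^ 'n \<Rightarrow> real"
    by (rule energy_not_least[OF hyps that])
  ultimately show ?thesis by blast
qed

end
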